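(* Let $f\in L^1$ be a first-order Haar chaos. The following conditions are equivalent: (a) there is $p\in(1,2]$ such that $f\in L^p$ and the system of dilations and translations $\{f_n\}_{n\ge1}$ of $f$ is a basis of $L^p_0$ equivalent to the Haar system; (b) $f\in L^2$ and for every $p\in(1,2]$ the system $\{f_n\}_{n\ge1}$ is a basis of $L^p_0$ equivalent to the Haar system.
   Context: All functions are complex-valued on $I=(0,1]$; $L^p_0$ is the closed subspace of mean-zero functions in $L^p(0,1)$. Let $h=\chi_{(0,1/2]}-\chi_{(1/2,1]}$. For $n=2^k+j$ with $k\ge0$, $0\le j\le 2^k-1$, $h_n(t)=h(2^kt-j)$ for $t\in(j2^{-k},(j+1)2^{-k}]$ and $0$ otherwise. For mean-zero $f\in L^1$, the system of dilations and translations is $f_n(t)=f(2^kt-j)$ on $(j2^{-k},(j+1)2^{-k}]$, $0$ otherwise. A first-order Haar chaos is a function $f=\sum_{k\ge0}c_kh_{2^k}$, $c_k\in\mathbb C$ (a finite sum at each point). A sequence $\{f_n\}$ is a basis of $L^p_0$ equivalent to $\{h_n\}$ if there is a linear isomorphism of $L^p_0$ onto itself mapping $h_n$ to $f_n$ for all $n\ge1$. *)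

theory Defs
  imports "HOL-Analysis.Analysis" "HOL-Library.Discrete_Functions"
begin

definition I_meas :: "real measure" where
  "I_meas = lebesgue_on {0<..1}"

definition in_Lp :: "real \<Rightarrow> (real \<Rightarrow> complex) \<Rightarrow> bool" where
  "in_Lp p f \<longleftrightarrow> f \<in> borel_measurable I_meas \<and> integrable I_meas (\<lambda>t. norm (f t) powr p)"

definition Lp_norm :: "real \<Rightarrow> (real \<Rightarrow> complex) \<Rightarrow> real" where
  "Lp_norm p f = (integral\<^sup>L I_meas (\<lambda>t. norm (f t) powr p)) powr (1 / p)"

definition in_Lp0 :: "real \<Rightarrow> (real \<Rightarrow> complex) \<Rightarrow> bool" where
  "in_Lp0 p f \<longleftrightarrow> in_Lp p f \<and> integral\<^sup>L I_meas f = 0"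

definition haar :: "real \<Rightarrow> complex" where
  "haar t = (if 0 < t \<and> t \<le> 1/2 then 1 else if 1/2 < t \<and> t \<le> 1 then -1 else 0)"

definition dil :: "(real \<Rightarrow> complex) \<Rightarrow> nat \<Rightarrow> real \<Rightarrow> complex" where
  "dil f n t = (let k = floor_log n; j = n - 2 ^ k in
     if real j / 2 ^ k < t \<and> t \<le> (real j + 1) / 2 ^ k
     then f (2 ^ k * t - real j) else 0)"

definition haar_chaos1 :: "(real \<Rightarrow> complex) \<Rightarrow> bool" where
  "haar_chaos1 f \<longleftrightarrow> (\<exists>c :: nat \<Rightarrow> complex. \<forall>t \<in> {0<..1}.
      finite {k. c k * dil haar (2 ^ k) t \<noteq> 0} \<and>
      (\<lambda>k. c k * dil haar (2 ^ k) t) sums f t)"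

text \<open>{f_n} is a basis of L^p_0 equivalent to the Haar system: there is a linear
  isomorphism (bounded, bounded below, onto) of L^p_0 onto itself mapping h_n to f_n
  (identities understood almost everywhere, i.e. in L^p).\<close>
definition equiv_haar :: "real \<Rightarrow> (real \<Rightarrow> complex) \<Rightarrow> bool" where
  "equiv_haar p f \<longleftrightarrow> (\<exists>T :: (real \<Rightarrow> complex) \<Rightarrow> (real \<Rightarrow> complex).
      (\<forall>g. in_Lp0 p g \<longrightarrow> in_Lp0 p (T g)) \<and>
      (\<forall>g h a b. in_Lp0 p g \<longrightarrow> in_Lp0 p h \<longrightarrow>
          (AE t in I_meas. T (\<lambda>s. a * g s + b * h s) t = a * T g t + b * T h t)) \<and>
      (\<exists>C. \<forall>g. in_Lp0 p g \<longrightarrow> Lp_norm p (T g) \<le> C * Lp_norm p g) \<and>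
      (\<exists>c. \<forall>g. in_Lp0 p g \<longrightarrow> Lp_norm p g \<le> c * Lp_norm p (T g)) \<and>
      (\<forall>h. in_Lp0 p h \<longrightarrow> (\<exists>g. in_Lp0 p g \<and> (AE t in I_meas. T g t = h t))) \<and>
      (\<forall>n \<ge> 1. AE t in I_meas. T (dil haar n) t = dil f n t))"

end

(*
A first-order chaos with coefficients c acts on Haar coefficients by
  a(n) |-> sum over 2^i | n of c(i) a(n / 2^i),
where n >= 1 is a node of the binary tree with children 2n and 2n + 1.  Along each ray
m, 2m, 4m, ... with m odd this is multiplication of power series by sum c(i) z^i, and the inverse
operator comes from the reciprocal series.  Hence the system is a basis equivalent to the Haar
system iff both convolution operators are bounded on dyadic martingales in L^p, and it suffices to
show that, for 1 < p < 2, boundedness in L^p and in L^2 are the same.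

From L^2 to L^p: the operator is local (its value at a node depends only on the ancestors), so it
may be applied to the martingale stopped when its maximal function Mf exceeds 2^j times the mean;
summing the L^2 bounds of the stopped martingales with weights 2^(j(p-2)) bounds the integral of
|Tf|^2 (Mf)^(p-2) by that of (Mf)^p, and Doob's inequality finishes the argument.

From L^p to L^2: put a finite sequence x along rays inside many independent blocks of levels.  The
martingale is a sum of independent copies of one variable with variance the weighted l^2 norm of x;
its fourth moment shows that its L^p norm is comparable to its L^2 norm, so boundedness in L^p gives
the weighted l^2 bound for multiplication by the power series, which is boundedness in L^2.
*)
theory Submission
  imports Defs
begin


text \<open>The two transfers between exponents are not independent. Convolving the block sequence
  carries coefficients along each ray into the next block, so the image is no longer a sum of
  independent copies. Projecting back onto the chosen nodes repairs this, but the projection must be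
  bounded in L^p uniformly in the block length. It is local and contracts L^2, so the transfer from
  L^2 to L^p supplies the bound; this is why that transfer is proved for arbitrary local operators,
  with a constant depending only on p and on the L^2 bound. The fourth moment of a single block is
  not controlled by its variance either; for L blocks it enters with factor L against the leading
  L^2, and it disappears as L grows. Passing from the tree back to functions meets another obstacle:
  a bound at all finite levels does not yet exhibit a function with the convolved coefficients. For
  a Haar polynomial the image is found in L^2, where Parseval makes tails small uniformly in the
  level; density and the L^p bound do the rest. Realising the operator in L^p thus uses both
  bounds.\<close>

section \<open>Martingales on the binary tree\<close>

text \<open>The Haar function $h_n$ sits at node $n$, whose children $2n$ and $2n+1$ are the halves of its support where it
  is $1$ and $-1$; the value of \<open>mart a\<close> at a node is that of $\sum_n a_n h_n$ there, the sum being over the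
  proper ancestors of the node.  The junk node $0$ never matters.\<close>

fun mart :: "(nat \<Rightarrow> complex) \<Rightarrow> nat \<Rightarrow> complex" where
  [simp del]: "mart a n = (if n < 2 then 0 else
     mart a (n div 2) + (if even n then a (n div 2) else - a (n div 2)))"

text \<open>Dyadic conditional expectation at \<open>n\<close> of a function given \<open>e\<close>
  levels further down. All moments of martingales are expressed by its value at node 1.\<close>

fun tav :: "nat \<Rightarrow> (nat \<Rightarrow> real) \<Rightarrow> nat \<Rightarrow> real" where
  "tav 0 \<phi> n = \<phi> n"
| "tav (Suc e) \<phi> n = (tav e \<phi> (2 * n) + tav e \<phi> (2 * n + 1)) / 2"

lemma mart_less_two [simp]: "n < 2 \<Longrightarrow> mart a n = 0"
  by (simp add: mart.simps)

lemma mart_left: "n > 0 \<Longrightarrow> mart a (2 * n) = mart a n + a n"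
  by (subst mart.simps) simp

lemma mart_right: "n > 0 \<Longrightarrow> mart a (Suc (2 * n)) = mart a n - a n"
  by (subst mart.simps) simp

lemma floor_log_Suc_twice [simp]: "n > 0 \<Longrightarrow> floor_log (Suc (2 * n)) = Suc (floor_log n)"
  by (simp add: floor_log_rec)

lemma tav_mono:
  assumes "\<And>m. m div 2 ^ e = n \<Longrightarrow> \<phi> m \<le> \<psi> m"
  shows "tav e \<phi> n \<le> tav e \<psi> n"
  using assms
proof (induction e arbitrary: n)
  case (Suc e)
  have "tav e \<phi> (2 * n) \<le> tav e \<psi> (2 * n)"
  proof (rule Suc.IH)
    fix m assume "m div 2 ^ e = 2 * n"
    then have "m div 2 ^ Suc e = n" by (metis div_mult2_eq mult.commute nonzero_mult_div_cancel_left power_Suc zero_neq_numeral)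
    then show "\<phi> m \<le> \<psi> m" by (rule Suc.prems)
  qed
  moreover have "tav e \<phi> (2 * n + 1) \<le> tav e \<psi> (2 * n + 1)"
  proof (rule Suc.IH)
    fix m assume *: "m div 2 ^ e = 2 * n + 1"
    have "m div 2 ^ Suc e = m div 2 ^ e div 2"
      by (metis div_mult2_eq mult.commute power_Suc)
    then have "m div 2 ^ Suc e = n" using * by simp
    then show "\<phi> m \<le> \<psi> m" by (rule Suc.prems)
  qed
  ultimately show ?case by simp
qed simp

lemma tav_cong:
  assumes "\<And>m. m div 2 ^ e = n \<Longrightarrow> \<phi> m = \<psi> m"
  shows "tav e \<phi> n = tav e \<psi> n"
  using assms by (intro antisym tav_mono) auto

lemma tav_add: "tav e (\<lambda>m. \<phi> m + \<psi> m) n = tav e \<phi> n + tav e \<psi> n"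
  by (induction e arbitrary: n) (auto simp: add_divide_distrib)

lemma tav_cmult: "tav e (\<lambda>m. c * \<phi> m) n = c * tav e \<phi> n"
  by (induction e arbitrary: n) (auto simp: field_simps)

lemma tav_diff: "tav e (\<lambda>m. \<phi> m - \<psi> m) n = tav e \<phi> n - tav e \<psi> n"
  using tav_add[of e \<phi> "\<lambda>m. - 1 * \<psi> m"] tav_cmult[of e "- 1" \<psi>] by simp

lemma tav_const [simp]: "tav e (\<lambda>m. c) n = c"
  by (induction e arbitrary: n) auto

lemma tav_sum: "tav e (\<lambda>m. \<Sum>i\<in>A. \<phi> i m) n = (\<Sum>i\<in>A. tav e (\<phi> i) n)"
  by (induction A rule: infinite_finite_induct) (auto simp: tav_add)

lemma tav_nonneg: "(\<And>m. 0 \<le> \<phi> m) \<Longrightarrow> 0 \<le> tav e \<phi> n"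
  using tav_mono[of e n "\<lambda>_. 0" \<phi>] by simp

lemma tav_zero_imp:
  assumes "tav e \<phi> n = 0" "\<And>m. 0 \<le> \<phi> m" "\<And>m. \<phi> m = 0 \<Longrightarrow> \<psi> m = 0"
  shows "tav e \<psi> n = 0"
  using assms(1)
proof (induction e arbitrary: n)
  case (Suc e)
  have "tav e \<phi> (2 * n) \<ge> 0" "tav e \<phi> (2 * n + 1) \<ge> 0" by (auto intro: tav_nonneg assms)
  with Suc.prems have "tav e \<phi> (2 * n) = 0" "tav e \<phi> (2 * n + 1) = 0" by auto
  with Suc.IH show ?case by simp
qed (use assms in auto)

lemma tav_Suc': "tav (Suc e) \<phi> n = tav e (\<lambda>m. (\<phi> (2 * m) + \<phi> (Suc (2 * m))) / 2) n"
proof (induction e arbitrary: n)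
  case (Suc e)
  show ?case by (simp only: tav.simps(2)[of "Suc e" \<phi>] Suc.IH tav.simps(2)[of e "\<lambda>m. (\<phi> (2 * m) + \<phi> (Suc (2 * m))) / 2"])
qed simp

lemma tav_tav: "tav i (tav j \<phi>) n = tav (i + j) \<phi> n"
  by (induction i arbitrary: n) auto

text \<open>The tangent to \<open>x powr p / p\<close> at \<open>A\<close> lies below the graph. The
  maximal inequality and Jensen's inequality both rest on it.\<close>

lemma young_tangent:
  fixes p x A :: real
  assumes "1 < p" "0 \<le> x" "0 \<le> A"
  shows "x * A powr (p - 1) \<le> x powr p / p + (1 - 1 / p) * A powr p"
proof -
  define q where "q = p / (p - 1)"
  have q: "q > 1" "1 / p + 1 / q = 1" "1 / q = 1 - 1 / p" "(p - 1) * q = p"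
    using assms by (auto simp: q_def field_simps)
  have "x * A powr (p - 1) \<le> x powr p / p + (A powr (p - 1)) powr q / q"
    using assms q by (intro Youngs_inequality) auto
  also have "(A powr (p - 1)) powr q = A powr p" using q by (simp add: powr_powr)
  also have "A powr p / q = (1 - 1 / p) * A powr p" using q by (metis divide_inverse inverse_eq_divide mult.commute mult.right_neutral times_divide_eq_left)
  finally show ?thesis .
qed

text \<open>Below the threshold \<open>s\<close> the last term suffices; above it
  \<open>y powr (p - 2)\<close> is at most \<open>s powr (p - 2)\<close>, as the exponent is not
  positive. This is how second moments control p-th moments.\<close>

lemma powr_le_split:
  fixes p y s :: real
  assumes "0 < p" "p \<le> 2" "0 \<le> y" "0 < s"
  shows "y powr p \<le> s powr (p - 2) * y\<^sup>2 + s powr p"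
proof (cases "y \<le> s")
  case True
  then have "y powr p \<le> s powr p" using assms by (intro powr_mono2) auto
  then show ?thesis by (smt (verit) zero_le_mult_iff powr_ge_zero zero_le_power2)
next
  case False
  then have "y powr p = y powr (p - 2) * y\<^sup>2"
    using assms by (simp add: powr_diff powr_numeral power2_eq_square)
  also have "\<dots> \<le> s powr (p - 2) * y\<^sup>2"
    using False assms by (intro mult_right_mono powr_mono2') auto
  finally show ?thesis by (smt (verit) powr_ge_zero)
qed

section \<open>Local operators bounded in $L^2$ are bounded in $L^p$\<close>

fun runmax :: "(nat \<Rightarrow> real) \<Rightarrow> nat \<Rightarrow> real" where
  [simp del]: "runmax A n = (if n < 2 then A n else max (runmax A (n div 2)) (A n))"

lemma runmax_left: "n > 0 \<Longrightarrow> runmax A (2 * n) = max (runmax A n) (A (2 * n))"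
  by (subst runmax.simps) simp

lemma runmax_right: "n > 0 \<Longrightarrow> runmax A (Suc (2 * n)) = max (runmax A n) (A (Suc (2 * n)))"
  by (subst runmax.simps) simp

lemma runmax_ge: "A n \<le> runmax A n"
  by (subst runmax.simps) simp

lemma runmax_Suc_0 [simp]: "runmax A (Suc 0) = A (Suc 0)"
  by (subst runmax.simps) simp

text \<open>A potential function takes the place of the weak-type estimate: \<open>\<phi>\<close> is
  a supermartingale by the tangent inequality, and its value at the root is not positive.\<close>

lemma doob_maximal:
  fixes A :: "nat \<Rightarrow> real"
  assumes p: "1 < p" and nonneg: "\<And>n. 0 \<le> A n"
    and split: "\<And>n. n > 0 \<Longrightarrow> floor_log n < K \<Longrightarrow> A n = (A (2 * n) + A (Suc (2 * n))) / 2"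
  shows "tav K (\<lambda>n. runmax A n powr p) 1 \<le> 2 powr p / (p - 1) * tav K (\<lambda>n. A n powr p) 1"
proof -
  define c where "c = 1 - 1 / p"
  define \<phi> where "\<phi> n = c * runmax A n powr p - A n * runmax A n powr (p - 1)" for n
  have M0: "0 \<le> runmax A n" for n using nonneg[of n] runmax_ge[of A n] by linarith
  \<comment> \<open>Raising the maximum from \<open>M\<close> to \<open>B\<close> does not increase
    the potential: for \<open>B > M\<close> the left side is \<open>- B powr p / p\<close>, and the
    claim is the tangent inequality for \<open>B\<close> at the point \<open>M\<close>.\<close>
  have *: "c * (max M B) powr p - B * (max M B) powr (p - 1)
        \<le> c * M powr p - B * M powr (p - 1)" if "0 \<le> M" "0 \<le> B" for M B
  proof (cases "B \<le> M")
    case False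
    then have "B * B powr (p - 1) = B powr p" using that by (simp add: powr_mult_base)
    moreover have "c * B powr p = B powr p - B powr p / p" by (simp add: c_def algebra_simps)
    ultimately show ?thesis using False young_tangent[OF p that(2) that(1), folded c_def] by (simp add: max_def)
  qed (simp add: max_def)
  have step: "(\<phi> (2 * n) + \<phi> (Suc (2 * n))) / 2 \<le> \<phi> n" if n: "n > 0" "floor_log n < K" for n
  proof -
    have "\<phi> (2 * n) \<le> c * runmax A n powr p - A (2 * n) * runmax A n powr (p - 1)"
      using *[OF M0 nonneg] n by (simp add: \<phi>_def runmax_left)
    moreover have "\<phi> (Suc (2 * n)) \<le> c * runmax A n powr p - A (Suc (2 * n)) * runmax A n powr (p - 1)"
      using *[OF M0 nonneg] n by (simp add: \<phi>_def runmax_right)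
    moreover have "A n * runmax A n powr (p - 1) = (A (2 * n) * runmax A n powr (p - 1) + A (Suc (2 * n)) * runmax A n powr (p - 1)) / 2"
      by (subst split[OF n]) (simp add: distrib_right)
    moreover have "(x + y) / 2 \<le> m - w" if "x \<le> m - u" "y \<le> m - v" "w = (u + v) / 2" for x y m u v w :: real
      using that by (simp add: field_simps)
    ultimately show ?thesis unfolding \<phi>_def by metis
  qed
  have "tav k \<phi> n \<le> \<phi> n" if "n > 0" "floor_log n + k \<le> K" for k n
    using that
  proof (induction k arbitrary: n)
    case (Suc k)
    have "tav k \<phi> (2 * n) \<le> \<phi> (2 * n)" "tav k \<phi> (Suc (2 * n)) \<le> \<phi> (Suc (2 * n))"
      using Suc.prems by (auto intro!: Suc.IH)
    with step[of n] Suc.prems show ?case by simp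
  qed simp
  from this[of 1 K] have "tav K \<phi> 1 \<le> \<phi> 1" by simp
  also have "\<phi> 1 \<le> 0"
    using *[of 0 "A 1"] nonneg[of 1] p by (simp add: \<phi>_def c_def max_def split: if_splits)
  finally have "c * tav K (\<lambda>n. runmax A n powr p) 1 \<le> tav K (\<lambda>n. A n * runmax A n powr (p - 1)) 1"
    by (simp add: \<phi>_def[abs_def] tav_diff tav_cmult)
  also have "\<dots> \<le> tav K (\<lambda>n. 2 powr (p - 1) / p * A n powr p + c / 2 * runmax A n powr p) 1"
  proof (rule tav_mono)
    fix m
    \<comment> \<open>Doubling \<open>A m\<close> leaves the coefficient \<open>c / 2\<close> on the
      maximal term, half of what stands on the left, so that this term can be absorbed.\<close>
    have "2 * A m * runmax A m powr (p - 1) \<le> (2 * A m) powr p / p + c * runmax A m powr p"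
      using young_tangent[OF p _ M0, of "2 * A m", folded c_def] nonneg[of m] by simp
    moreover have "(2 * A m) powr p = 2 * (2 powr (p - 1) * A m powr p)"
      using nonneg[of m] by (simp add: powr_mult powr_diff)
    ultimately show "A m * runmax A m powr (p - 1) \<le> 2 powr (p - 1) / p * A m powr p + c / 2 * runmax A m powr p"
      by (simp add: field_simps)
  qed
  finally have "c / 2 * tav K (\<lambda>n. runmax A n powr p) 1 \<le> 2 powr (p - 1) / p * tav K (\<lambda>n. A n powr p) 1"
    unfolding tav_add tav_cmult by (simp add: field_simps)
  then have "c * tav K (\<lambda>n. runmax A n powr p) 1 \<le> 2 powr p / p * tav K (\<lambda>n. A n powr p) 1"
    by (simp add: powr_diff)
  then have "p * (c * tav K (\<lambda>n. runmax A n powr p) 1) \<le> p * (2 powr p / p * tav K (\<lambda>n. A n powr p) 1)"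
    using p by (intro mult_left_mono) auto
  moreover have "p * c = p - 1" using p by (simp add: c_def field_simps)
  ultimately have "(p - 1) * tav K (\<lambda>n. runmax A n powr p) 1 \<le> 2 powr p * tav K (\<lambda>n. A n powr p) 1"
    using p by (simp flip: mult.assoc)
  then show ?thesis using p by (simp add: le_divide_eq mult.commute)
qed

text \<open>The nodes \<open>n div 2 ^ i\<close> are \<open>n\<close> and its ancestors.\<close>

definition local_op :: "((nat \<Rightarrow> complex) \<Rightarrow> nat \<Rightarrow> complex) \<Rightarrow> bool" where
  "local_op T \<longleftrightarrow> (\<forall>a b n. n > 0 \<longrightarrow> (\<forall>i. 2 ^ i \<le> n \<longrightarrow> a (n div 2 ^ i) = b (n div 2 ^ i)) \<longrightarrow> T a n = T b n)"

text \<open>The thresholds are $\lambda_j = \alpha 2^j$, and $M$ is a value of the maximal function.\<close>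

lemma stopping_weights:
  fixes p \<alpha> M :: real
  assumes p: "1 < p" "p < 2" and \<alpha>: "0 < \<alpha>" and M: "\<alpha> \<le> M" "M \<le> \<alpha> * 2 ^ K"
  shows "\<exists>j\<le>K. M \<le> \<alpha> * 2 ^ j \<and> M powr (p - 2) \<le> 4 * (\<alpha> * 2 ^ j) powr (p - 2)"
    and "(\<Sum>j\<le>K. (\<alpha> * 2 ^ j) powr (p - 2) * (min (2 * (\<alpha> * 2 ^ j)) M)\<^sup>2)
          \<le> (16 + 1 / (1 - 2 powr (p - 2))) * M powr p"
proof -
  define l where "l j = \<alpha> * 2 ^ j" for j :: nat
  have l0: "l j > 0" for j using \<alpha> by (simp add: l_def)
  have lS: "l (Suc j) = 2 * l j" for j by (simp add: l_def)
  \<comment> \<open>The first threshold not below \<open>M\<close>. It satisfies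
    \<open>M \<le> l j0 \<le> 2 * M\<close>, so its weight is comparable to
    \<open>M powr (p - 2)\<close>.\<close>
  define j0 where "j0 = (LEAST j. M \<le> l j)"
  have j0: "M \<le> l j0" unfolding j0_def by (rule LeastI[of _ K]) (use M in \<open>simp add: l_def\<close>)
  have j0K: "j0 \<le> K" unfolding j0_def by (rule Least_le) (use M in \<open>simp add: l_def\<close>)
  have below: "l j < M" if "j < j0" for j using that not_less_Least j0_def by force
  have above: "M \<le> l j" if "j \<ge> j0" for j
    using j0 that \<alpha> by (simp add: l_def) (smt (verit) mult_left_mono power_increasing)
  have up: "l j0 \<le> 2 * M"
  proof (cases j0)
    case 0 then show ?thesis using M \<alpha> by (simp add: l_def)
  next
    case (Suc i) then show ?thesis using below[of i] by (simp add: lS)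
  qed
  have M0: "M > 0" using M \<alpha> by linarith
  have "4 * (l j0) powr (p - 2) \<ge> 4 * (2 * M) powr (p - 2)"
    using up l0 p by (intro mult_left_mono powr_mono2') auto
  also have "4 * (2 * M) powr (p - 2) = (4 * 2 powr (p - 2)) * M powr (p - 2)" using M0 by (simp add: powr_mult)
  also have "4 * 2 powr (p - 2) = (2::real) powr p" by (simp add: powr_diff powr_numeral)
  also have "(2::real) powr p * M powr (p - 2) \<ge> 1 * M powr (p - 2)"
    using p by (intro mult_right_mono) (auto simp: ge_one_powr_ge_zero)
  finally have "M powr (p - 2) \<le> 4 * l j0 powr (p - 2)" by simp
  with j0 j0K show "\<exists>j\<le>K. M \<le> \<alpha> * 2 ^ j \<and> M powr (p - 2) \<le> 4 * (\<alpha> * 2 ^ j) powr (p - 2)"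
    by (auto simp: l_def)
  define r where "r = (2::real) powr (p - 2)"
  have r: "0 < r" "r < 1" using p by (auto simp: r_def powr_less_one)
  have s1: "(\<Sum>j<J. l j powr p) \<le> l J powr p" for J
  proof (induction J)
    case (Suc J)
    have "2 powr p \<ge> (2::real) powr 1" using p by (intro powr_mono) auto
    then have "2 * l J powr p \<le> 2 powr p * l J powr p" by (intro mult_right_mono) auto
    also have "\<dots> = l (Suc J) powr p" using l0[of J] by (simp add: lS powr_mult)
    finally show ?case using Suc by simp
  qed simp
  have s2: "(1 - r) * (\<Sum>j\<in>{j0..<j0+i}. l j powr (p - 2)) = l j0 powr (p - 2) - l (j0 + i) powr (p - 2)" for i
  proof (induction i)
    case (Suc i)
    have "l (Suc (j0 + i)) powr (p - 2) = r * l (j0 + i) powr (p - 2)"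
      using l0[of "j0 + i"] by (simp add: lS powr_mult r_def)
    moreover have "(1 - r) * (\<Sum>j\<in>{j0..<j0 + Suc i}. l j powr (p - 2))
        = (1 - r) * (\<Sum>j\<in>{j0..<j0 + i}. l j powr (p - 2)) + (l (j0 + i) powr (p - 2) - r * l (j0 + i) powr (p - 2))"
      by (simp add: algebra_simps)
    ultimately show ?case using Suc by simp
  qed simp
  let ?f = "\<lambda>j. l j powr (p - 2) * (min (2 * l j) M)\<^sup>2"
  \<comment> \<open>Before \<open>j0\<close> the minimum is bounded by \<open>2 * l j\<close>, and
    the growing geometric sum gives 16. From \<open>j0\<close> on it is bounded by \<open>M\<close>,
    and the weights decay with ratio \<open>r < 1\<close>, which gives
    \<open>1 / (1 - r)\<close>.\<close>
  have "{..K} = {..<j0} \<union> {j0..<j0 + (Suc K - j0)}" using j0K by auto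
  then have "(\<Sum>j\<le>K. ?f j) = (\<Sum>j<j0. ?f j) + (\<Sum>j\<in>{j0..<j0 + (Suc K - j0)}. ?f j)"
    by (simp only:) (rule sum.union_disjoint, auto)
  also have "(\<Sum>j<j0. ?f j) \<le> (\<Sum>j<j0. 4 * l j powr p)"
  proof (rule sum_mono)
    fix j
    have "(min (2 * l j) M)\<^sup>2 \<le> (2 * l j)\<^sup>2" using l0[of j] M0 by (intro power_mono) auto
    then have "?f j \<le> l j powr (p - 2) * (2 * l j)\<^sup>2" by (intro mult_left_mono) auto
    also have "\<dots> = 4 * l j powr p" using l0[of j] by (simp add: powr_diff powr_numeral power2_eq_square)
    finally show "?f j \<le> 4 * l j powr p" .
  qed
  also have "\<dots> \<le> 4 * l j0 powr p" using s1[of j0] by (simp flip: sum_distrib_left)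
  also have "\<dots> \<le> 4 * (4 * M powr p)"
  proof -
    have "l j0 powr p \<le> (2 * M) powr p" using up l0[of j0] p by (intro powr_mono2) auto
    also have "\<dots> = 2 powr p * M powr p" using M0 by (simp add: powr_mult)
    also have "\<dots> \<le> 2 powr 2 * M powr p" using p by (intro mult_right_mono powr_mono) auto
    finally show ?thesis by (simp add: powr_numeral)
  qed
  also have "(\<Sum>j\<in>{j0..<j0 + (Suc K - j0)}. ?f j) \<le> (\<Sum>j\<in>{j0..<j0 + (Suc K - j0)}. M\<^sup>2 * l j powr (p - 2))"
  proof (rule sum_mono)
    fix j
    have "(min (2 * l j) M)\<^sup>2 \<le> M\<^sup>2" using l0[of j] M0 by (intro power_mono) auto
    then show "?f j \<le> M\<^sup>2 * l j powr (p - 2)"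
      by (metis mult.commute mult_left_mono powr_ge_zero)
  qed
  also have "\<dots> = M\<^sup>2 * ((l j0 powr (p - 2) - l (j0 + (Suc K - j0)) powr (p - 2)) / (1 - r))"
    using s2[of "Suc K - j0"] r by (simp add: eq_divide_eq mult.commute flip: sum_distrib_left)
  also have "\<dots> \<le> M\<^sup>2 * (M powr (p - 2) / (1 - r))"
  proof (intro mult_left_mono divide_right_mono)
    have "l j0 powr (p - 2) \<le> M powr (p - 2)" using M0 j0 p by (intro powr_mono2') auto
    then show "l j0 powr (p - 2) - l (j0 + (Suc K - j0)) powr (p - 2) \<le> M powr (p - 2)"
      by (smt (verit) powr_ge_zero)
  qed (use r in auto)
  also have "\<dots> = M powr p / (1 - r)" using M0 by (simp add: powr_diff powr_numeral)
  finally show "(\<Sum>j\<le>K. (\<alpha> * 2 ^ j) powr (p - 2) * (min (2 * (\<alpha> * 2 ^ j)) M)\<^sup>2)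
          \<le> (16 + 1 / (1 - 2 powr (p - 2))) * M powr p"
    by (simp add: l_def r_def algebra_simps)
qed


section \<open>Stopped martingales on the tree\<close>

lemma tree_induct [consumes 1, case_names one left right]:
  assumes "n > 0" "P (1::nat)" "\<And>n. n > 0 \<Longrightarrow> P n \<Longrightarrow> P (2 * n)" "\<And>n. n > 0 \<Longrightarrow> P n \<Longrightarrow> P (Suc (2 * n))"
  shows "P n"
  using assms(1)
proof (induction n rule: floor_log_induct)
  case (double n)
  then have "n div 2 > 0" by auto
  show ?case
  proof (cases "even n")
    case True
    then show ?thesis using assms(3)[OF \<open>n div 2 > 0\<close> double(2)] by simp
  next
    case False
    then have "Suc (2 * (n div 2)) = n" by presburger
    then show ?thesis using assms(4)[OF \<open>n div 2 > 0\<close> double(2)] by simp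
  qed
qed (use assms in auto)

lemma leaf_floor_log:
  assumes "m div 2 ^ K = (1::nat)"
  shows "m > 0" "floor_log m = K"
proof -
  have "2 ^ K * (m div 2 ^ K) \<le> m" "m < 2 ^ K * Suc (m div 2 ^ K)"
    using dividend_less_times_div[of "2 ^ K" m] by auto
  then have *: "2 ^ K \<le> m" "m < 2 * 2 ^ K" using assms by auto
  then show "m > 0" by (metis gr0I leD zero_less_numeral zero_less_power)
  then show "floor_log m = K" using * by (intro floor_log_eqI) auto
qed

lemma norm_mart_le_tav: "n > 0 \<Longrightarrow> norm (mart a n) \<le> tav e (\<lambda>m. norm (mart a m)) n"
proof (induction e arbitrary: n)
  case (Suc e)
  have eq: "mart a n = (mart a (2 * n) + mart a (Suc (2 * n))) / 2"
    using Suc.prems by (simp add: mart_left mart_right)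
  have "norm (mart a n) = norm (mart a (2 * n) + mart a (Suc (2 * n))) / 2"
    by (subst eq) (simp only: norm_divide norm_numeral)
  also have "\<dots> \<le> (norm (mart a (2 * n)) + norm (mart a (Suc (2 * n)))) / 2"
    by (intro divide_right_mono norm_triangle_ineq) simp
  also have "\<dots> \<le> tav (Suc e) (\<lambda>m. norm (mart a m)) n"
    using Suc.IH[of "2 * n"] Suc.IH[of "Suc (2 * n)"] Suc.prems by simp
  finally show ?case .
qed simp

text \<open>Stopping is done by deleting coefficients: \<open>runmax\<close> does not decrease along
  a path, so once it exceeds \<open>r\<close> all later coefficients vanish and the value is
  frozen.\<close>

definition stop :: "real \<Rightarrow> (nat \<Rightarrow> real) \<Rightarrow> (nat \<Rightarrow> complex) \<Rightarrow> nat \<Rightarrow> complex" where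
  "stop r A a n = (if runmax A n \<le> r then a n else 0)"

text \<open>The step across the threshold is still taken. As \<open>A\<close> is non-negative and
  the average of its two children, it at most doubles in one step; hence
  \<open>2 * r\<close>.\<close>

lemma mart_stop:
  assumes "n > 0" "floor_log n \<le> K" and lam: "A 1 \<le> r"
    and nonneg: "\<And>n. 0 \<le> A n"
    and bd: "\<And>n. n > 0 \<Longrightarrow> floor_log n \<le> K \<Longrightarrow> norm (mart a n) \<le> A n"
    and split: "\<And>n. n > 0 \<Longrightarrow> floor_log n < K \<Longrightarrow> A n = (A (2 * n) + A (Suc (2 * n))) / 2"
  shows "(runmax A n \<le> r \<longrightarrow> mart (stop r A a) n = mart a n) \<and>
    norm (mart (stop r A a) n) \<le> min (2 * r) (runmax A n)"
proof -
  have step: "(runmax A m \<le> r \<longrightarrow> mart (stop r A a) m = mart a m) \<and>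
    norm (mart (stop r A a) m) \<le> min (2 * r) (runmax A m)"
    if IH: "(runmax A n \<le> r \<longrightarrow> mart (stop r A a) n = mart a n) \<and>
    norm (mart (stop r A a) n) \<le> min (2 * r) (runmax A n)"
      and m: "m > 0" "floor_log m \<le> K" "A m \<le> 2 * A n"
      and eq: "\<And>b. mart b m = mart b n + \<epsilon> * b n" and M: "runmax A m = max (runmax A n) (A m)"
    for n m \<epsilon>
  proof (cases "runmax A n \<le> r")
    case True
    then have "mart (stop r A a) m = mart a m" using IH eq by (simp add: stop_def)
    moreover have "norm (mart a m) \<le> A m" using bd m by blast
    ultimately show ?thesis using True m M runmax_ge[of A n] by auto
  next
    case False
    then have "mart (stop r A a) m = mart (stop r A a) n" using eq by (simp add: stop_def)
    then show ?thesis using False IH M by auto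
  qed
  from assms(1,2) show ?thesis
  proof (induction n rule: tree_induct)
    case one
    then show ?case using lam nonneg[of 1] by simp
  next
    case (left n)
    then have "A (2 * n) \<le> 2 * A n" using split[of n] nonneg[of "Suc (2 * n)"] by simp
    with left show ?case
      by (intro step[of n "2 * n" 1]) (auto simp: mart_left runmax_left)
  next
    case (right n)
    then have "A (Suc (2 * n)) \<le> 2 * A n" using split[of n] nonneg[of "2 * n"] by simp
    with right show ?case
      by (intro step[of n "Suc (2 * n)" "-1"]) (auto simp: mart_right runmax_right)
  qed
qed

lemma runmax_ancestor: "2 ^ i \<le> n \<Longrightarrow> runmax A (n div 2 ^ i) \<le> runmax A n"
proof (induction i)
  case (Suc i)
  have n: "n div 2 ^ Suc i = n div 2 ^ i div 2"
    by (metis div_mult2_eq mult.commute power_Suc)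
  have "2 \<le> n div 2 ^ i" using Suc.prems by (simp add: less_eq_div_iff_mult_less_eq)
  then have "runmax A (n div 2 ^ i div 2) \<le> runmax A (n div 2 ^ i)"
    by (subst (2) runmax.simps) auto
  with Suc n show ?case by simp
qed simp

text \<open>No ancestor of \<open>n\<close> has been stopped, so locality makes the two images agree
  on the whole path to \<open>n\<close>.\<close>

lemma mart_local_stop:
  assumes T: "local_op T" and "n > 0" "runmax A n \<le> r"
  shows "mart (T (stop r A a)) n = mart (T a) n"
proof -
  have *: "T (stop r A a) n = T a n" if "n > 0" "runmax A n \<le> r" for n
  proof -
    have "stop r A a (n div 2 ^ i) = a (n div 2 ^ i)" if "2 ^ i \<le> n" for i
      using runmax_ancestor[OF that, of A] \<open>runmax A n \<le> r\<close> by (simp add: stop_def)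
    then show ?thesis using T that unfolding local_op_def by blast
  qed
  from assms(2,3) show ?thesis
  proof (induction n rule: tree_induct)
    case (left n)
    then show ?case using *[of n] by (simp add: mart_left runmax_left)
  next
    case (right n)
    then show ?case using *[of n] by (simp add: mart_right runmax_right)
  qed simp
qed

text \<open>One constant serves all local operators with the same L^2 bound. The order of the
  quantifiers matters: the result is later applied to the projections \<open>restr N\<close> with
  one constant for all \<open>N\<close>.\<close>

lemma local_op_bounded:
  fixes p B :: real
  assumes p: "1 < p" "p < 2" and B: "0 \<le> B"
  shows "\<exists>C\<ge>0. \<forall>T. local_op T \<longrightarrow>
    (\<forall>a k. tav k (\<lambda>n. (norm (mart (T a) n))\<^sup>2) 1 \<le> B * tav k (\<lambda>n. (norm (mart a n))\<^sup>2) 1) \<longrightarrow>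
    (\<forall>a k. tav k (\<lambda>n. norm (mart (T a) n) powr p) 1 \<le> C * tav k (\<lambda>n. norm (mart a n) powr p) 1)"
proof -
  define W where "W = 16 + 1 / (1 - 2 powr (p - 2))"
  define D where "D = 2 powr p / (p - 1)"
  have "(2::real) powr (p - 2) < 1" using p by (auto simp: powr_less_one)
  then have W: "W > 0" by (simp add: W_def add_pos_pos)
  have D: "D > 0" using p by (simp add: D_def)
  have "tav K (\<lambda>n. norm (mart (T a) n) powr p) 1 \<le> ((4 * B * W + 1) * D) * tav K (\<lambda>n. norm (mart a n) powr p) 1"
    if T: "local_op T"
      and L2: "\<And>a k. tav k (\<lambda>n. (norm (mart (T a) n))\<^sup>2) 1 \<le> B * tav k (\<lambda>n. (norm (mart a n))\<^sup>2) 1"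
    for T a K
  proof -
    \<comment> \<open>\<open>norm (mart a n)\<close> is only a submartingale and may jump by any
      factor. Its conditional expectation from level \<open>K\<close> is a martingale that dominates
      it, agrees with it at the leaves and at most doubles in one step.\<close>
    define A where "A n = tav (K - floor_log n) (\<lambda>m. norm (mart a m)) n" for n
    have nonneg: "0 \<le> A n" for n unfolding A_def by (intro tav_nonneg) simp
    have bd: "norm (mart a n) \<le> A n" if "n > 0" for n
      unfolding A_def by (rule norm_mart_le_tav[OF that])
    have split: "A n = (A (2 * n) + A (Suc (2 * n))) / 2" if "n > 0" "floor_log n < K" for n
    proof -
      have "K - floor_log n = Suc (K - Suc (floor_log n))" using that by simp
      then show ?thesis using that by (simp add: A_def)
    qed
    have leafA: "A m = norm (mart a m)" if "m div 2 ^ K = 1" for m :: nat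
      using leaf_floor_log[OF that] by (simp add: A_def)
    show ?thesis
    proof (cases "A 1 = 0")
      \<comment> \<open>The thresholds used below would all be 0. Here the martingale vanishes at
        level \<open>K\<close>, and the L^2 bound forces its image to vanish there as well.\<close>
      case True
      then have 0: "tav K (\<lambda>m. norm (mart a m)) 1 = 0" by (simp add: A_def)
      have "tav K (\<lambda>m. (norm (mart a m))\<^sup>2) 1 = 0" by (rule tav_zero_imp[OF 0]) auto
      with L2[of K a] have "tav K (\<lambda>m. (norm (mart (T a) m))\<^sup>2) 1 \<le> 0" by simp
      moreover have "tav K (\<lambda>m. (norm (mart (T a) m))\<^sup>2) 1 \<ge> 0" by (intro tav_nonneg) simp
      ultimately have "tav K (\<lambda>m. (norm (mart (T a) m))\<^sup>2) 1 = 0" by simp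
      then have "tav K (\<lambda>m. norm (mart (T a) m) powr p) 1 = 0" by (rule tav_zero_imp) auto
      then show ?thesis using B W D by (auto intro!: mult_nonneg_nonneg tav_nonneg)
    next
      case False
      define \<alpha> where "\<alpha> = A 1"
      have \<alpha>: "\<alpha> > 0" using False nonneg[of 1] by (simp add: \<alpha>_def)
      define M where "M = runmax A"
      \<comment> \<open>By doubling, the maximal function is at most \<open>\<alpha> * 2 ^ K\<close>
        at level \<open>K\<close>, so the thresholds with \<open>j \<le> K\<close> suffice.\<close>
      have M\<alpha>: "\<alpha> \<le> M n \<and> M n \<le> \<alpha> * 2 ^ floor_log n \<and> A n \<le> \<alpha> * 2 ^ floor_log n"
        if "n > 0" "floor_log n \<le> K" for n
        using that
      proof (induction n rule: tree_induct)
        case one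
        then show ?case by (simp add: M_def \<alpha>_def)
      next
        case (left n)
        then have "A (2 * n) \<le> 2 * A n" using split[of n] nonneg[of "Suc (2 * n)"] by simp
        with left \<alpha> show ?case by (auto simp: M_def runmax_left)
      next
        case (right n)
        then have "A (Suc (2 * n)) \<le> 2 * A n" using split[of n] nonneg[of "2 * n"] by simp
        with right \<alpha> show ?case by (auto simp: M_def runmax_right)
      qed
      define l where "l j = \<alpha> * 2 ^ j" for j :: nat
      have l\<alpha>: "\<alpha> \<le> l j" for j using \<alpha> by (simp add: l_def)
      let ?y = "\<lambda>n. norm (mart (T a) n)"
      let ?st = "\<lambda>j. stop (l j) A a"
      \<comment> \<open>At each leaf some threshold comparable to \<open>M\<close> is not exceeded,
        and there the stopped and the unstopped image coincide. Summing over all \<open>j\<close>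
        removes the dependence of this threshold on the leaf.\<close>
      have "tav K (\<lambda>n. ?y n powr p) 1 \<le> tav K (\<lambda>n. 4 * (\<Sum>j\<le>K. l j powr (p - 2) * (norm (mart (T (?st j)) n))\<^sup>2) + M n powr p) 1"
      proof (rule tav_mono)
        fix m :: nat assume m: "m div 2 ^ K = 1"
        note lf = leaf_floor_log[OF m]
        have Mm: "\<alpha> \<le> M m" "M m \<le> \<alpha> * 2 ^ K" using M\<alpha>[of m] lf by auto
        from stopping_weights(1)[OF p \<alpha> Mm] obtain j where
          j: "j \<le> K" "M m \<le> l j" "M m powr (p - 2) \<le> 4 * l j powr (p - 2)" by (auto simp: l_def)
        have eq: "mart (T (?st j)) m = mart (T a) m"
          using j lf T by (intro mart_local_stop) (auto simp: M_def)
        have "?y m powr p \<le> M m powr (p - 2) * (?y m)\<^sup>2 + M m powr p"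
          using p Mm \<alpha> by (intro powr_le_split) auto
        also have "M m powr (p - 2) * (?y m)\<^sup>2 \<le> 4 * l j powr (p - 2) * (?y m)\<^sup>2"
          using j by (intro mult_right_mono) auto
        also have "\<dots> = 4 * (l j powr (p - 2) * (norm (mart (T (?st j)) m))\<^sup>2)" using eq by simp
        also have "l j powr (p - 2) * (norm (mart (T (?st j)) m))\<^sup>2 \<le> (\<Sum>j\<le>K. l j powr (p - 2) * (norm (mart (T (?st j)) m))\<^sup>2)"
          using j(1) by (intro member_le_sum) auto
        finally show "?y m powr p \<le> 4 * (\<Sum>j\<le>K. l j powr (p - 2) * (norm (mart (T (?st j)) m))\<^sup>2) + M m powr p"
          by simp
      qed
      also have "\<dots> = 4 * (\<Sum>j\<le>K. l j powr (p - 2) * tav K (\<lambda>n. (norm (mart (T (?st j)) n))\<^sup>2) 1) + tav K (\<lambda>n. M n powr p) 1"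
        by (simp add: tav_add tav_cmult tav_sum)
      also have "(\<Sum>j\<le>K. l j powr (p - 2) * tav K (\<lambda>n. (norm (mart (T (?st j)) n))\<^sup>2) 1)
          \<le> (\<Sum>j\<le>K. l j powr (p - 2) * (B * tav K (\<lambda>n. (norm (mart (?st j) n))\<^sup>2) 1))"
        by (intro sum_mono mult_left_mono L2) auto
      also have "\<dots> = B * tav K (\<lambda>n. \<Sum>j\<le>K. l j powr (p - 2) * (norm (mart (?st j) n))\<^sup>2) 1"
        by (simp add: tav_cmult tav_sum sum_distrib_left algebra_simps)
      also have "\<dots> \<le> B * tav K (\<lambda>n. W * M n powr p) 1"
      proof (intro mult_left_mono B tav_mono)
        fix m :: nat assume m: "m div 2 ^ K = 1"
        note lf = leaf_floor_log[OF m]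
        have Mm: "\<alpha> \<le> M m" "M m \<le> \<alpha> * 2 ^ K" using M\<alpha>[of m] lf by auto
        have "(\<Sum>j\<le>K. l j powr (p - 2) * (norm (mart (?st j) m))\<^sup>2) \<le> (\<Sum>j\<le>K. l j powr (p - 2) * (min (2 * l j) (M m))\<^sup>2)"
        proof (intro sum_mono mult_left_mono power_mono)
          fix j
          show "norm (mart (?st j) m) \<le> min (2 * l j) (M m)"
            using mart_stop[of m K A "l j" a] lf l\<alpha>[of j] nonneg bd split by (simp add: M_def \<alpha>_def)
        qed auto
        also have "\<dots> \<le> W * M m powr p"
          using stopping_weights(2)[OF p \<alpha> Mm] by (simp add: l_def W_def)
        finally show "(\<Sum>j\<le>K. l j powr (p - 2) * (norm (mart (?st j) m))\<^sup>2) \<le> W * M m powr p" .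
      qed
      also have "4 * (B * tav K (\<lambda>n. W * M n powr p) 1) + tav K (\<lambda>n. M n powr p) 1 = (4 * B * W + 1) * tav K (\<lambda>n. M n powr p) 1"
        by (simp add: tav_cmult algebra_simps)
      also have "\<dots> \<le> (4 * B * W + 1) * (D * tav K (\<lambda>n. A n powr p) 1)"
        unfolding M_def D_def using B W by (intro mult_left_mono doob_maximal p nonneg split) auto
      also have "tav K (\<lambda>n. A n powr p) 1 = tav K (\<lambda>n. norm (mart a n) powr p) 1"
        by (intro tav_cong) (simp add: leafA)
      finally show ?thesis by (simp add: mult.assoc)
    qed
  qed
  moreover have "0 \<le> (4 * B * W + 1) * D" using B W D by simp
  ultimately show ?thesis by blast
qed


section \<open>Convolution along rays\<close>

text \<open>The bound \<open>i < n\<close> keeps the index set finite at the junk node 0, which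
  every power of two divides.\<close>

definition conv :: "(nat \<Rightarrow> complex) \<Rightarrow> (nat \<Rightarrow> complex) \<Rightarrow> nat \<Rightarrow> complex" where
  "conv c a n = (\<Sum>i | i < n \<and> 2 ^ i dvd n. c i * a (n div 2 ^ i))"

lemma conv_odd:
  assumes "odd m"
  shows "conv c a (2 ^ k * m) = (\<Sum>i\<le>k. c i * a (2 ^ (k - i) * m))"
proof -
  have m: "m > 0" using assms by (auto intro: gr0I)
  have "{i. i < 2 ^ k * m \<and> 2 ^ i dvd 2 ^ k * m} = {..k}"
  proof (intro equalityI subsetI)
    fix i assume "i \<in> {i. i < 2 ^ k * m \<and> 2 ^ i dvd 2 ^ k * m}"
    then have "(2::nat) ^ i dvd 2 ^ k" using assms
      by (simp add: coprime_dvd_mult_left_iff)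
    then show "i \<in> {..k}" by (simp add: power_dvd_imp_le)
  next
    fix i assume i: "i \<in> {..k}"
    have "k < 2 ^ k * m" using m by (metis less_exp mult.right_neutral less_le_trans mult_le_mono2 One_nat_def Suc_leI)
    then show "i \<in> {i. i < 2 ^ k * m \<and> 2 ^ i dvd 2 ^ k * m}" using i by (auto simp: le_imp_power_dvd)
  qed
  moreover have "2 ^ k * m div 2 ^ i = 2 ^ (k - i) * m" if "i \<le> k" for i
    using that by (metis div_mult_swap le_imp_power_dvd mult.commute power_diff zero_neq_numeral)
  ultimately show ?thesis by (simp add: conv_def)
qed

lemma conv_fps:
  assumes "odd m"
  shows "Abs_fps (\<lambda>k. conv c a (2 ^ k * m)) = Abs_fps c * Abs_fps (\<lambda>k. a (2 ^ k * m))"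
  using assms by (simp add: fps_eq_iff fps_mult_nth conv_odd atMost_atLeast0)

lemma nat_odd_decomp: "n > (0::nat) \<Longrightarrow> \<exists>k m. odd m \<and> n = 2 ^ k * m"
proof (induction n rule: less_induct)
  case (less n)
  show ?case
  proof (cases "odd n")
    case True
    then show ?thesis by (intro exI[of _ 0] exI[of _ n]) simp
  next
    case False
    then obtain n' where n': "n = 2 * n'" by blast
    with less.prems have "n' < n" "n' > 0" by auto
    from less.IH[OF this] obtain k m where "odd m" "n' = 2 ^ k * m" by blast
    then show ?thesis using n' by (intro exI[of _ "Suc k"] exI[of _ m]) simp
  qed
qed

lemma conv_inverse:
  assumes "Abs_fps c * Abs_fps d = 1" "n > 0"
  shows "conv c (conv d a) n = a n"
proof -
  obtain k m where m: "odd m" "n = 2 ^ k * m" using nat_odd_decomp[OF assms(2)] by blast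
  have "Abs_fps (\<lambda>k. conv c (conv d a) (2 ^ k * m)) = Abs_fps (\<lambda>k. a (2 ^ k * m))"
    using assms m(1) by (simp add: conv_fps flip: mult.assoc)
  then show ?thesis using m by (simp add: fps_eq_iff)
qed

lemma conv_add: "conv c (\<lambda>n. x * a n + y * b n) n = x * conv c a n + y * conv c b n"
  by (simp add: conv_def sum_distrib_left flip: sum.distrib) (simp add: algebra_simps)

lemma conv_diff: "conv c (\<lambda>n. a n - b n) n = conv c a n - conv c b n"
  by (simp add: conv_def right_diff_distrib sum_subtractf)

lemma local_op_conv: "local_op (conv c)"
  unfolding local_op_def conv_def by (auto intro!: sum.cong dest: dvd_imp_le)

text \<open>A bound on p-th powers, so \<open>C\<close> is the p-th power of an operator bound. Only
  finite levels of arbitrary coefficient sequences occur, so convergence is no issue on the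
  tree.\<close>

definition Lp_bd :: "real \<Rightarrow> real \<Rightarrow> ((nat \<Rightarrow> complex) \<Rightarrow> nat \<Rightarrow> complex) \<Rightarrow> bool" where
  "Lp_bd p C T \<longleftrightarrow> (\<forall>a k. tav k (\<lambda>n. norm (mart (T a) n) powr p) 1 \<le> C * tav k (\<lambda>n. norm (mart a n) powr p) 1)"

lemma Lp_bd_two: "Lp_bd 2 C T \<longleftrightarrow> (\<forall>a k. tav k (\<lambda>n. (norm (mart (T a) n))\<^sup>2) 1 \<le> C * tav k (\<lambda>n. (norm (mart a n))\<^sup>2) 1)"
  by (simp add: Lp_bd_def)

section \<open>Parseval's identity on the tree and its splitting into rays\<close>

lemma cmod_parallelogram: "((cmod (z + w))\<^sup>2 + (cmod (z - w))\<^sup>2) / 2 = (cmod z)\<^sup>2 + (cmod w)\<^sup>2"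
  unfolding cmod_power2 by (simp add: power2_eq_square algebra_simps)

lemma tav_mart_sq_Suc:
  "tav (Suc k) (\<lambda>n. (norm (mart a n))\<^sup>2) 1 = tav k (\<lambda>n. (norm (mart a n))\<^sup>2) 1 + tav k (\<lambda>n. (norm (a n))\<^sup>2) 1"
proof -
  have "tav k (\<lambda>m. ((norm (mart a (2 * m)))\<^sup>2 + (norm (mart a (Suc (2 * m))))\<^sup>2) / 2) 1
      = tav k (\<lambda>n. (norm (mart a n))\<^sup>2 + (norm (a n))\<^sup>2) 1"
    by (rule tav_cong) (simp add: mart_left mart_right leaf_floor_log cmod_parallelogram)
  then show ?thesis by (simp only: tav_Suc' tav_add)
qed

lemma tav_eq_sum: "tav l \<phi> n = (\<Sum>m\<in>{n * 2 ^ l..<(n + 1) * 2 ^ l}. \<phi> m) / 2 ^ l"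
proof (induction l arbitrary: n)
  case (Suc l)
  have "{n * 2 ^ Suc l..<(n + 1) * 2 ^ Suc l} = {(2 * n) * 2 ^ l..<(2 * n + 1) * 2 ^ l} \<union> {(2 * n + 1) * 2 ^ l..<(2 * n + 1 + 1) * 2 ^ l}"
    by (auto simp: algebra_simps)
  then have "(\<Sum>m\<in>{n * 2 ^ Suc l..<(n + 1) * 2 ^ Suc l}. \<phi> m) =
    (\<Sum>m\<in>{(2 * n) * 2 ^ l..<(2 * n + 1) * 2 ^ l}. \<phi> m) + (\<Sum>m\<in>{(2 * n + 1) * 2 ^ l..<(2 * n + 1 + 1) * 2 ^ l}. \<phi> m)"
    by (simp only:) (rule sum.union_disjoint, auto)
  then show ?case by (simp only: tav.simps Suc.IH) (simp add: add_divide_distrib)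
qed simp

lemma floor_log_less_iff: "n > 0 \<Longrightarrow> floor_log n < k \<longleftrightarrow> n < 2 ^ k"
proof
  assume "n > 0" "n < 2 ^ k"
  then have "2 ^ floor_log n < (2::nat) ^ k" by (meson floor_log_exp2_le le_less_trans)
  then show "floor_log n < k" by simp
next
  assume "n > 0" "floor_log n < k"
  then have "(2::nat) ^ Suc (floor_log n) \<le> 2 ^ k" by (intro power_increasing) auto
  then show "n < 2 ^ k" using floor_log_exp2_gt[of n] by simp
qed

lemma floor_log_pow_mult: "m > 0 \<Longrightarrow> floor_log (2 ^ i * m) = i + floor_log m"
  by (induction i) (auto simp: mult.assoc)

text \<open>Parseval: increments are orthogonal to the past by the parallelogram law, and
  \<open>1 / 2 ^ floor_log n\<close> is the measure of the support of the Haar function at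
  \<open>n\<close>.\<close>

lemma tav_mart_sq:
  "tav k (\<lambda>n. (norm (mart a n))\<^sup>2) 1 = (\<Sum>n\<in>{1..<2 ^ k}. (norm (a n))\<^sup>2 / 2 ^ floor_log n)"
proof (induction k)
  case (Suc k)
  have "tav k (\<lambda>n. (norm (a n))\<^sup>2) 1 = (\<Sum>n\<in>{2 ^ k..<2 ^ Suc k}. (norm (a n))\<^sup>2 / 2 ^ k)"
    by (simp add: tav_eq_sum sum_divide_distrib mult_2)
  also have "\<dots> = (\<Sum>n\<in>{2 ^ k..<2 ^ Suc k}. (norm (a n))\<^sup>2 / 2 ^ floor_log n)"
  proof (rule sum.cong[OF refl])
    fix n :: nat assume n: "n \<in> {2 ^ k..<2 ^ Suc k}"
    then have "n > 0" by (meson atLeastLessThan_iff less_le_trans zero_less_numeral zero_less_power)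
    then have "floor_log n = k" using n by (intro floor_log_eqI) auto
    then show "(norm (a n))\<^sup>2 / 2 ^ k = (norm (a n))\<^sup>2 / 2 ^ floor_log n" by simp
  qed
  finally have "tav (Suc k) (\<lambda>n. (norm (mart a n))\<^sup>2) 1 =
    (\<Sum>n\<in>{1..<2 ^ k}. (norm (a n))\<^sup>2 / 2 ^ floor_log n) + (\<Sum>n\<in>{2 ^ k..<2 ^ Suc k}. (norm (a n))\<^sup>2 / 2 ^ floor_log n)"
    by (simp only: tav_mart_sq_Suc Suc)
  also have "\<dots> = (\<Sum>n\<in>{1..<2 ^ k} \<union> {2 ^ k..<2 ^ Suc k}. (norm (a n))\<^sup>2 / 2 ^ floor_log n)"
    by (rule sum.union_disjoint[symmetric]) auto
  also have "{1..<2 ^ k} \<union> {2 ^ k..<2 ^ Suc k} = {1..<(2::nat) ^ Suc k}"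
    by (intro ivl_disj_un) auto
  finally show ?case .
qed simp

text \<open>Every positive integer is uniquely \<open>2 ^ i * m\<close> with \<open>m\<close> odd,
  and it lies on level \<open>i + floor_log m\<close>; this sorts the nodes of the first
  \<open>k\<close> levels into rays.\<close>

lemma sum_odd_parts:
  fixes g :: "nat \<Rightarrow> real"
  shows "(\<Sum>n\<in>{1..<2 ^ k}. g n) = (\<Sum>m | odd m \<and> m < 2 ^ k. \<Sum>i<k - floor_log m. g (2 ^ i * m))"
proof -
  let ?S = "SIGMA m:{m. odd m \<and> m < 2 ^ k}. {..<k - floor_log m}"
  let ?h = "\<lambda>(m, i). 2 ^ i * m"
  have inj: "inj_on ?h ?S"
  proof (rule inj_onI, clarify)
    fix m i m' i' :: nat assume *: "odd m" "odd m'" "2 ^ i * m = 2 ^ i' * m'"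
    have "multiplicity 2 (2 ^ i * m) = i" if "odd m" for i m :: nat
      using that by (intro multiplicity_eqI) auto
    from this[OF *(1), of i] this[OF *(2), of i'] *(3) have "i = i'" by simp
    with *(3) show "m = m' \<and> i = i'" by simp
  qed
  have "?h ` ?S = {1..<2 ^ k}"
  proof (intro equalityI subsetI)
    fix n assume "n \<in> ?h ` ?S"
    then obtain m i where n: "n = 2 ^ i * m" "odd m" "i < k - floor_log m" by auto
    then have "m > 0" by (auto intro: gr0I)
    with n have "n > 0" "floor_log n < k" by (auto simp: floor_log_pow_mult)
    then show "n \<in> {1..<2 ^ k}" by (simp add: floor_log_less_iff)
  next
    fix n :: nat assume n: "n \<in> {1..<2 ^ k}"
    then obtain i m where m: "odd m" "n = 2 ^ i * m" using nat_odd_decomp[of n] by auto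
    then have "m > 0" by (auto intro: gr0I)
    have "floor_log n < k" using n by (subst floor_log_less_iff) auto
    then have "i + floor_log m < k" using m \<open>m > 0\<close> by (simp add: floor_log_pow_mult)
    then have "m < 2 ^ k" using floor_log_less_iff[OF \<open>m > 0\<close>, of k] by simp
    with m \<open>i + floor_log m < k\<close> show "n \<in> ?h ` ?S" by (intro image_eqI[of _ _ "(m, i)"]) auto
  qed
  then have "(\<Sum>n\<in>{1..<2 ^ k}. g n) = (\<Sum>x\<in>?S. g (?h x))"
    using sum.reindex[OF inj, of g] by (simp add: o_def)
  also have "\<dots> = (\<Sum>m | odd m \<and> m < 2 ^ k. \<Sum>i<k - floor_log m. g (2 ^ i * m))"
    by (subst sum.Sigma) (auto simp: case_prod_beta)
  finally show ?thesis .
qed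

text \<open>Parseval sum of a single ray, normalised at its odd starting node; the weights halve
  because each left step halves the support.\<close>

definition wsum :: "nat \<Rightarrow> (nat \<Rightarrow> complex) \<Rightarrow> real" where
  "wsum K x = (\<Sum>k<K. (norm (x k))\<^sup>2 / 2 ^ k)"

text \<open>Different rays contribute separate terms to Parseval's sum, and on each of them the
  operator is the same multiplication of power series, so the bound for one ray carries over with
  its constant.\<close>

lemma conv_L2_bounded:
  assumes "\<And>x K. wsum K (fps_nth (Abs_fps c * Abs_fps x)) \<le> C * wsum K x"
  shows "Lp_bd 2 C (conv c)"
  unfolding Lp_bd_two
proof (intro allI)
  fix a k
  let ?N = "\<lambda>a. tav k (\<lambda>n. (norm (mart a n))\<^sup>2) 1"
  let ?O = "{m. odd m \<and> m < (2::nat) ^ k}"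
  have N: "?N a = (\<Sum>m\<in>?O. wsum (k - floor_log m) (\<lambda>i. a (2 ^ i * m)) / 2 ^ floor_log m)" for a
    unfolding tav_mart_sq sum_odd_parts wsum_def
  proof (rule sum.cong[OF refl])
    fix m :: nat assume "m \<in> ?O"
    then have "m > 0" by (auto intro: gr0I)
    then show "(\<Sum>i<k - floor_log m. (norm (a (2 ^ i * m)))\<^sup>2 / 2 ^ floor_log (2 ^ i * m)) =
      (\<Sum>i<k - floor_log m. (norm (a (2 ^ i * m)))\<^sup>2 / 2 ^ i) / 2 ^ floor_log m"
      by (simp add: floor_log_pow_mult sum_divide_distrib power_add)
  qed
  have "?N (conv c a) \<le> (\<Sum>m\<in>?O. C * wsum (k - floor_log m) (\<lambda>i. a (2 ^ i * m)) / 2 ^ floor_log m)"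
    unfolding N
  proof (intro sum_mono divide_right_mono)
    fix m assume "m \<in> ?O"
    then have "conv c a (2 ^ i * m) = fps_nth (Abs_fps c * Abs_fps (\<lambda>i. a (2 ^ i * m))) i" for i
      using conv_fps[of m c a] by (simp add: fps_eq_iff)
    then show "wsum (k - floor_log m) (\<lambda>i. conv c a (2 ^ i * m)) \<le> C * wsum (k - floor_log m) (\<lambda>i. a (2 ^ i * m))"
      using assms by simp
  qed auto
  also have "\<dots> = C * ?N a" unfolding N by (simp add: sum_distrib_left)
  finally show "?N (conv c a) \<le> C * ?N a" .
qed

section \<open>Boundedness in $L^p$ implies boundedness in $L^2$\<close>

text \<open>The levels are cut into blocks of length $N$.  The node \<open>n\<close> is kept if, within its block, the path to it turns
  right once, at the first step, and then always left; the number of left steps is \<open>floor_log n mod N - 1\<close>.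
  So each block contributes with probability $1/2$ and uses its own digits only.\<close>

definition keep :: "nat \<Rightarrow> nat \<Rightarrow> bool" where
  "keep N n \<longleftrightarrow> floor_log n mod N > 0 \<and> n mod 2 ^ (floor_log n mod N) = 2 ^ (floor_log n mod N - 1)"

definition blk :: "nat \<Rightarrow> (nat \<Rightarrow> complex) \<Rightarrow> nat \<Rightarrow> complex" where
  "blk N x n = (if keep N n then x (floor_log n mod N - 1) else 0)"

text \<open>The convolution carries coefficients past the end of a block along its left spine; this
  projection discards them.\<close>

definition restr :: "nat \<Rightarrow> (nat \<Rightarrow> complex) \<Rightarrow> nat \<Rightarrow> complex" where
  "restr N a n = (if keep N n then a n else 0)"

lemma local_op_restr: "local_op (restr N)"
proof -
  have "restr N a n = restr N b n" if "n > 0" "\<forall>i. 2 ^ i \<le> n \<longrightarrow> a (n div 2 ^ i) = b (n div 2 ^ i)" for a b n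
    using that(1) that(2)[rule_format, of 0] by (simp add: restr_def)
  then show ?thesis unfolding local_op_def by blast
qed

lemma restr_L2: "tav k (\<lambda>n. (norm (mart (restr N a) n))\<^sup>2) 1 \<le> 1 * tav k (\<lambda>n. (norm (mart a n))\<^sup>2) 1"
  unfolding tav_mart_sq mult_1 by (intro sum_mono divide_right_mono) (auto simp: restr_def)

lemma pow_mult_odd_mod: "2 ^ k * Suc (2 * q) mod 2 ^ Suc k = (2::nat) ^ k"
proof -
  have "2 ^ k * Suc (2 * q) = 2 ^ k + 2 ^ Suc k * q" by (simp add: algebra_simps)
  then have "2 ^ k * Suc (2 * q) mod 2 ^ Suc k = (2::nat) ^ k mod 2 ^ Suc k" by (simp only: mod_mult_self2)
  then show ?thesis by simp
qed

text \<open>From a kept node the ray back to its odd starting node stays inside one block, so the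
  convolution reads only that block's copy of \<open>x\<close>, from its beginning, and yields a
  Cauchy product.\<close>

lemma restr_conv_blk:
  assumes "n > 0"
  shows "restr N (conv c (blk N x)) n = blk N (fps_nth (Abs_fps c * Abs_fps x)) n"
proof (cases "keep N n")
  case True
  define l where "l = floor_log n mod N"
  have l: "l > 0" "n mod 2 ^ l = 2 ^ (l - 1)" using True by (auto simp: keep_def l_def)
  define k where "k = l - 1"
  define q where "q = n div 2 ^ l"
  have lk: "l = Suc k" using l by (simp add: k_def)
  have "n = 2 ^ l * q + 2 ^ k" using l(2) unfolding q_def k_def by (metis mult_div_mod_eq)
  then have n: "n = 2 ^ k * Suc (2 * q)" by (simp add: lk algebra_simps)
  have kl: "k + floor_log (Suc (2 * q)) = floor_log n" unfolding n by (subst floor_log_pow_mult) auto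
  have "blk N x (2 ^ (k - i) * Suc (2 * q)) = x (k - i)" if "i \<le> k" for i
  proof -
    have "floor_log (2 ^ (k - i) * Suc (2 * q)) = floor_log n - i"
      using kl that by (subst floor_log_pow_mult) auto
    \<comment> \<open>Going back \<open>i\<close> levels does not cross the block boundary, since
      \<open>i \<le> k < l\<close>. For \<open>N = 0\<close> the operation \<open>mod\<close> is the
      identity and the whole tree is one block.\<close>
    moreover have "(floor_log n - i) mod N = l - i"
    proof -
      have "floor_log n - i = (l - i) + N * (floor_log n div N)"
        using that lk by (metis Nat.diff_add_assoc2 l_def le_SucI mod_mult_div_eq)
      moreover have "N > 0 \<Longrightarrow> l < N" by (simp add: l_def)
      moreover have "N = 0 \<Longrightarrow> l - i = floor_log n - i" by (simp add: l_def)
      ultimately show ?thesis by (cases "N = 0") auto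
    qed
    ultimately have fl: "floor_log (2 ^ (k - i) * Suc (2 * q)) mod N = Suc (k - i)" using that lk by simp
    show ?thesis unfolding blk_def keep_def fl pow_mult_odd_mod by simp
  qed
  then have "conv c (blk N x) n = (\<Sum>i\<le>k. c i * x (k - i))"
    unfolding n by (subst conv_odd) (auto intro!: sum.cong)
  also have "\<dots> = fps_nth (Abs_fps c * Abs_fps x) k" by (simp add: fps_mult_nth atMost_atLeast0)
  finally show ?thesis using True by (simp add: restr_def blk_def k_def l_def)
qed (simp add: restr_def blk_def)

lemma mart_cong: "(\<And>n. n > 0 \<Longrightarrow> a n = b n) \<Longrightarrow> n > 0 \<Longrightarrow> mart a n = mart b n"
  by (rotate_tac -1, induction n rule: tree_induct) (auto simp: mart_left mart_right)

lemma tav_mart_zero_below: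
  assumes "n > 0" "\<And>j m. j < e \<Longrightarrow> m div 2 ^ j = n \<Longrightarrow> b m = 0"
  shows "tav e (\<lambda>m. G (mart b m)) n = G (mart b n)"
  using assms
proof (induction e arbitrary: n)
  case (Suc e)
  have b: "b n = 0" using Suc.prems(2)[of 0 n] by simp
  have d: "m div 2 ^ Suc j = m div 2 ^ j div 2" for m j :: nat by (metis div_mult2_eq mult.commute power_Suc)
  have "tav e (\<lambda>m. G (mart b m)) (2 * n) = G (mart b (2 * n))"
  proof (rule Suc.IH)
    fix j m :: nat assume "j < e" "m div 2 ^ j = 2 * n"
    then show "b m = 0" using d[of m j] by (intro Suc.prems(2)[of "Suc j" m]) (simp_all del: power_Suc)
  qed (use Suc.prems in simp)
  moreover have "tav e (\<lambda>m. G (mart b m)) (Suc (2 * n)) = G (mart b (Suc (2 * n)))"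
  proof (rule Suc.IH)
    fix j m :: nat assume "j < e" "m div 2 ^ j = Suc (2 * n)"
    then show "b m = 0" using d[of m j] by (intro Suc.prems(2)[of "Suc j" m]) (simp_all del: power_Suc)
  qed simp
  ultimately show ?case using b Suc.prems(1) by (simp add: mart_left mart_right)
qed simp

text \<open>The expectation of $G$ at the end of a random path of length $e$ that starts with value $w$ at a node whose left
  spine carries the coefficients $x_0, x_1, \dots$ and that meets no other coefficients.\<close>

fun spine :: "nat \<Rightarrow> (nat \<Rightarrow> complex) \<Rightarrow> (complex \<Rightarrow> real) \<Rightarrow> complex \<Rightarrow> real" where
  "spine 0 x G w = G w"
| "spine (Suc e) x G w = (spine e (\<lambda>i. x (Suc i)) G (w + x 0) + G (w - x 0)) / 2"

text \<open>A path follows the left spine up to its first right turn and is frozen afterwards: the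
  last hypothesis empties the subtrees that hang to the right of the spine.\<close>

lemma tav_mart_spine:
  assumes "s > 0" "\<And>j. j < e \<Longrightarrow> b (2 ^ j * s) = x j"
    and "\<And>i j m. i + j + 1 < e \<Longrightarrow> m div 2 ^ i = Suc (2 * (2 ^ j * s)) \<Longrightarrow> b m = 0"
  shows "tav e (\<lambda>m. G (mart b m)) s = spine e x G (mart b s)"
  using assms
proof (induction e arbitrary: s x)
  case (Suc e)
  have b: "b s = x 0" using Suc.prems(2)[of 0] by simp
  have "tav e (\<lambda>m. G (mart b m)) (2 * s) = spine e (\<lambda>i. x (Suc i)) G (mart b (2 * s))"
  proof (rule Suc.IH)
    fix j assume "j < e"
    then show "b (2 ^ j * (2 * s)) = x (Suc j)" using Suc.prems(2)[of "Suc j"] by (simp add: ac_simps)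
  next
    fix i j m :: nat assume "i + j + 1 < e" "m div 2 ^ i = Suc (2 * (2 ^ j * (2 * s)))"
    then show "b m = 0" using Suc.prems(3)[of i "Suc j" m] by (simp add: ac_simps)
  qed (use Suc.prems in simp)
  moreover have "tav e (\<lambda>m. G (mart b m)) (Suc (2 * s)) = G (mart b (Suc (2 * s)))"
  proof (rule tav_mart_zero_below)
    fix j m :: nat assume "j < e" "m div 2 ^ j = Suc (2 * s)"
    then show "b m = 0" using Suc.prems(3)[of j 0 m] by simp
  qed simp
  ultimately show ?case using Suc.prems(1) b by (simp add: mart_left mart_right)
qed simp

lemma floor_log_div_pow:
  assumes "m div 2 ^ j = n" "n > 0"
  shows "floor_log m = j + floor_log n"
  using assms
proof (induction j arbitrary: m n)
  case (Suc j)
  have d: "m div 2 ^ Suc j = m div 2 ^ j div 2" by (metis div_mult2_eq mult.commute power_Suc)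
  with Suc.prems have n: "n = m div 2 ^ j div 2" by simp
  with Suc.prems have "m div 2 ^ j \<ge> 2" by linarith
  then have "floor_log (m div 2 ^ j) = Suc (floor_log n)" unfolding n by (rule floor_log_rec)
  moreover have "floor_log m = j + floor_log (m div 2 ^ j)"
    using \<open>m div 2 ^ j \<ge> 2\<close> by (intro Suc.IH) auto
  ultimately show ?case by simp
qed simp

text \<open>The first of the \<open>Suc K\<close> levels is the coin toss that activates the block:
  a left step leads to no kept node of the block, a right step to an odd node whose left spine
  carries \<open>x\<close>.\<close>

lemma tav_blk:
  assumes r: "r > 0" "floor_log r mod Suc K = 0"
  shows "tav (Suc K) (\<lambda>m. G (mart (blk (Suc K) x) m)) r
    = (spine K x G (mart (blk (Suc K) x) r) + G (mart (blk (Suc K) x) r)) / 2"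
proof -
  let ?b = "blk (Suc K) x"
  have md: "(j + floor_log r) mod Suc K = j" if "j \<le> K" for j
    using mod_add_right_eq[of j "floor_log r" "Suc K"] r(2) that by simp
  have b0: "?b r = 0" using r by (simp add: blk_def keep_def)
  have "tav K (\<lambda>m. G (mart ?b m)) (2 * r) = G (mart ?b (2 * r))"
  proof (rule tav_mart_zero_below)
    fix j m :: nat assume j: "j < K" "m div 2 ^ j = 2 * r"
    then have l: "floor_log m mod Suc K = Suc j" using floor_log_div_pow[of m j "2 * r"] r md[of "Suc j"] by simp
    \<comment> \<open>A kept node has binary digit 1 at position \<open>j\<close>, the digit of the
      first step in the block; here \<open>m div 2 ^ j\<close> is even.\<close>
    have "m mod 2 ^ Suc j = 2 ^ j * (m div 2 ^ j mod 2) + m mod 2 ^ j"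
      by (metis mod_mult2_eq mult.commute power_Suc)
    then have "m mod 2 ^ Suc j < 2 ^ j" using j by simp
    then show "?b m = 0" unfolding blk_def keep_def l by simp
  qed (use r in simp)
  moreover have "tav K (\<lambda>m. G (mart ?b m)) (Suc (2 * r)) = spine K x G (mart ?b (Suc (2 * r)))"
  proof (rule tav_mart_spine)
    fix j assume "j < K"
    then have l: "floor_log (2 ^ j * Suc (2 * r)) mod Suc K = Suc j"
      using r md[of "Suc j"] by (subst floor_log_pow_mult) auto
    show "?b (2 ^ j * Suc (2 * r)) = x j" unfolding blk_def keep_def l pow_mult_odd_mod by simp
  next
    fix i j m :: nat assume ij: "i + j + 1 < K" "m div 2 ^ i = Suc (2 * (2 ^ j * Suc (2 * r)))"
    have "floor_log (Suc (2 * (2 ^ j * Suc (2 * r)))) = Suc (j + Suc (floor_log r))"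
      using r by (subst floor_log_Suc_twice, simp) (subst floor_log_pow_mult, auto)
    then have l: "floor_log m mod Suc K = Suc (Suc (i + j))"
      using floor_log_div_pow[OF ij(2)] md[of "Suc (Suc (i + j))"] ij(1) by (simp add: ac_simps)
    \<comment> \<open>The second right turn makes digit \<open>i\<close> of \<open>m\<close> equal
      to 1, while a kept node has only zeros below the digit of the first step.\<close>
    have "m mod 2 ^ Suc (Suc (i + j)) \<noteq> 2 ^ (Suc (Suc (i + j)) - 1)"
    proof
      assume *: "m mod 2 ^ Suc (Suc (i + j)) = 2 ^ (Suc (Suc (i + j)) - 1)"
      define q where "q = m div 2 ^ Suc (Suc (i + j))"
      have "m = 2 ^ Suc (Suc (i + j)) * q + 2 ^ Suc (i + j)"
        using * unfolding q_def by (metis diff_Suc_1 mult_div_mod_eq)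
      then have m: "m = 2 ^ i * (2 * (2 ^ j * (2 * q + 1)))"
        by (simp add: algebra_simps power_add)
      have "even (m div 2 ^ i)" unfolding m by simp
      with ij(2) show False by simp
    qed
    then show "?b m = 0" unfolding blk_def keep_def l by simp
  qed simp
  ultimately show ?thesis using r b0 by (simp add: mart_left mart_right)
qed

section \<open>Second and fourth moments of the block martingale\<close>

lemma spine_mono: "(\<And>v. G v \<le> H v) \<Longrightarrow> spine e x G w \<le> spine e x H w"
  by (induction e arbitrary: x w) (simp_all add: add_mono divide_right_mono)

lemma spine_add: "spine e x (\<lambda>v. G v + H v) w = spine e x G w + spine e x H w"
  by (induction e arbitrary: x w) (simp_all add: add_divide_distrib)

lemma spine_cmult: "spine e x (\<lambda>v. c * G v) w = c * spine e x G w"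
  by (induction e arbitrary: x w) (simp_all add: algebra_simps)

lemma spine_const: "spine e x (\<lambda>v. c) w = c"
  by (induction e arbitrary: x w) simp_all

lemma spine_translate: "spine e x G (z + w) = spine e x (\<lambda>v. G (z + v)) w"
  by (induction e arbitrary: x w) (simp_all add: add.assoc flip: add_diff_eq)

lemma wsum_Suc: "wsum (Suc e) x = (norm (x 0))\<^sup>2 + wsum e (\<lambda>i. x (Suc i)) / 2"
  unfolding wsum_def by (subst sum.lessThan_Suc_shift) (simp add: sum_divide_distrib mult.commute)

lemma spine_square: "spine e x (\<lambda>v. (norm v)\<^sup>2) w = (norm w)\<^sup>2 + wsum e x"
proof (induction e arbitrary: x w)
  case (Suc e)
  have "((norm (w + x 0))\<^sup>2 + (norm (w - x 0))\<^sup>2) / 2 = (norm w)\<^sup>2 + (norm (x 0))\<^sup>2" by (rule cmod_parallelogram)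
  then show ?case by (simp add: Suc wsum_Suc field_simps)
qed (simp add: wsum_def)

lemma spine_linear: "spine e x (\<lambda>v. Re (cnj z * v)) w = Re (cnj z * w)"
  by (induction e arbitrary: x w) (simp_all add: algebra_simps)

text \<open>The term linear in \<open>w\<close> stays exact because it averages out when
  \<open>w\<close> has mean zero. The coefficient of \<open>norm z ^ 4\<close> is exactly 1, so
  adding one block after another causes no exponential growth.\<close>

lemma cmod_add_pow4:
  "(norm (z + w)) ^ 4 \<le> (norm z) ^ 4 + 4 * (norm z)\<^sup>2 * Re (cnj z * w) + 8 * (norm z)\<^sup>2 * (norm w)\<^sup>2 + 3 * (norm w) ^ 4"
proof -
  define A B R where "A = (norm z)\<^sup>2" and "B = (norm w)\<^sup>2" and "R = Re (cnj z * w)"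
  have "R\<^sup>2 \<le> (norm (cnj z * w))\<^sup>2" unfolding R_def by (metis abs_Re_le_cmod abs_norm_cancel power2_le_iff_abs_le norm_ge_zero power2_abs)
  then have R: "R\<^sup>2 \<le> A * B" by (simp add: A_def B_def norm_mult power_mult_distrib)
  have "0 \<le> (R - B)\<^sup>2" by simp
  then have RB: "4 * (R * B) \<le> 2 * R\<^sup>2 + 2 * B\<^sup>2" by (simp add: power2_diff)
  have "(norm (z + w))\<^sup>2 = A + 2 * R + B"
    unfolding A_def B_def R_def cmod_power2 by (simp add: power2_eq_square algebra_simps)
  then have "(norm (z + w)) ^ 4 = (A + 2 * R + B)\<^sup>2" by (metis numeral_Bit0 power_add power2_eq_square)
  also have "\<dots> = A\<^sup>2 + 4 * R\<^sup>2 + B\<^sup>2 + 4 * (A * R) + 2 * (A * B) + 4 * (R * B)"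
    by (simp add: power2_eq_square algebra_simps)
  also have "\<dots> \<le> A\<^sup>2 + 4 * (A * R) + 8 * (A * B) + 3 * B\<^sup>2" using R RB by linarith
  finally show ?thesis by (simp add: A_def B_def R_def power_mult[symmetric] mult.assoc)
qed

lemma tav_blk_Suc:
  "tav (Suc L * Suc K) (\<lambda>m. G (mart (blk (Suc K) x) m)) 1 =
   tav (L * Suc K) (\<lambda>r. (spine K x G (mart (blk (Suc K) x) r) + G (mart (blk (Suc K) x) r)) / 2) 1"
proof -
  have "tav (Suc L * Suc K) (\<lambda>m. G (mart (blk (Suc K) x) m)) 1 = tav (L * Suc K) (tav (Suc K) (\<lambda>m. G (mart (blk (Suc K) x) m))) 1"
    by (simp only: tav_tav) (simp add: algebra_simps)
  also have "\<dots> = tav (L * Suc K) (\<lambda>r. (spine K x G (mart (blk (Suc K) x) r) + G (mart (blk (Suc K) x) r)) / 2) 1"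
  proof (rule tav_cong)
    fix r :: nat assume "r div 2 ^ (L * Suc K) = 1"
    from leaf_floor_log[OF this] show "tav (Suc K) (\<lambda>m. G (mart (blk (Suc K) x) m)) r = (spine K x G (mart (blk (Suc K) x) r) + G (mart (blk (Suc K) x) r)) / 2"
      by (intro tav_blk) (auto simp del: mult_Suc_right)
  qed
  finally show ?thesis .
qed

text \<open>The factor 1/2 is the probability that a block is active.\<close>

lemma tav_blk_square:
  "tav (L * Suc K) (\<lambda>m. (norm (mart (blk (Suc K) x) m))\<^sup>2) 1 = L * wsum K x / 2"
proof (induction L)
  case (Suc L)
  have "tav (Suc L * Suc K) (\<lambda>m. (norm (mart (blk (Suc K) x) m))\<^sup>2) 1 = tav (L * Suc K) (\<lambda>r. (norm (mart (blk (Suc K) x) r))\<^sup>2 + wsum K x / 2) 1"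
    unfolding tav_blk_Suc[where L = L and G = "\<lambda>v. (norm v)\<^sup>2"] spine_square by (simp add: add_divide_distrib)
  also have "\<dots> = Suc L * wsum K x / 2" unfolding tav_add Suc by (simp add: field_simps)
  finally show ?case .
qed simp

text \<open>A new block adds \<open>4 * wsum K x\<close> times the current second moment and at most
  two fourth moments of one spine. The first part sums to order \<open>L ^ 2\<close>, the second
  only to order \<open>L\<close>, so for large \<open>L\<close> the fourth moment is comparable to
  the squared variance, whatever \<open>x\<close> is.\<close>

lemma tav_blk_pow4:
  "tav (L * Suc K) (\<lambda>m. (norm (mart (blk (Suc K) x) m)) ^ 4) 1 \<le>
    (real L)\<^sup>2 * (wsum K x)\<^sup>2 + 2 * real L * spine K x (\<lambda>v. (norm v) ^ 4) 0"
proof (induction L)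
  case (Suc L)
  have M4: "0 \<le> spine K x (\<lambda>v. (norm v) ^ 4) 0" using spine_mono[of "\<lambda>_. 0" "\<lambda>v. (norm v) ^ 4" K x 0] by (simp add: spine_const)
  have sp: "spine K x (\<lambda>v. (norm v) ^ 4) z \<le> (norm z) ^ 4 + 8 * wsum K x * (norm z)\<^sup>2 + 3 * spine K x (\<lambda>v. (norm v) ^ 4) 0" for z
  proof -
    have "spine K x (\<lambda>v. (norm v) ^ 4) z = spine K x (\<lambda>v. (norm (z + v)) ^ 4) 0"
      using spine_translate[of K x _ z 0] by simp
    also have "\<dots> \<le> spine K x (\<lambda>v. (norm z) ^ 4 + 4 * (norm z)\<^sup>2 * Re (cnj z * v) + 8 * (norm z)\<^sup>2 * (norm v)\<^sup>2 + 3 * (norm v) ^ 4) 0"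
      by (intro spine_mono cmod_add_pow4)
    also have "\<dots> = (norm z) ^ 4 + 8 * wsum K x * (norm z)\<^sup>2 + 3 * spine K x (\<lambda>v. (norm v) ^ 4) 0"
      unfolding spine_add spine_cmult spine_const spine_linear spine_square by simp
    finally show ?thesis .
  qed
  have "tav (Suc L * Suc K) (\<lambda>m. (norm (mart (blk (Suc K) x) m)) ^ 4) 1 \<le> tav (L * Suc K) (\<lambda>r. (norm (mart (blk (Suc K) x) r)) ^ 4 + 4 * wsum K x * (norm (mart (blk (Suc K) x) r))\<^sup>2 + 2 * spine K x (\<lambda>v. (norm v) ^ 4) 0) 1"
    unfolding tav_blk_Suc[where L = L and G = "\<lambda>v. (norm v) ^ 4"]
  proof (rule tav_mono)
    fix r
    show "(spine K x (\<lambda>v. (norm v) ^ 4) (mart (blk (Suc K) x) r) + (norm (mart (blk (Suc K) x) r)) ^ 4) / 2 \<le> (norm (mart (blk (Suc K) x) r)) ^ 4 + 4 * wsum K x * (norm (mart (blk (Suc K) x) r))\<^sup>2 + 2 * spine K x (\<lambda>v. (norm v) ^ 4) 0"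
      using sp[of "mart (blk (Suc K) x) r"] M4 by simp
  qed
  also have "\<dots> \<le> ((real L)\<^sup>2 * (wsum K x)\<^sup>2 + 2 * real L * spine K x (\<lambda>v. (norm v) ^ 4) 0) + 4 * wsum K x * (L * wsum K x / 2) + 2 * spine K x (\<lambda>v. (norm v) ^ 4) 0"
    unfolding tav_add tav_cmult tav_blk_square tav_const using Suc by simp
  also have "\<dots> \<le> (real (Suc L))\<^sup>2 * (wsum K x)\<^sup>2 + 2 * real (Suc L) * spine K x (\<lambda>v. (norm v) ^ 4) 0"
    by (simp add: power2_eq_square algebra_simps)
  finally show ?case .
qed simp

text \<open>The converse trade: up to \<open>s\<close> the square is controlled by the p-th power,
  beyond \<open>s\<close> by the fourth power. With \<open>s ^ 2\<close> a suitable multiple of the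
  variance, the last term has a mean small enough to be absorbed.\<close>

lemma square_le_split:
  fixes p y s :: real
  assumes "1 < p" "p < 2" "0 \<le> y" "0 < s"
  shows "y\<^sup>2 \<le> s powr (2 - p) * y powr p + y ^ 4 / s\<^sup>2"
proof (cases "y = 0 \<or> y > s")
  case True
  show ?thesis
  proof (cases "y = 0")
    case False
    with True have "s\<^sup>2 \<le> y\<^sup>2" using assms by (intro power_mono) auto
    then have "y\<^sup>2 * s\<^sup>2 \<le> y\<^sup>2 * y\<^sup>2" by (intro mult_left_mono) auto
    then have "y\<^sup>2 \<le> y ^ 4 / s\<^sup>2" using assms by (simp add: le_divide_eq flip: power_add)
    then show ?thesis by (smt (verit) mult_nonneg_nonneg powr_ge_zero)
  qed simp
next
  case False
  then have "y\<^sup>2 = y powr (2 - p) * y powr p"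
    using assms by (simp flip: powr_add add: powr_numeral)
  also have "\<dots> \<le> s powr (2 - p) * y powr p"
    using False assms by (intro mult_right_mono powr_mono2) auto
  finally show ?thesis by (smt (verit) assms divide_nonneg_nonneg zero_le_power zero_le_power2)
qed

lemma le_if_le_add_divide_nat:
  fixes a b m :: real
  assumes "\<And>L. L > 0 \<Longrightarrow> a \<le> b + m / real L"
  shows "a \<le> b"
proof (rule field_le_epsilon)
  fix e :: real assume e: "e > 0"
  obtain L :: nat where L: "\<bar>m\<bar> / e < real L" using reals_Archimedean2 by blast
  then have L0: "L > 0" using e by (metis divide_nonneg_pos abs_ge_zero gr0I not_le of_nat_0)
  have "m / real L \<le> e" using L L0 e by (simp add: field_simps)
  then show "a \<le> b + e" using assms[OF L0] by linarith
qed


lemma conv_Lp_imp_L2: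
  fixes p C :: real
  assumes p: "1 < p" "p < 2" and C: "0 \<le> C" and bd: "Lp_bd p C (conv c)"
  shows "\<exists>C'\<ge>0. Lp_bd 2 C' (conv c)"
proof -
  obtain C1 where C1: "C1 \<ge> 0" and restr: "\<forall>T. local_op T \<longrightarrow>
      (\<forall>a k. tav k (\<lambda>n. (norm (mart (T a) n))\<^sup>2) 1 \<le> 1 * tav k (\<lambda>n. (norm (mart a n))\<^sup>2) 1) \<longrightarrow>
      (\<forall>a k. tav k (\<lambda>n. norm (mart (T a) n) powr p) 1 \<le> C1 * tav k (\<lambda>n. norm (mart a n) powr p) 1)"
    using local_op_bounded[OF p zero_le_one] by blast
  define D where "D = C1 * C"
  have D: "D \<ge> 0" using C1 C by (simp add: D_def)
  \<comment> \<open>24 is the product of 3/2 from the p-th moment of the input, 4 as a bound for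
    \<open>4 powr (1 - p / 2)\<close>, and 4 from clearing \<open>Y / 4\<close>.\<close>
  define E where "E = (24 * D) powr (2 / p)"
  \<comment> \<open>\<open>X\<close> stands for \<open>wsum K x\<close>, which may be 0. In the end
    it is \<open>wsum K x + 1 / L\<close>, and \<open>L\<close> tends to infinity.\<close>
  have main: "wsum K y \<le> E * X"
    if y: "y = fps_nth (Abs_fps c * Abs_fps x)" and X: "X > 0" "wsum K x \<le> X" for K x y X
  proof (cases "wsum K y > 0")
    case False
    have "0 \<le> E * X" using X by (simp add: E_def)
    with False show ?thesis by simp
  next
    case True
    define Y where "Y = wsum K y"
    define M4 where "M4 = spine K y (\<lambda>v. (norm v) ^ 4) 0"
    have Y: "Y > 0" using True by (simp add: Y_def)
    \<comment> \<open>\<open>M4\<close> has no bound in terms of \<open>Y\<close>, but it is divided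
      by the number \<open>L\<close> of blocks, which is free.\<close>
    have "Y / 4 \<le> 6 * D * (Y powr (1 - p / 2) * X powr (p / 2)) + (M4 / (2 * Y)) / real L" if L: "L > 0" for L :: nat
    proof -
      let ?N = "Suc K"
      let ?E = "\<lambda>\<phi>. tav (L * ?N) \<phi> 1"
      let ?a = "mart (blk ?N x)" and ?b = "mart (blk ?N y)"
      \<comment> \<open>The image has variance \<open>L * Y / 2\<close>. With
        \<open>s ^ 2 = 4 * L * Y\<close> the leading fourth-moment term becomes
        \<open>L * Y / 4\<close>, half of it, and is absorbed. The value \<open>t ^ 2\<close> is at
        least twice the variance of the input.\<close>
      define s t where "s = sqrt (4 * (real L * Y))" and "t = sqrt (real L * X)"
      have s: "s > 0" "s\<^sup>2 = 4 * (real L * Y)" using Y L by (auto simp: s_def)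
      have t: "t > 0" "t\<^sup>2 = real L * X" using X L by (auto simp: t_def)
      have a2: "?E (\<lambda>n. norm (?a n) powr p) \<le> 3 / 2 * t powr p"
      proof -
        have "?E (\<lambda>n. norm (?a n) powr p) \<le> ?E (\<lambda>n. t powr (p - 2) * (norm (?a n))\<^sup>2 + t powr p)"
          using p t by (intro tav_mono powr_le_split) auto
        also have "\<dots> = t powr (p - 2) * (L * wsum K x / 2) + t powr p"
          unfolding tav_add tav_cmult tav_const tav_blk_square ..
        also have "\<dots> \<le> t powr (p - 2) * (t\<^sup>2 / 2) + t powr p"
          unfolding t(2) using X by (intro add_right_mono mult_left_mono divide_right_mono) auto
        also have "t powr (p - 2) * (t\<^sup>2 / 2) = t powr p / 2"
          using t(1) by (simp add: powr_diff powr_numeral)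
        finally show ?thesis by simp
      qed
      have ab: "?E (\<lambda>n. norm (?b n) powr p) \<le> D * (3 / 2 * t powr p)"
      proof -
        have "?E (\<lambda>n. norm (?b n) powr p) = ?E (\<lambda>n. norm (mart (restr ?N (conv c (blk ?N x))) n) powr p)"
        proof (rule tav_cong)
          fix m :: nat assume "m div 2 ^ (L * ?N) = 1"
          then have "m > 0" by (rule leaf_floor_log)
          then have "?b m = mart (restr ?N (conv c (blk ?N x))) m"
            by (intro mart_cong) (simp_all add: restr_conv_blk y)
          then show "norm (?b m) powr p = norm (mart (restr ?N (conv c (blk ?N x))) m) powr p" by simp
        qed
        also have "\<dots> \<le> C1 * ?E (\<lambda>n. norm (mart (conv c (blk ?N x)) n) powr p)" 
          by (rule restr[rule_format]) (rule local_op_restr, rule restr_L2)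
        also have "\<dots> \<le> C1 * (C * ?E (\<lambda>n. norm (?a n) powr p))"
          using bd C1 unfolding Lp_bd_def by (intro mult_left_mono) auto
        also have "\<dots> = D * ?E (\<lambda>n. norm (?a n) powr p)" by (simp add: D_def)
        also have "\<dots> \<le> D * (3 / 2 * t powr p)" using D a2 by (intro mult_left_mono)
        finally show ?thesis .
      qed
      have "L * Y / 2 = ?E (\<lambda>n. (norm (?b n))\<^sup>2)" unfolding tav_blk_square Y_def ..
      also have "\<dots> \<le> ?E (\<lambda>n. s powr (2 - p) * norm (?b n) powr p + 1 / s\<^sup>2 * norm (?b n) ^ 4)"
        using square_le_split[OF p _ s(1)] by (intro tav_mono) simp
      also have "\<dots> = s powr (2 - p) * ?E (\<lambda>n. norm (?b n) powr p) + 1 / s\<^sup>2 * ?E (\<lambda>n. norm (?b n) ^ 4)"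
        unfolding tav_add tav_cmult ..
      also have "\<dots> \<le> s powr (2 - p) * (D * (3 / 2 * t powr p)) + 1 / s\<^sup>2 * ((real L)\<^sup>2 * Y\<^sup>2 + 2 * real L * M4)"
        unfolding Y_def M4_def by (intro add_mono mult_left_mono ab tav_blk_pow4) auto
      also have "1 / s\<^sup>2 * ((real L)\<^sup>2 * Y\<^sup>2 + 2 * real L * M4) = L * (Y / 4 + M4 / (2 * Y) / L)"
        unfolding s(2) using Y L by (simp add: divide_simps) (simp add: algebra_simps power2_eq_square)
      also have "s powr (2 - p) * (D * (3 / 2 * t powr p)) \<le> L * (6 * D * (Y powr (1 - p / 2) * X powr (p / 2)))"
      proof -
        have "s powr (2 - p) = (4 * (L * Y)) powr (1 - p / 2)"
        proof -
          have "s = (4 * (L * Y)) powr (1 / 2)" unfolding s_def using Y by (simp add: powr_half_sqrt del: real_sqrt_mult)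
          moreover have "1 / 2 * (2 - p) = 1 - p / 2" by (simp add: field_simps)
          ultimately show ?thesis by (simp only: powr_powr)
        qed
        also have "\<dots> = 4 powr (1 - p / 2) * (real L powr (1 - p / 2) * Y powr (1 - p / 2))"
          using Y by (simp add: powr_mult)
        also have "\<dots> \<le> 4 * (real L powr (1 - p / 2) * Y powr (1 - p / 2))"
          using p powr_mono[of "1 - p / 2" 1 "4::real"] by (intro mult_right_mono) auto
        finally have 1: "s powr (2 - p) \<le> 4 * (real L powr (1 - p / 2) * Y powr (1 - p / 2))" .
        have 2: "t powr p = real L powr (p / 2) * X powr (p / 2)"
        proof -
          have "t = (L * X) powr (1 / 2)" unfolding t_def using X by (simp add: powr_half_sqrt del: real_sqrt_mult)
          moreover have "1 / 2 * p = p / 2" by simp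
          ultimately have "t powr p = (L * X) powr (p / 2)" by (simp only: powr_powr)
          then show ?thesis using X by (simp add: powr_mult)
        qed
        have 3: "real L powr (1 - p / 2) * real L powr (p / 2) = L" using L by (simp flip: powr_add)
        have "s powr (2 - p) * (D * (3 / 2 * t powr p)) \<le> 4 * (real L powr (1 - p / 2) * Y powr (1 - p / 2)) * (D * (3 / 2 * t powr p))"
          using D by (intro mult_right_mono 1) auto
        also have "\<dots> = (real L powr (1 - p / 2) * real L powr (p / 2)) * (6 * D * (Y powr (1 - p / 2) * X powr (p / 2)))"
          unfolding 2 by simp
        finally show ?thesis unfolding 3 .
      qed
      finally have "L * (Y / 2) \<le> L * (6 * D * (Y powr (1 - p / 2) * X powr (p / 2)) + (Y / 4 + M4 / (2 * Y) / L))"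
        by (simp add: distrib_left)
      then have "Y / 2 \<le> 6 * D * (Y powr (1 - p / 2) * X powr (p / 2)) + (Y / 4 + M4 / (2 * Y) / L)"
        using L by (simp only: mult_le_cancel_left_pos of_nat_0_less_iff)
      then show ?thesis by linarith
    qed
    then have "Y / 4 \<le> 6 * D * (Y powr (1 - p / 2) * X powr (p / 2))" by (rule le_if_le_add_divide_nat)
    then have "Y \<le> Y powr (1 - p / 2) * (24 * D * X powr (p / 2))" by (simp add: ac_simps)
    moreover have "Y powr (1 - p / 2) * Y powr (p / 2) = Y" using Y by (simp flip: powr_add)
    ultimately have "Y powr (1 - p / 2) * Y powr (p / 2) \<le> Y powr (1 - p / 2) * (24 * D * X powr (p / 2))" by (simp only:)
    moreover have "Y powr (1 - p / 2) > 0" using Y by simp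
    ultimately have *: "Y powr (p / 2) \<le> 24 * D * X powr (p / 2)" by (rule mult_left_le_imp_le)
    have "Y = (Y powr (p / 2)) powr (2 / p)" using Y p by (simp add: powr_powr)
    also have "\<dots> \<le> (24 * D * X powr (p / 2)) powr (2 / p)" using * p by (intro powr_mono2) auto
    also have "\<dots> = E * X" using D X p by (simp add: powr_mult powr_powr E_def)
    finally show ?thesis by (simp add: Y_def)
  qed
  have "wsum K (fps_nth (Abs_fps c * Abs_fps x)) \<le> E * wsum K x" for x K
  proof (rule le_if_le_add_divide_nat)
    fix L :: nat assume "L > 0"
    moreover have "wsum K x \<ge> 0" unfolding wsum_def by (intro sum_nonneg) auto
    ultimately have "wsum K (fps_nth (Abs_fps c * Abs_fps x)) \<le> E * (wsum K x + 1 / L)"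
      by (intro main[OF refl]) (auto intro: add_nonneg_pos)
    then show "wsum K (fps_nth (Abs_fps c * Abs_fps x)) \<le> E * wsum K x + E / real L"
      by (simp add: distrib_left)
  qed
  then have "Lp_bd 2 E (conv c)" by (rule conv_L2_bounded)
  moreover have "E \<ge> 0" by (simp add: E_def)
  ultimately show ?thesis by blast
qed

lemma conv_L2_imp_Lp:
  assumes "1 < p" "p \<le> 2" "0 \<le> C" "Lp_bd 2 C (conv c)"
  shows "\<exists>C'\<ge>0. Lp_bd p C' (conv c)"
proof (cases "p = 2")
  case False
  then have "1 < p" "p < 2" using assms by auto
  from local_op_bounded[OF this assms(3), folded Lp_bd_two, folded Lp_bd_def] obtain C' where "C' \<ge> 0"
    and *: "\<forall>T. local_op T \<longrightarrow> Lp_bd 2 C T \<longrightarrow> Lp_bd p C' T" by blast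
  have "Lp_bd p C' (conv c)" using *[rule_format, OF local_op_conv assms(4)] .
  with \<open>C' \<ge> 0\<close> show ?thesis by blast
qed (use assms in auto)


section \<open>Dyadic averages and Haar coefficients\<close>

lemma space_I_meas [simp]: "space I_meas = {0<..1}"
  by (simp add: I_meas_def space_restrict_space)

lemma finite_measure_I_meas: "finite_measure I_meas"
  by (rule finite_measureI) (simp add: I_meas_def space_restrict_space emeasure_restrict_space)

lemma measure_I_meas_space [simp]: "measure I_meas {0<..1} = 1"
  by (simp add: I_meas_def measure_restrict_space)

lemma integrable_I_meas_const [simp]: "integrable I_meas (\<lambda>t. c)"
  by (rule finite_measure.integrable_const[OF finite_measure_I_meas])

lemma integral_I_meas_const [simp]: "integral\<^sup>L I_meas (\<lambda>t. c) = c"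
  for c :: "'a::{banach, second_countable_topology}"
  by (simp add: lebesgue_integral_const measure_I_meas_space)

lemma integrable_I_meas_iff:
  fixes g :: "real \<Rightarrow> 'a::{banach, second_countable_topology}"
  shows "integrable I_meas g \<longleftrightarrow> integrable lebesgue (\<lambda>t. indicator {0<..1} t *\<^sub>R g t)"
  unfolding I_meas_def by (subst integrable_restrict_space) auto

lemma integral_I_meas:
  fixes g :: "real \<Rightarrow> 'a::{banach, second_countable_topology}"
  shows "integral\<^sup>L I_meas g = (\<integral>t. indicator {0<..1} t *\<^sub>R g t \<partial>lebesgue)"
  unfolding I_meas_def by (subst integral_restrict_space) auto

text \<open>With $t$ replaced by $1+t$, the support of $h_n$ becomes $(n 2^{-k}, (n+1) 2^{-k}]$, $k = \lfloor\log_2 n\rfloor$.\<close>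

definition ivl :: "nat \<Rightarrow> real set" where
  "ivl n = {t. real n < 2 ^ floor_log n * (1 + t) \<and> 2 ^ floor_log n * (1 + t) \<le> real n + 1}"

lemma ivl_eq: "ivl n = {real n / 2 ^ floor_log n - 1<..(real n + 1) / 2 ^ floor_log n - 1}"
  by (auto simp: ivl_def field_simps)

lemma floor_log_bounds: "n > 0 \<Longrightarrow> 2 ^ floor_log n \<le> n" "n < 2 * 2 ^ floor_log n"
  using floor_log_exp2_le floor_log_exp2_gt by auto

lemma ivl_subset: assumes "n > 0" shows "ivl n \<subseteq> {0<..1}"
proof -
  have "(2::real) ^ floor_log n \<le> real n"
    using floor_log_bounds(1)[OF assms] by (metis of_nat_le_iff of_nat_numeral of_nat_power)
  moreover have "real n + 1 \<le> 2 * 2 ^ floor_log n"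
  proof -
    have "n + 1 \<le> 2 * 2 ^ floor_log n" using floor_log_bounds(2)[of n] by simp
    then have "real (n + 1) \<le> real (2 * 2 ^ floor_log n)" by (rule of_nat_mono)
    then show ?thesis by simp
  qed
  ultimately have "2 ^ floor_log n * 1 < 2 ^ floor_log n * (1 + x) \<and> 2 ^ floor_log n * (1 + x) \<le> 2 ^ floor_log n * 2"
    if "x \<in> ivl n" for x
    using that unfolding ivl_def by (simp only: mem_Collect_eq) linarith
  then show ?thesis by (auto simp only: mult_less_cancel_left_pos mult_le_cancel_left_pos zero_less_power zero_less_numeral) auto
qed

lemma ivl_one [simp]: "ivl (Suc 0) = {0<..1}"
  by (simp add: ivl_eq)

lemma ivl_split: assumes "n > 0" shows "ivl n = ivl (2 * n) \<union> ivl (Suc (2 * n))" "ivl (2 * n) \<inter> ivl (Suc (2 * n)) = {}"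
  using assms by (auto simp: ivl_def)

lemma sets_ivl [measurable]: "ivl n \<in> sets lebesgue" "n > 0 \<Longrightarrow> ivl n \<in> sets I_meas"
proof -
  show *: "ivl n \<in> sets lebesgue" by (simp add: ivl_eq)
  show "ivl n \<in> sets I_meas" if "n > 0"
    using * ivl_subset[OF that] unfolding I_meas_def by (subst sets_restrict_space_iff) auto
qed

lemma measure_ivl: "measure lebesgue (ivl n) = 1 / 2 ^ floor_log n"
  by (simp add: ivl_eq field_simps)

text \<open>Integration runs over the whole line, so that the affine substitution in
  \<open>avg_dil\<close> applies directly.\<close>

definition avg :: "(real \<Rightarrow> 'a) \<Rightarrow> nat \<Rightarrow> 'a::{banach, second_countable_topology}" where
  "avg g n = 2 ^ floor_log n *\<^sub>R (\<integral>t. indicator (ivl n) t *\<^sub>R g t \<partial>lebesgue)"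

lemma integrable_ivl:
  fixes g :: "real \<Rightarrow> 'a::{banach, second_countable_topology}"
  assumes "integrable I_meas g" "n > 0"
  shows "integrable lebesgue (\<lambda>t. indicator (ivl n) t *\<^sub>R g t)"
proof -
  have "integrable lebesgue (\<lambda>t. indicator (ivl n) t *\<^sub>R (indicator {0<..1} t *\<^sub>R g t))"
    using integrable_mult_indicator[OF sets_ivl(1)] assms(1) by (simp only: integrable_I_meas_iff)
  moreover have "indicator (ivl n) t *\<^sub>R (indicator {0<..1} t *\<^sub>R g t) = indicator (ivl n) t *\<^sub>R g t" for t
    using ivl_subset[OF assms(2)] by (auto simp: indicator_def)
  ultimately show ?thesis by (simp only:)
qed

lemma avg_one: "avg g (Suc 0) = integral\<^sup>L I_meas g"
  by (simp add: avg_def integral_I_meas)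

lemma avg_split:
  assumes "integrable I_meas g" "n > 0"
  shows "avg g n = (1 / 2) *\<^sub>R (avg g (2 * n) + avg g (Suc (2 * n)))"
proof -
  have "indicator (ivl n) t *\<^sub>R g t = indicator (ivl (2 * n)) t *\<^sub>R g t + indicator (ivl (Suc (2 * n))) t *\<^sub>R g t" for t
    unfolding ivl_split(1)[OF assms(2)] using ivl_split(2)[OF assms(2)] by (auto simp: indicator_def)
  then have "(\<integral>t. indicator (ivl n) t *\<^sub>R g t \<partial>lebesgue)
    = (\<integral>t. indicator (ivl (2 * n)) t *\<^sub>R g t \<partial>lebesgue) + (\<integral>t. indicator (ivl (Suc (2 * n))) t *\<^sub>R g t \<partial>lebesgue)"
    using assms by (simp add: integrable_ivl)
  then show ?thesis using assms(2) by (simp add: avg_def scaleR_add_right)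
qed

lemma avg_cong:
  assumes "\<And>t. t \<in> ivl n \<Longrightarrow> f t = g t"
  shows "avg f n = avg g n"
proof -
  have "(\<lambda>t. indicator (ivl n) t *\<^sub>R f t) = (\<lambda>t. indicator (ivl n) t *\<^sub>R g t)"
    using assms by (intro ext) (auto simp: indicator_def)
  then show ?thesis by (simp add: avg_def)
qed

lemma avg_const: "avg (\<lambda>t. c) n = c"
proof -
  have "emeasure lebesgue (ivl n) < \<infinity>" by (simp add: ivl_eq divide_right_mono)
  then have "(\<integral>t. indicator (ivl n) t *\<^sub>R c \<partial>lebesgue) = measure lebesgue (ivl n) *\<^sub>R c"
    by (subst has_bochner_integral_integral_eq[OF has_bochner_integral_indicator]) auto
  then show ?thesis by (simp add: avg_def measure_ivl)
qed

lemma avg_add: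
  assumes "integrable I_meas f" "integrable I_meas g" "n > 0"
  shows "avg (\<lambda>t. f t + g t) n = avg f n + avg g n"
  using assms by (simp add: avg_def scaleR_add_right integrable_ivl)

lemma avg_cmult:
  fixes g :: "real \<Rightarrow> 'a::{banach, second_countable_topology, real_normed_field}"
  assumes "integrable I_meas g" "n > 0"
  shows "avg (\<lambda>t. c * g t) n = c * avg g n"
proof -
  have "(\<lambda>t. indicator (ivl n) t *\<^sub>R (c * g t)) = (\<lambda>t. c * (indicator (ivl n) t *\<^sub>R g t))" by auto
  then show ?thesis using assms by (simp add: avg_def del: mult_scaleR_right) (simp add: integrable_ivl)
qed

lemma avg_mono:
  fixes f g :: "real \<Rightarrow> real"
  assumes "integrable I_meas f" "integrable I_meas g" "n > 0" "\<And>t. f t \<le> g t"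
  shows "avg f n \<le> avg g n"
  unfolding avg_def using assms
  by (intro scaleR_left_mono integral_mono integrable_ivl) (auto simp del: real_scaleR_def)

lemma norm_avg_le: "norm (avg g n) \<le> avg (\<lambda>t. norm (g t)) n"
proof -
  have "norm (\<integral>t. indicator (ivl n) t *\<^sub>R g t \<partial>lebesgue) \<le> (\<integral>t. norm (indicator (ivl n) t *\<^sub>R g t) \<partial>lebesgue)"
    by (rule integral_norm_bound)
  then show ?thesis by (simp add: avg_def)
qed

lemma avg_AE_cong:
  assumes "AE t in I_meas. f t = g t" "n > 0" "f \<in> borel_measurable I_meas" "g \<in> borel_measurable I_meas"
  shows "avg f n = avg g n"
proof -
  have "avg f n = 2 ^ floor_log n *\<^sub>R integral\<^sup>L I_meas (\<lambda>t. indicator (ivl n) t *\<^sub>R f t)" for f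
  proof -
    have "indicator {0<..1} t *\<^sub>R (indicator (ivl n) t *\<^sub>R f t) = indicator (ivl n) t *\<^sub>R f t" for t
      using ivl_subset[OF assms(2)] by (auto simp: indicator_def)
    then show ?thesis by (simp add: avg_def integral_I_meas del: scaleR_scaleR)
  qed
  moreover have "integral\<^sup>L I_meas (\<lambda>t. indicator (ivl n) t *\<^sub>R f t) = integral\<^sup>L I_meas (\<lambda>t. indicator (ivl n) t *\<^sub>R g t)"
    using assms by (intro integral_cong_AE) auto
  ultimately show ?thesis by metis
qed

lemma tav_avg:
  fixes u :: "real \<Rightarrow> real"
  assumes "integrable I_meas u" "n > 0"
  shows "tav k (avg u) n = avg u n"
  using assms(2)
proof (induction k arbitrary: n)
  case (Suc k)
  then show ?case using avg_split[OF assms(1), of n] by simp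
qed simp

lemma powr_le_one_add: "1 < p \<Longrightarrow> 0 \<le> x \<Longrightarrow> x \<le> 1 + x powr p" for x p :: real
proof (cases "x \<le> 1")
  case False
  assume "1 < p"
  with False have "x powr 1 \<le> x powr p" by (intro powr_mono) auto
  with False show ?thesis by simp
qed (smt (verit) powr_ge_zero)

lemma in_Lp_integrable:
  assumes "1 \<le> p" "in_Lp p g"
  shows "integrable I_meas g"
proof (rule Bochner_Integration.integrable_bound[of _ "\<lambda>t. 1 + norm (g t) powr p"])
  show "AE t in I_meas. norm (g t) \<le> norm (1 + norm (g t) powr p)"
  proof (rule AE_I2)
    fix t
    have "norm (g t) \<le> 1 + norm (g t) powr p"
      using assms(1) powr_le_one_add[of p "norm (g t)"] by (cases "p = 1") auto
    then show "norm (g t) \<le> norm (1 + norm (g t) powr p)" by simp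
  qed
qed (use assms in \<open>auto simp: in_Lp_def\<close>)

text \<open>The tangent inequality is averaged at the point \<open>B\<close>, the mean of the
  norm.\<close>

lemma jensen_avg:
  fixes g :: "real \<Rightarrow> complex"
  assumes p: "1 < p" and g: "in_Lp p g" and n: "n > 0"
  shows "norm (avg g n) powr p \<le> avg (\<lambda>t. norm (g t) powr p) n"
proof -
  have gi: "integrable I_meas (\<lambda>t. norm (g t))" using in_Lp_integrable[of p g] p g by auto
  have gp: "integrable I_meas (\<lambda>t. norm (g t) powr p)" using g by (simp add: in_Lp_def)
  define B where "B = avg (\<lambda>t. norm (g t)) n"
  have B: "norm (avg g n) \<le> B" unfolding B_def by (rule norm_avg_le)
  have B0: "0 \<le> B" using B norm_ge_zero order_trans by blast
  have "B powr (p - 1) * B \<le> 1 / p * avg (\<lambda>t. norm (g t) powr p) n + (1 - 1 / p) * B powr p"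
  proof -
    have "avg (\<lambda>t. B powr (p - 1) * norm (g t)) n \<le> avg (\<lambda>t. 1 / p * norm (g t) powr p + (1 - 1 / p) * B powr p) n"
    proof (rule avg_mono)
      fix t
      show "B powr (p - 1) * norm (g t) \<le> 1 / p * norm (g t) powr p + (1 - 1 / p) * B powr p"
        using young_tangent[OF p norm_ge_zero B0, of "g t"] by (simp add: mult.commute)
    qed (use gi gp n in auto)
    also have "\<dots> = 1 / p * avg (\<lambda>t. norm (g t) powr p) n + (1 - 1 / p) * B powr p"
      using gp n by (subst avg_add) (auto simp only: avg_const avg_cmult intro!: integrable_mult_right integrable_I_meas_const)
    finally show ?thesis using gi n by (simp add: avg_cmult B_def)
  qed
  moreover have "B powr (p - 1) * B = B powr p" using B0 by (simp add: powr_mult_base mult.commute)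
  ultimately have "1 / p * B powr p \<le> 1 / p * avg (\<lambda>t. norm (g t) powr p) n" by (simp add: algebra_simps)
  then have "B powr p \<le> avg (\<lambda>t. norm (g t) powr p) n" using p by (simp add: divide_le_cancel)
  moreover have "norm (avg g n) powr p \<le> B powr p" using B p by (intro powr_mono2) auto
  ultimately show ?thesis by linarith
qed

lemma tav_avg_powr_le:
  fixes g :: "real \<Rightarrow> complex"
  assumes p: "1 < p" and g: "in_Lp p g"
  shows "tav k (\<lambda>n. norm (avg g n) powr p) 1 \<le> (\<integral>t. norm (g t) powr p \<partial>I_meas)"
proof -
  have gp: "integrable I_meas (\<lambda>t. norm (g t) powr p)" using g by (simp add: in_Lp_def)
  have "tav k (\<lambda>n. norm (avg g n) powr p) 1 \<le> tav k (avg (\<lambda>t. norm (g t) powr p)) 1"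
    by (intro tav_mono jensen_avg p g) (rule leaf_floor_log)
  also have "\<dots> = (\<integral>t. norm (g t) powr p \<partial>I_meas)" using gp by (simp add: tav_avg avg_one)
  finally show ?thesis .
qed

text \<open>Makes the average at a fixed node a continuous functional on L^p, which lets
  coefficients pass to limits.\<close>

lemma norm_avg_powr_le:
  fixes g :: "real \<Rightarrow> complex"
  assumes p: "1 < p" and g: "in_Lp p g" and n: "n > 0"
  shows "norm (avg g n) powr p \<le> 2 ^ floor_log n * (\<integral>t. norm (g t) powr p \<partial>I_meas)"
proof -
  have gp: "integrable I_meas (\<lambda>t. norm (g t) powr p)" using g by (simp add: in_Lp_def)
  have "(\<integral>t. indicator (ivl n) t *\<^sub>R (norm (g t) powr p) \<partial>lebesgue) \<le> (\<integral>t. indicator {0<..1} t *\<^sub>R (norm (g t) powr p) \<partial>lebesgue)"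
    using gp ivl_subset[OF n] n by (intro integral_mono integrable_ivl) (auto simp: integrable_I_meas_iff indicator_def)
  then have "avg (\<lambda>t. norm (g t) powr p) n \<le> 2 ^ floor_log n * (\<integral>t. norm (g t) powr p \<partial>I_meas)"
    by (simp add: avg_def integral_I_meas)
  with jensen_avg[OF assms] show ?thesis by linarith
qed

text \<open>Inverse of \<open>ivl\<close> on a level: for \<open>0 < t \<le> 1\<close> it selects
  the interval containing \<open>t\<close>. The ceiling minus 1 replaces the floor because the
  intervals are open on the left and closed on the right.\<close>

definition node :: "nat \<Rightarrow> real \<Rightarrow> nat" where
  "node k t = nat (\<lceil>2 ^ k * (1 + t)\<rceil> - 1)"

lemma node_props:
  assumes "0 < t" "t \<le> 1"
  shows "node k t > 0" "floor_log (node k t) = k" "t \<in> ivl (node k t)"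
proof -
  define m where "m = node k t"
  have "2 ^ k * (1 + t) > 2 ^ k * (1::real)" using assms by (intro mult_strict_left_mono) auto
  then have c: "\<lceil>2 ^ k * (1 + t)\<rceil> > 2 ^ k" by (simp add: less_ceiling_iff)
  moreover have "(2::int) ^ k > 0" by simp
  ultimately have "\<lceil>2 ^ k * (1 + t)\<rceil> > 0" by linarith
  then have m: "int m = \<lceil>2 ^ k * (1 + t)\<rceil> - 1" unfolding m_def node_def by simp
  with c have m': "int m \<ge> 2 ^ k" by linarith
  have ml: "real m < 2 ^ k * (1 + t)" "2 ^ k * (1 + t) \<le> real m + 1"
    using ceiling_correct[of "2 ^ k * (1 + t)"] m by linarith+
  have "2 ^ k * (1 + t) \<le> 2 ^ k * (2::real)" using assms by (intro mult_left_mono) auto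
  with ml have "real m < 2 * 2 ^ k" by linarith
  then have m2: "m < 2 * 2 ^ k" by (metis of_nat_less_iff of_nat_mult of_nat_numeral of_nat_power)
  have m1: "2 ^ k \<le> m" using m' by (metis of_nat_le_iff of_nat_numeral of_nat_power)
  then show 0: "node k t > 0" unfolding m_def[symmetric] by (metis gr0I leD zero_less_numeral zero_less_power)
  then show fl: "floor_log (node k t) = k" using m1 m2 unfolding m_def by (intro floor_log_eqI) auto
  show "t \<in> ivl (node k t)" using ml fl by (simp add: ivl_def m_def)
qed

lemma node_unique:
  assumes "t \<in> ivl n" "n > 0"
  shows "node (floor_log n) t = n"
proof -
  have "\<lceil>2 ^ floor_log n * (1 + t)\<rceil> = int n + 1" using assms(1) by (intro ceiling_unique) (auto simp: ivl_def)
  then show ?thesis by (simp add: node_def)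
qed

lemma measurable_node: "(\<lambda>t. \<phi> (node k t)) \<in> borel_measurable I_meas" for \<phi> :: "nat \<Rightarrow> real"
proof -
  have "(\<lambda>t::real. \<phi> (nat (\<lceil>2 ^ k * (1 + t)\<rceil> - 1))) \<in> borel_measurable borel" by measurable
  then have "(\<lambda>t. \<phi> (node k t)) \<in> borel_measurable lebesgue" unfolding node_def[symmetric] by (simp add: measurable_completion)
  then show ?thesis unfolding I_meas_def by (rule measurable_restrict_space1)
qed

lemma integrable_node: "integrable I_meas (\<lambda>t. \<phi> (node k t))" for \<phi> :: "nat \<Rightarrow> real"
proof (rule finite_measure.integrable_const_bound[OF finite_measure_I_meas])
  show "AE t in I_meas. norm (\<phi> (node k t)) \<le> (\<Sum>m<2 ^ Suc k. \<bar>\<phi> m\<bar>)"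
  proof (rule AE_I2)
    fix t assume "t \<in> space I_meas"
    then have "node k t < 2 ^ Suc k" using node_props[of t k] floor_log_bounds(2)[of "node k t"] by simp
    then show "norm (\<phi> (node k t)) \<le> (\<Sum>m<2 ^ Suc k. \<bar>\<phi> m\<bar>)" unfolding real_norm_def by (intro member_le_sum) auto
  qed
qed (rule measurable_node)

lemma avg_node:
  assumes "n > 0" "floor_log n + j = k"
  shows "avg (\<lambda>t. \<phi> (node k t)) n = tav j \<phi> n"
  using assms
proof (induction j arbitrary: n)
  case 0
  then have "avg (\<lambda>t. \<phi> (node k t)) n = avg (\<lambda>t. \<phi> n) n" by (intro avg_cong) (auto simp: node_unique)
  then show ?case by (simp add: avg_const)
next
  case (Suc j)
  then show ?case by (simp add: avg_split[OF integrable_node Suc.prems(1)])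
qed

lemma integral_node: "(\<integral>t. \<phi> (node k t) \<partial>I_meas) = tav k \<phi> 1" for \<phi> :: "nat \<Rightarrow> real"
  using avg_node[of 1 k k \<phi>] by (simp add: avg_one)

text \<open>The bound is required only from some index on, because the norms of a Haar polynomial
  are compared with those of its coefficients only from its own level onwards.\<close>

lemma fatou_real:
  fixes u :: "nat \<Rightarrow> real \<Rightarrow> real"
  assumes u: "\<And>i. integrable I_meas (u i)" "\<And>i t. 0 \<le> u i t"
    and v: "v \<in> borel_measurable I_meas" "\<And>t. 0 \<le> v t"
    and lim: "AE t in I_meas. (\<lambda>i. u i t) \<longlonglongrightarrow> v t"
    and bd: "\<And>i. i \<ge> N \<Longrightarrow> integral\<^sup>L I_meas (u i) \<le> B"
  shows "integrable I_meas v" "integral\<^sup>L I_meas v \<le> B"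
proof -
  have B: "0 \<le> B" using order_trans[OF Bochner_Integration.integral_nonneg bd[of N]] u by simp
  have "(\<integral>\<^sup>+t. ennreal (v t) \<partial>I_meas) = (\<integral>\<^sup>+t. liminf (\<lambda>i. ennreal (u (i + N) t)) \<partial>I_meas)"
  proof (rule nn_integral_cong_AE)
    show "AE t in I_meas. ennreal (v t) = liminf (\<lambda>i. ennreal (u (i + N) t))"
      using lim
    proof eventually_elim
      case (elim t)
      then have "(\<lambda>i. ennreal (u (i + N) t)) \<longlonglongrightarrow> ennreal (v t)"
        by (intro tendsto_ennrealI LIMSEQ_ignore_initial_segment)
      then show ?case by (simp add: lim_imp_Liminf)
    qed
  qed
  also have "\<dots> \<le> liminf (\<lambda>i. \<integral>\<^sup>+t. ennreal (u (i + N) t) \<partial>I_meas)"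
    using u by (intro nn_integral_liminf) auto
  also have "\<dots> \<le> liminf (\<lambda>i. ennreal B)"
    using u bd by (intro Liminf_mono always_eventually allI) (auto simp: nn_integral_eq_integral intro!: ennreal_leI)
  finally have le: "(\<integral>\<^sup>+t. ennreal (v t) \<partial>I_meas) \<le> ennreal B" by (simp add: Liminf_const)
  then show i: "integrable I_meas v"
    using v by (intro integrableI_nonneg) (auto simp: le_less_trans)
  show "integral\<^sup>L I_meas v \<le> B"
    using le v B by (simp add: nn_integral_eq_integral[OF i])
qed


lemma avg_eq_integral:
  fixes g :: "real \<Rightarrow> complex"
  assumes "integrable I_meas g" "n > 0"
  shows "avg g n = 2 ^ floor_log n *\<^sub>R
    integral {real n / 2 ^ floor_log n - 1..(real n + 1) / 2 ^ floor_log n - 1} (\<lambda>t. indicator {0<..1} t *\<^sub>R g t)"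
proof -
  let ?G = "\<lambda>t. indicator {0<..1} t *\<^sub>R g t"
  have "integrable (lebesgue_on (ivl n)) g"
    using integrable_ivl[OF assms] by (subst integrable_restrict_space) auto
  then have "integral\<^sup>L (lebesgue_on (ivl n)) g = integral (ivl n) g"
    by (rule lebesgue_integral_eq_integral) simp
  moreover have "integral\<^sup>L (lebesgue_on (ivl n)) g = (\<integral>t. indicator (ivl n) t *\<^sub>R g t \<partial>lebesgue)"
    by (rule integral_restrict_space) simp
  moreover have "integral (ivl n) g = integral (ivl n) ?G"
    using ivl_subset[OF assms(2)] by (intro Henstock_Kurzweil_Integration.integral_cong) (auto simp: indicator_def)
  moreover have "integral (ivl n) ?G = integral {real n / 2 ^ floor_log n - 1..(real n + 1) / 2 ^ floor_log n - 1} ?G"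
    by (rule integral_spike_set; rule negligible_subset[of "{real n / 2 ^ floor_log n - 1}"]) (auto simp: ivl_eq)
  ultimately show ?thesis by (simp add: avg_def)
qed

text \<open>Lebesgue differentiation is applied to intervals that begin at \<open>t\<close>, for the
  function and for its reflection; a dyadic interval around \<open>t\<close> is cut at
  \<open>t\<close> into one piece of either kind.\<close>

lemma avg_node_tendsto:
  fixes g :: "real \<Rightarrow> complex"
  assumes g: "integrable I_meas g"
  shows "AE t in I_meas. (\<lambda>k. avg g (node k t)) \<longlonglongrightarrow> g t"
proof -
  define G where "G t = indicator {0<..1} t *\<^sub>R g t" for t :: real
  define G' where "G' t = G (- t)" for t
  have G: "integrable lebesgue G" using g by (simp add: integrable_I_meas_iff G_def[abs_def])
  then have G': "integrable lebesgue G'"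
    using lebesgue_integrable_real_affine_iff[of "-1" G 0] by (simp add: G'_def[abs_def])
  have int: "G integrable_on cbox a b" "G' integrable_on cbox a b" for a b
    using integrable_on_subcbox[OF integrable_on_lebesgue[OF G]] integrable_on_subcbox[OF integrable_on_lebesgue[OF G']] by auto
  obtain N where N: "negligible N" "\<And>x e. \<lbrakk>x \<notin> N; 0 < e\<rbrakk> \<Longrightarrow> \<exists>d>0. \<forall>h. 0 < h \<and> h < d \<longrightarrow>
      norm (integral (cbox x (x + h *\<^sub>R One)) G /\<^sub>R h ^ DIM(real) - G x) < e"
    using integrable_ccontinuous_explicit[of G] int(1) by blast
  obtain N' where N': "negligible N'" "\<And>x e. \<lbrakk>x \<notin> N'; 0 < e\<rbrakk> \<Longrightarrow> \<exists>d>0. \<forall>h. 0 < h \<and> h < d \<longrightarrow>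
      norm (integral (cbox x (x + h *\<^sub>R One)) G' /\<^sub>R h ^ DIM(real) - G' x) < e"
    using integrable_ccontinuous_explicit[of G'] int(2) by blast
  have "negligible (uminus ` N')"
    using N'(1) by (intro negligible_differentiable_image_negligible) (auto simp: differentiable_on_minus)
  then have "negligible (N \<union> uminus ` N')" using N(1) by (rule negligible_Un[rotated])
  then have "AE t in lebesgue. t \<notin> N \<union> uminus ` N'" by (intro AE_not_in) (simp add: negligible_iff_null_sets)
  moreover have "(\<lambda>k. avg g (node k t)) \<longlonglongrightarrow> g t" if t: "t \<notin> N \<union> uminus ` N'" "0 < t" "t \<le> 1" for t
  proof (rule LIMSEQ_I)
    fix e :: real assume e: "e > 0"
    have "- t \<notin> N'" using t(1) by force
    with N'(2)[of "- t" "e / 2"] e obtain d' where d': "d' > 0" "\<And>h. 0 < h \<Longrightarrow> h < d' \<Longrightarrow>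
        norm (integral {- t..- t + h} G' /\<^sub>R h - G t) < e / 2" by (auto simp: G'_def)
    from N(2)[of t "e / 2"] e t(1) obtain d where d: "d > 0" "\<And>h. 0 < h \<Longrightarrow> h < d \<Longrightarrow>
        norm (integral {t..t + h} G /\<^sub>R h - G t) < e / 2" by auto
    have scale: "norm (I - h *\<^sub>R G t) \<le> e / 2 * h" if "norm (I /\<^sub>R h - G t) < e / 2" "h > 0" for I h
    proof -
      have "I - h *\<^sub>R G t = h *\<^sub>R (I /\<^sub>R h - G t)" using that(2) by (simp add: scaleR_diff_right)
      then have "norm (I - h *\<^sub>R G t) = h * norm (I /\<^sub>R h - G t)" using that(2) by simp
      also have "\<dots> \<le> h * (e / 2)" using that by (intro mult_left_mono) auto
      finally show ?thesis by (simp add: mult.commute)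
    qed
    have "(\<lambda>k. (1 / 2 :: real) ^ k) \<longlonglongrightarrow> 0" by (intro LIMSEQ_power_zero) simp
    from LIMSEQ_D[OF this, of "min d d'"] d(1) d'(1)
    obtain k0 where k0: "\<And>k. k \<ge> k0 \<Longrightarrow> 1 / 2 ^ k < min d d'" by (auto simp: power_one_over)
    have "norm (avg g (node k t) - g t) < e" if k: "k \<ge> k0" for k
    proof -
      define n a b where "n = node k t" and "a = real n / 2 ^ k - 1" and "b = (real n + 1) / 2 ^ k - 1"
      note np = node_props[OF t(2,3), of k, folded n_def]
      have ab: "a < t" "t \<le> b" "b - a = 1 / 2 ^ k"
        using np(3) unfolding ivl_eq np(2) by (auto simp: a_def b_def field_simps)
      have lt: "t - a < d'" "b - t < d" using ab k0[OF k] by linarith+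
      have I1: "norm (integral {a..t} G - (t - a) *\<^sub>R G t) \<le> e / 2 * (t - a)"
      proof (rule scale)
        have "integral {- t..- t + (t - a)} G' = integral {a..t} G"
          using Henstock_Kurzweil_Integration.integral_reflect_real[where f = G and a = a and b = t] by (simp add: G'_def[abs_def])
        with d'(2)[of "t - a"] ab lt show "norm (integral {a..t} G /\<^sub>R (t - a) - G t) < e / 2" by simp
      qed (use ab in simp)
      \<comment> \<open>If \<open>t\<close> is a right endpoint this piece is a point, so the errors
        are compared after multiplication by the length, where they add up to \<open>e / 2\<close>
        times \<open>b - a\<close>.\<close>
      have I2: "norm (integral {t..b} G - (b - t) *\<^sub>R G t) \<le> e / 2 * (b - t)"
      proof (cases "b = t")
        case False
        with ab lt d(2)[of "b - t"] show ?thesis by (intro scale) auto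
      qed simp
      have "integral {a..b} G = integral {a..t} G + integral {t..b} G"
        using Henstock_Kurzweil_Integration.integral_combine[of a t b G] ab int(1)[of a b] by simp
      then have "integral {a..b} G - (b - a) *\<^sub>R G t = (integral {a..t} G - (t - a) *\<^sub>R G t) + (integral {t..b} G - (b - t) *\<^sub>R G t)"
        by (simp add: scaleR_diff_left)
      then have "norm (integral {a..b} G - (b - a) *\<^sub>R G t) \<le> e / 2 * (t - a) + e / 2 * (b - t)"
        using I1 I2 norm_triangle_le add_mono by metis
      also have "\<dots> = e / 2 * (b - a)" by (simp flip: distrib_left)
      finally have I: "norm (integral {a..b} G - (1 / 2 ^ k) *\<^sub>R G t) \<le> e / 2 * (1 / 2 ^ k)" unfolding ab(3) .
      have "avg g n = 2 ^ k *\<^sub>R integral {a..b} G"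
        using avg_eq_integral[OF g np(1)] np(2) by (simp add: a_def b_def G_def[abs_def])
      then have "avg g n - g t = 2 ^ k *\<^sub>R (integral {a..b} G - (1 / 2 ^ k) *\<^sub>R G t)"
        using t by (simp add: scaleR_diff_right G_def)
      then have "norm (avg g n - g t) = 2 ^ k * norm (integral {a..b} G - (1 / 2 ^ k) *\<^sub>R G t)" by simp
      also have "\<dots> \<le> 2 ^ k * (e / 2 * (1 / 2 ^ k))" using I by (intro mult_left_mono) auto
      also have "\<dots> < e" using e by simp
      finally show ?thesis by (simp add: n_def)
    qed
    then show "\<exists>k0. \<forall>k\<ge>k0. norm (avg g (node k t) - g t) < e" by blast
  qed
  ultimately have "AE t in lebesgue. t \<in> {0<..1} \<longrightarrow> (\<lambda>k. avg g (node k t)) \<longlonglongrightarrow> g t" by auto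
  then show ?thesis unfolding I_meas_def by (subst AE_restrict_space_iff) auto
qed

section \<open>Haar coefficients and their relation to L^p norms\<close>

definition coef :: "(real \<Rightarrow> complex) \<Rightarrow> nat \<Rightarrow> complex" where
  "coef g n = (avg g (2 * n) - avg g (Suc (2 * n))) / 2"

text \<open>The p-th power, without a root, of the L^p norm of the Haar partial sum over the first
  \<open>k\<close> levels.\<close>

definition hnorm :: "real \<Rightarrow> nat \<Rightarrow> (nat \<Rightarrow> complex) \<Rightarrow> real" where
  "hnorm p k a = tav k (\<lambda>n. norm (mart a n) powr p) 1"

lemma Lp_bd_hnorm: "Lp_bd p C T \<longleftrightarrow> (\<forall>a k. hnorm p k (T a) \<le> C * hnorm p k a)"
  by (simp add: Lp_bd_def hnorm_def)

lemma avg_children: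
  assumes "integrable I_meas g" "n > 0"
  shows "avg g (2 * n) = avg g n + coef g n" "avg g (Suc (2 * n)) = avg g n - coef g n"
  using avg_split[OF assms] by (simp_all add: coef_def scaleR_conv_of_real field_simps)

lemma mart_coef:
  assumes g: "integrable I_meas g" and "n > 0"
  shows "mart (coef g) n = avg g n - integral\<^sup>L I_meas g"
  using assms(2)
proof (induction n rule: tree_induct)
  case one
  then show ?case by (simp add: avg_one)
next
  case (left n)
  then show ?case using avg_children[OF g, of n] by (simp add: mart_left)
next
  case (right n)
  then show ?case using avg_children[OF g, of n] by (simp add: mart_right)
qed

lemma hnorm_cong:
  assumes "\<And>n. n > 0 \<Longrightarrow> a n = b n"
  shows "hnorm p k a = hnorm p k b"
  unfolding hnorm_def
proof (rule tav_cong)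
  fix m :: nat assume "m div 2 ^ k = 1"
  then have "m > 0" by (rule leaf_floor_log)
  with mart_cong[OF assms] show "norm (mart a m) powr p = norm (mart b m) powr p" by simp
qed

lemma hnorm_coef:
  assumes "integrable I_meas g" "integral\<^sup>L I_meas g = 0"
  shows "hnorm p k (coef g) = tav k (\<lambda>n. norm (avg g n) powr p) 1"
  unfolding hnorm_def
proof (rule tav_cong)
  fix m :: nat assume "m div 2 ^ k = 1"
  then have "m > 0" by (rule leaf_floor_log)
  with assms show "norm (mart (coef g) m) powr p = norm (avg g m) powr p" by (simp add: mart_coef)
qed

lemma in_Lp0_D:
  assumes "1 < p" "in_Lp0 p g"
  shows "in_Lp p g" "integrable I_meas g" "integral\<^sup>L I_meas g = 0" "g \<in> borel_measurable I_meas"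
    "integrable I_meas (\<lambda>t. norm (g t) powr p)"
proof -
  show *: "in_Lp p g" and "integral\<^sup>L I_meas g = 0" using assms(2) by (simp_all only: in_Lp0_def)
  show "integrable I_meas g" using in_Lp_integrable[OF _ *] assms(1) by simp
  show "g \<in> borel_measurable I_meas" "integrable I_meas (\<lambda>t. norm (g t) powr p)"
    using * by (simp_all only: in_Lp_def)
qed

lemma hnorm_coef_le:
  assumes "1 < p" "in_Lp0 p g"
  shows "hnorm p k (coef g) \<le> (\<integral>t. norm (g t) powr p \<partial>I_meas)"
  using tav_avg_powr_le[OF assms(1), of g k] in_Lp0_D[OF assms] by (simp add: hnorm_coef)

text \<open>The averages converge almost everywhere, so Fatou's lemma passes the bound on to the
  limit. With \<open>hnorm_coef_le\<close> this turns tree bounds into bounds for functions.\<close>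

lemma in_Lp_if_hnorm_bounded:
  assumes p: "0 < p" and g: "integrable I_meas g" "integral\<^sup>L I_meas g = 0"
    and bd: "\<And>k. k \<ge> N \<Longrightarrow> hnorm p k (coef g) \<le> B"
  shows "in_Lp p g" "(\<integral>t. norm (g t) powr p \<partial>I_meas) \<le> B"
proof -
  have lim: "AE t in I_meas. (\<lambda>k. norm (avg g (node k t)) powr p) \<longlonglongrightarrow> norm (g t) powr p"
    using avg_node_tendsto[OF g(1)]
  proof eventually_elim
    case (elim t)
    then show ?case using p by (intro tendsto_powr' tendsto_norm tendsto_const) auto
  qed
  have m: "(\<lambda>t. norm (g t) powr p) \<in> borel_measurable I_meas" using g by measurable
  have b: "(\<integral>t. norm (avg g (node k t)) powr p \<partial>I_meas) \<le> B" if "k \<ge> N" for k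
    using bd[OF that] g integral_node[of "\<lambda>n. norm (avg g n) powr p" k] by (simp add: hnorm_coef)
  have "integrable I_meas (\<lambda>t. norm (g t) powr p)"
    by (rule fatou_real(1)[OF integrable_node[of "\<lambda>n. norm (avg g n) powr p"] _ m _ lim b]) auto
  then show "in_Lp p g" using g by (simp add: in_Lp_def)
  show "(\<integral>t. norm (g t) powr p \<partial>I_meas) \<le> B"
    by (rule fatou_real(2)[OF integrable_node[of "\<lambda>n. norm (avg g n) powr p"] _ m _ lim b]) auto
qed

text \<open>Coefficients and a zero mean determine all averages, and these determine the function
  almost everywhere by differentiation.\<close>

lemma coef_unique:
  assumes f: "integrable I_meas f" "integral\<^sup>L I_meas f = 0"
    and g: "integrable I_meas g" "integral\<^sup>L I_meas g = 0"
    and eq: "\<And>n. n > 0 \<Longrightarrow> coef f n = coef g n"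
  shows "AE t in I_meas. f t = g t"
proof -
  have avg: "avg f n = avg g n" if "n > 0" for n
    using mart_cong[of "coef f" "coef g" n] mart_coef[OF f(1) that] mart_coef[OF g(1) that] f(2) g(2) eq that by simp
  from avg_node_tendsto[OF f(1)] avg_node_tendsto[OF g(1)] AE_space
  show ?thesis
  proof eventually_elim
    case (elim t)
    then have "avg f (node k t) = avg g (node k t)" for k using node_props(1)[of t k] avg by simp
    with elim show ?case using LIMSEQ_unique by auto
  qed
qed

lemma coef_AE_cong:
  assumes "AE t in I_meas. f t = g t" "n > 0" "f \<in> borel_measurable I_meas" "g \<in> borel_measurable I_meas"
  shows "coef f n = coef g n"
  using avg_AE_cong[OF assms(1) _ assms(3,4)] assms(2) by (simp add: coef_def)

lemma coef_lincomb:
  assumes "integrable I_meas f" "integrable I_meas g" "n > 0"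
  shows "coef (\<lambda>t. a * f t + b * g t) n = a * coef f n + b * coef g n"
  using assms by (simp add: coef_def avg_add avg_cmult) (simp add: field_simps)

lemma norm_add_powr_le:
  fixes x y :: "'a::real_normed_vector" and p :: real
  assumes "0 < p"
  shows "norm (x + y) powr p \<le> 2 powr p * (norm x powr p + norm y powr p)"
proof -
  have "norm (x + y) \<le> 2 * max (norm x) (norm y)" using norm_triangle_ineq[of x y] by linarith
  then have "norm (x + y) powr p \<le> (2 * max (norm x) (norm y)) powr p" using assms by (intro powr_mono2) auto
  also have "\<dots> = 2 powr p * max (norm x) (norm y) powr p" by (rule powr_mult)
  also have "\<dots> \<le> 2 powr p * (norm x powr p + norm y powr p)" by (intro mult_left_mono) (auto simp: max_def)
  finally show ?thesis .
qed

lemma hnorm_diff_le: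
  assumes "0 < p"
  shows "hnorm p k (\<lambda>n. a n - b n) \<le> 2 powr p * (hnorm p k a + hnorm p k b)"
proof -
  have m: "mart (\<lambda>n. a n - b n) n = mart a n - mart b n" if "n > 0" for n
    using that by (induction n rule: tree_induct) (auto simp: mart_left mart_right)
  have "hnorm p k (\<lambda>n. a n - b n) \<le> tav k (\<lambda>n. 2 powr p * (norm (mart a n) powr p + norm (mart b n) powr p)) 1"
    unfolding hnorm_def
  proof (rule tav_mono)
    fix n :: nat assume "n div 2 ^ k = 1"
    then have "n > 0" by (rule leaf_floor_log)
    with norm_add_powr_le[OF assms, of "mart a n" "- mart b n"] m
    show "norm (mart (\<lambda>n. a n - b n) n) powr p \<le> 2 powr p * (norm (mart a n) powr p + norm (mart b n) powr p)" by simp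
  qed
  then show ?thesis by (simp add: hnorm_def tav_cmult tav_add)
qed

lemma in_Lp_lincomb:
  assumes "0 < p" "in_Lp p f" "in_Lp p g"
  shows "in_Lp p (\<lambda>t. a * f t + b * g t)"
proof -
  have fm: "f \<in> borel_measurable I_meas" "g \<in> borel_measurable I_meas" using assms by (auto simp: in_Lp_def)
  have "integrable I_meas (\<lambda>t. norm (a * f t + b * g t) powr p)"
  proof (rule Bochner_Integration.integrable_bound)
    show "integrable I_meas (\<lambda>t. 2 powr p * (norm a powr p * norm (f t) powr p + norm b powr p * norm (g t) powr p))"
      using assms by (auto simp: in_Lp_def)
    show "(\<lambda>t. norm (a * f t + b * g t) powr p) \<in> borel_measurable I_meas" using fm by measurable
    show "AE t in I_meas. norm (norm (a * f t + b * g t) powr p)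
      \<le> norm (2 powr p * (norm a powr p * norm (f t) powr p + norm b powr p * norm (g t) powr p))"
    proof (rule AE_I2)
      fix t
      show "norm (norm (a * f t + b * g t) powr p)
        \<le> norm (2 powr p * (norm a powr p * norm (f t) powr p + norm b powr p * norm (g t) powr p))"
        using norm_add_powr_le[OF assms(1), of "a * f t" "b * g t"] by (simp add: norm_mult powr_mult)
    qed
  qed
  moreover have "(\<lambda>t. a * f t + b * g t) \<in> borel_measurable I_meas" using fm by measurable
  ultimately show ?thesis by (simp add: in_Lp_def)
qed

lemma in_Lp0_lincomb:
  assumes "1 < p" "in_Lp0 p f" "in_Lp0 p g"
  shows "in_Lp0 p (\<lambda>t. a * f t + b * g t)"
  using assms in_Lp0_D[OF assms(1,2)] in_Lp0_D[OF assms(1,3)] by (simp add: in_Lp0_def in_Lp_lincomb)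

lemma in_Lp0_diff:
  assumes "1 < p" "in_Lp0 p f" "in_Lp0 p g"
  shows "in_Lp0 p (\<lambda>t. f t - g t)"
  using in_Lp0_lincomb[OF assms, of 1 "-1"] by simp

lemma in_Lp_mono:
  assumes "0 < p" "p \<le> q" "in_Lp q f"
  shows "in_Lp p f"
proof -
  have fm: "f \<in> borel_measurable I_meas" using assms by (auto simp: in_Lp_def)
  have "integrable I_meas (\<lambda>t. norm (f t) powr p)"
  proof (rule Bochner_Integration.integrable_bound[of _ "\<lambda>t. 1 + norm (f t) powr q"])
    show "(\<lambda>t. norm (f t) powr p) \<in> borel_measurable I_meas" using fm by measurable
    show "AE t in I_meas. norm (norm (f t) powr p) \<le> norm (1 + norm (f t) powr q)"
    proof (rule AE_I2)
      fix t
      show "norm (norm (f t) powr p) \<le> norm (1 + norm (f t) powr q)"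
      proof (cases "norm (f t) \<le> 1")
        case True
        then have "norm (f t) powr p \<le> 1 powr p" using assms by (intro powr_mono2) auto
        then show ?thesis by simp (smt (verit) powr_ge_zero)
      next
        case False
        then have "norm (f t) powr p \<le> norm (f t) powr q" using assms by (intro powr_mono) auto
        then show ?thesis by simp
      qed
    qed
  qed (use assms in \<open>auto simp: in_Lp_def\<close>)
  with fm show ?thesis by (simp add: in_Lp_def)
qed

section \<open>Completeness of L^p and realisation of coefficient sequences\<close>

lemma powr_le_imp_le:
  fixes p x s C :: real
  assumes "0 < p" "0 \<le> x" "0 \<le> s" "0 \<le> C" "x powr p \<le> C * s powr p"
  shows "x \<le> C powr (1 / p) * s"
proof -
  have "x = (x powr p) powr (1 / p)" using assms by (simp add: powr_powr)
  also have "\<dots> \<le> (C * s powr p) powr (1 / p)" using assms by (intro powr_mono2) auto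
  also have "\<dots> = C powr (1 / p) * s" using assms by (simp add: powr_mult powr_powr)
  finally show ?thesis .
qed

lemma Lp_limit:
  fixes F :: "nat \<Rightarrow> real \<Rightarrow> complex"
  assumes p: "1 < p" and F: "\<And>i. in_Lp p (F i)"
    and cauchy: "\<And>i j. i \<le> j \<Longrightarrow> (\<integral>t. norm (F i t - F j t) powr p \<partial>I_meas) \<le> (1 / 2 ^ i) powr p"
  shows "\<exists>G. in_Lp p G \<and> (\<forall>i. (\<integral>t. norm (F i t - G t) powr p \<partial>I_meas) \<le> (1 / 2 ^ i) powr p)"
proof -
  have Fm [measurable]: "F i \<in> borel_measurable I_meas" for i using F by (auto simp: in_Lp_def)
  have D: "in_Lp p (\<lambda>t. F i t - F j t)" for i j using in_Lp_lincomb[of p "F i" "F j" 1 "-1"] p F by simp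
  then have Dp: "integrable I_meas (\<lambda>t. norm (F i t - F j t) powr p)" for i j by (simp add: in_Lp_def)
  have Di: "integrable I_meas (\<lambda>t. norm (F i t - F j t))" for i j
    using in_Lp_integrable[OF _ D] p by (intro integrable_norm) auto
  \<comment> \<open>Comparing each increment with the size \<open>s = (1 / 2) ^ i\<close> gives a
    summable L^1 bound, hence absolute convergence of the telescoping series almost
    everywhere.\<close>
  have L1: "(\<integral>t. norm (F i t - F (Suc i) t) \<partial>I_meas) \<le> 2 * (1 / 2) ^ i" for i
  proof -
    define s where "s = (1 / 2 :: real) ^ i"
    have s: "s > 0" by (simp add: s_def)
    have "(\<integral>t. norm (F i t - F (Suc i) t) \<partial>I_meas) \<le> (\<integral>t. s + s powr (1 - p) * norm (F i t - F (Suc i) t) powr p \<partial>I_meas)"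
    proof (rule integral_mono)
      fix t
      let ?x = "norm (F i t - F (Suc i) t)"
      show "?x \<le> s + s powr (1 - p) * ?x powr p"
      proof (cases "?x \<le> s")
        case False
        then have "?x = ?x powr (1 - p) * ?x powr p" using s by (simp flip: powr_add)
        also have "\<dots> \<le> s powr (1 - p) * ?x powr p" using False s p by (intro mult_right_mono powr_mono2') auto
        finally show ?thesis using s by simp
      qed (smt (verit) mult_nonneg_nonneg powr_ge_zero)
    qed (use Di Dp in auto)
    also have "\<dots> = s + s powr (1 - p) * (\<integral>t. norm (F i t - F (Suc i) t) powr p \<partial>I_meas)" using Dp by simp
    also have "\<dots> \<le> s + s powr (1 - p) * s powr p"
      using cauchy[of i "Suc i"] by (intro add_left_mono mult_left_mono) (auto simp: s_def power_one_over)
    also have "s powr (1 - p) * s powr p = s" using s by (simp flip: powr_add)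
    finally show ?thesis by (simp add: s_def)
  qed
  have "AE t in I_meas. summable (\<lambda>i. norm (F i t - F (Suc i) t))"
  proof -
    have "(\<integral>\<^sup>+t. (\<Sum>i. ennreal (norm (F i t - F (Suc i) t))) \<partial>I_meas) = (\<Sum>i. \<integral>\<^sup>+t. ennreal (norm (F i t - F (Suc i) t)) \<partial>I_meas)"
      by (rule nn_integral_suminf) measurable
    also have "\<dots> = (\<Sum>i. ennreal (\<integral>t. norm (F i t - F (Suc i) t) \<partial>I_meas))"
      using Di by (simp add: nn_integral_eq_integral)
    also have "\<dots> \<le> (\<Sum>i. ennreal (2 * (1 / 2) ^ i))"
      using L1 by (intro suminf_le ennreal_leI) auto
    also have "\<dots> = ennreal (\<Sum>i. 2 * (1 / 2) ^ i)"
      by (intro suminf_ennreal2) (auto intro!: summable_mult summable_geometric)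
    finally have "(\<integral>\<^sup>+t. (\<Sum>i. ennreal (norm (F i t - F (Suc i) t))) \<partial>I_meas) \<noteq> \<infinity>" by (auto simp: top_unique)
    then have "AE t in I_meas. (\<Sum>i. ennreal (norm (F i t - F (Suc i) t))) \<noteq> \<infinity>"
      by (intro nn_integral_PInf_AE) measurable
    then show ?thesis by eventually_elim (auto intro!: summable_suminf_not_top)
  qed
  then have conv: "AE t in I_meas. (\<lambda>j. F j t) \<longlonglongrightarrow> lim (\<lambda>j. F j t)"
  proof eventually_elim
    case (elim t)
    then have "summable (\<lambda>i. F i t - F (Suc i) t)" by (rule summable_norm_cancel)
    then have "summable (\<lambda>i. - (F i t - F (Suc i) t))" by (rule summable_minus)
    then have "summable (\<lambda>i. F (Suc i) t - F i t)" by simp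
    then have "(\<lambda>n. \<Sum>i<n. F (Suc i) t - F i t) \<longlonglongrightarrow> (\<Sum>i. F (Suc i) t - F i t)" by (rule summable_LIMSEQ)
    then have "(\<lambda>n. F n t - F 0 t) \<longlonglongrightarrow> (\<Sum>i. F (Suc i) t - F i t)"
      by (simp add: sum_lessThan_telescope[of "\<lambda>i. F i t"])
    from tendsto_add[OF this tendsto_const[of "F 0 t"]] have "convergent (\<lambda>i. F i t)" by (simp add: convergentI)
    then show ?case by (simp add: convergent_LIMSEQ_iff)
  qed
  define G where "G t = lim (\<lambda>j. F j t)" for t
  have Gm [measurable]: "G \<in> borel_measurable I_meas" unfolding G_def[abs_def] by measurable
  have fat: "integrable I_meas (\<lambda>t. norm (F i t - G t) powr p) \<and> (\<integral>t. norm (F i t - G t) powr p \<partial>I_meas) \<le> (1 / 2 ^ i) powr p" for i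
  proof -
    have lim: "AE t in I_meas. (\<lambda>j. norm (F i t - F j t) powr p) \<longlonglongrightarrow> norm (F i t - G t) powr p"
      using conv
    proof eventually_elim
      case (elim t)
      then show ?case using p unfolding G_def by (intro tendsto_powr' tendsto_norm tendsto_diff tendsto_const) auto
    qed
    have m: "(\<lambda>t. norm (F i t - G t) powr p) \<in> borel_measurable I_meas" by measurable
    show ?thesis
      using fatou_real[OF Dp[of i] _ m _ lim cauchy[of i], of i] by auto
  qed
  have "in_Lp p (\<lambda>t. 1 * F 0 t + (- 1) * (F 0 t - G t))"
    using fat[of 0] p F by (intro in_Lp_lincomb) (auto simp: in_Lp_def)
  then have "in_Lp p G" by simp
  with fat show ?thesis by blast
qed

lemma leaf_le_tav:
  assumes "m div 2 ^ k = n" "\<And>m. 0 \<le> \<phi> m"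
  shows "\<phi> m \<le> 2 ^ k * tav k \<phi> n"
proof -
  have "n * 2 ^ k \<le> m" using assms(1) by (metis div_times_less_eq_dividend)
  moreover have "m < (n + 1) * 2 ^ k"
    using dividend_less_times_div[of "2 ^ k" m] assms(1) by (simp add: algebra_simps)
  ultimately have "m \<in> {n * 2 ^ k..<(n + 1) * 2 ^ k}" by simp
  then have "\<phi> m \<le> (\<Sum>m\<in>{n * 2 ^ k..<(n + 1) * 2 ^ k}. \<phi> m)" using assms(2) by (intro member_le_sum) auto
  then show ?thesis unfolding tav_eq_sum by simp
qed

lemma div_pow_floor_log: assumes "n > 0" shows "n div 2 ^ floor_log n = 1"
proof -
  have "2 ^ floor_log n \<le> n" "n < 2 * 2 ^ floor_log n" using floor_log_bounds assms by auto
  then show ?thesis by (intro div_nat_eqI) auto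
qed

lemma geometric_null: "(\<lambda>i. C * (1 / 2 ^ i)) \<longlonglongrightarrow> 0" for C :: real
  using tendsto_mult_right_zero[OF LIMSEQ_power_zero[of "1 / 2 :: real"], of C] by (simp add: power_one_over)

lemma avg_tendsto:
  fixes F :: "nat \<Rightarrow> real \<Rightarrow> complex"
  assumes p: "1 < p" and F: "\<And>i. in_Lp p (F i)" and G: "in_Lp p G"
    and bd: "\<And>i. (\<integral>t. norm (F i t - G t) powr p \<partial>I_meas) \<le> M * (1 / 2 ^ i) powr p"
    and M: "0 \<le> M" and n: "n > 0"
  shows "(\<lambda>i. avg (F i) n) \<longlonglongrightarrow> avg G n"
proof -
  have Fi: "integrable I_meas (F i)" for i using in_Lp_integrable[OF _ F] p by simp
  have Gi: "integrable I_meas G" using in_Lp_integrable[OF _ G] p by simp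
  have "norm (avg (F i) n - avg G n) \<le> (2 ^ floor_log n * M) powr (1 / p) * (1 / 2 ^ i)" for i
  proof (rule powr_le_imp_le)
    have "in_Lp p (\<lambda>t. F i t - G t)" using in_Lp_lincomb[of p "F i" G 1 "-1"] p F G by simp
    from norm_avg_powr_le[OF p this n] have "norm (avg (\<lambda>t. F i t - G t) n) powr p \<le> 2 ^ floor_log n * (M * (1 / 2 ^ i) powr p)"
      using bd[of i] by (smt (verit) mult_left_mono zero_le_power)
    moreover have "avg (\<lambda>t. F i t - G t) n = avg (F i) n - avg G n"
      using avg_add[OF Fi[of i], of "\<lambda>t. - 1 * G t" n] avg_cmult[OF Gi n, of "-1"] Gi n by simp
    ultimately show "norm (avg (F i) n - avg G n) powr p \<le> 2 ^ floor_log n * M * (1 / 2 ^ i) powr p" by (simp add: mult.assoc)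
  qed (use p M in auto)
  from Lim_null_comparison[OF always_eventually[OF allI[OF this]] geometric_null]
  show ?thesis by (simp add: LIM_zero_iff)
qed

text \<open>Approximation uniformly in the level makes the approximants Cauchy in L^p; the limit has
  the right coefficients because each single node is controlled by the norm at its level.\<close>

lemma riesz_fischer:
  assumes p: "1 < p"
    and appr: "\<And>e. e > 0 \<Longrightarrow> \<exists>F. in_Lp0 p F \<and> (\<forall>k. hnorm p k (\<lambda>n. b n - coef F n) \<le> e)"
  shows "\<exists>F. in_Lp0 p F \<and> (\<forall>n>0. coef F n = b n)"
proof -
  \<comment> \<open>Comparing two approximants through \<open>b\<close> costs
    \<open>2 powr p\<close> times the sum of two errors; this choice gives exactly the rate that
    \<open>Lp_limit\<close> expects.\<close>
  define e where "e i = (1 / 2 ^ i) powr p / (2 * 2 powr p)" for i :: nat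
  have e: "e i > 0" for i by (simp add: e_def)
  have "\<forall>i. \<exists>F. in_Lp0 p F \<and> (\<forall>k. hnorm p k (\<lambda>n. b n - coef F n) \<le> e i)" using appr e by blast
  then obtain F where F: "\<And>i. in_Lp0 p (F i)" "\<And>i k. hnorm p k (\<lambda>n. b n - coef (F i) n) \<le> e i" by metis
  note FD = in_Lp0_D[OF p F(1)]
  have "(\<integral>t. norm (F i t - F j t) powr p \<partial>I_meas) \<le> (1 / 2 ^ i) powr p" if "i \<le> j" for i j
  proof (rule in_Lp_if_hnorm_bounded(2)[where N = 0])
    fix k
    have "hnorm p k (coef (\<lambda>t. F i t - F j t)) = hnorm p k (\<lambda>n. (b n - coef (F j) n) - (b n - coef (F i) n))"
      using coef_lincomb[OF FD(2) FD(2), of _ 1 i "-1" j] by (intro hnorm_cong) simp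
    also have "\<dots> \<le> 2 powr p * (hnorm p k (\<lambda>n. b n - coef (F j) n) + hnorm p k (\<lambda>n. b n - coef (F i) n))"
      using p by (intro hnorm_diff_le) auto
    also have "\<dots> \<le> 2 powr p * (e j + e i)" by (intro mult_left_mono add_mono F(2)) auto
    also have "\<dots> \<le> 2 powr p * (e i + e i)"
      using that p unfolding e_def
      by (intro mult_left_mono add_right_mono divide_right_mono powr_mono2 divide_left_mono) auto
    also have "\<dots> = (1 / 2 ^ i) powr p" by (simp add: e_def)
    finally show "hnorm p k (coef (\<lambda>t. F i t - F j t)) \<le> (1 / 2 ^ i) powr p" .
  qed (use p FD in auto)
  from Lp_limit[OF p FD(1) this] obtain G where G: "in_Lp p G"
    "\<And>i. (\<integral>t. norm (F i t - G t) powr p \<partial>I_meas) \<le> (1 / 2 ^ i) powr p" by blast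
  have Gi: "integrable I_meas G" using in_Lp_integrable[OF _ G(1)] p by simp
  have avgl: "(\<lambda>i. avg (F i) n) \<longlonglongrightarrow> avg G n" if n: "n > 0" for n
    using G(2) by (intro avg_tendsto[OF p FD(1) G(1) _ _ n, where M = 1]) auto
  have "(\<lambda>i. avg (F i) 1) \<longlonglongrightarrow> avg G 1" using avgl by simp
  then have "integral\<^sup>L I_meas G = 0" using FD(3) by (simp add: avg_one LIMSEQ_const_iff)
  then have G0: "in_Lp0 p G" using G by (simp add: in_Lp0_def)
  have "coef G n = b n" if n: "n > 0" for n
  proof -
    have "(\<lambda>i. coef (F i) n) \<longlonglongrightarrow> coef G n" unfolding coef_def using n by (intro tendsto_intros avgl) auto
    moreover have "(\<lambda>i. b n - coef (F i) n) \<longlonglongrightarrow> 0"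
    proof -
      define D where "D i = (\<lambda>n. b n - coef (F i) n)" for i
      have md: "(\<lambda>i. mart (D i) m) \<longlonglongrightarrow> 0" if "m > 0" for m
      proof -
        have "norm (mart (D i) m) \<le> (2 ^ floor_log m) powr (1 / p) * (1 / 2 ^ i)" for i
        proof (rule powr_le_imp_le)
          have "norm (mart (D i) m) powr p \<le> 2 ^ floor_log m * hnorm p (floor_log m) (D i)"
            unfolding hnorm_def using leaf_le_tav[OF div_pow_floor_log[OF that], of "\<lambda>m. norm (mart (D i) m) powr p"] by simp
          also have "\<dots> \<le> 2 ^ floor_log m * (1 / 2 ^ i) powr p"
          proof (intro mult_left_mono)
            have "1 \<le> 2 * (2::real) powr p" using p ge_one_powr_ge_zero[of 2 p] by simp
            then have "e i \<le> (1 / 2 ^ i) powr p" unfolding e_def by (simp add: divide_le_eq mult_le_cancel_left1)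
            then show "hnorm p (floor_log m) (D i) \<le> (1 / 2 ^ i) powr p" using F(2)[of "floor_log m" i] by (simp add: D_def)
          qed simp
          finally show "norm (mart (D i) m) powr p \<le> 2 ^ floor_log m * (1 / 2 ^ i) powr p" .
        qed (use p in auto)
        from Lim_null_comparison[OF always_eventually[OF allI[OF this]] geometric_null] show ?thesis .
      qed
      have "(\<lambda>i. (mart (D i) (2 * n) - mart (D i) (Suc (2 * n))) / 2) \<longlonglongrightarrow> (0 - 0) / 2"
        using n by (intro tendsto_intros md) auto
      moreover have "(\<lambda>i. (mart (D i) (2 * n) - mart (D i) (Suc (2 * n))) / 2) = (\<lambda>i. D i n)"
        using n by (simp add: mart_left mart_right)
      ultimately have "(\<lambda>i. D i n) \<longlonglongrightarrow> (0 - 0) / 2" by (simp only:)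
      then show ?thesis by (simp add: D_def)
    qed
    then have "(\<lambda>i. b n - (b n - coef (F i) n)) \<longlonglongrightarrow> b n - 0" by (intro tendsto_intros)
    ultimately show ?thesis using LIMSEQ_unique by fastforce
  qed
  with G0 show ?thesis by blast
qed


lemma ivl_descendant:
  assumes "m div 2 ^ j = n" "n > 0"
  shows "ivl m \<subseteq> ivl n"
proof
  fix t assume t: "t \<in> ivl m"
  have "n * 2 ^ j \<le> m" using assms(1) by (metis div_times_less_eq_dividend)
  then have 1: "real n * 2 ^ j \<le> real m" by (metis of_nat_le_iff of_nat_mult of_nat_numeral of_nat_power)
  have "m + 1 \<le> (n + 1) * 2 ^ j"
    using dividend_less_times_div[of "2 ^ j" m] assms(1) by (simp add: algebra_simps)
  then have "real (m + 1) \<le> real ((n + 1) * 2 ^ j)" by (rule of_nat_mono)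
  then have 2: "real m + 1 \<le> (real n + 1) * 2 ^ j" by (simp add: algebra_simps)
  have fl: "floor_log m = j + floor_log n" by (rule floor_log_div_pow[OF assms])
  define x where "x = 2 ^ floor_log n * (1 + t)"
  have "(2::real) ^ floor_log m * (1 + t) = x * 2 ^ j" by (simp add: fl x_def power_add)
  then have "real m < x * 2 ^ j" "x * 2 ^ j \<le> real m + 1" using t by (auto simp: ivl_def)
  then have "real n * 2 ^ j < x * 2 ^ j" "x * 2 ^ j \<le> (real n + 1) * 2 ^ j" using 1 2 by linarith+
  then show "t \<in> ivl n" by (simp add: ivl_def x_def)
qed

section \<open>Dilations and translations\<close>

lemma dil_ivl:
  assumes "n > 0"
  shows "dil f n t = (if t \<in> ivl n then f (2 ^ floor_log n * (1 + t) - real n) else 0)"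
proof -
  have j: "real (n - 2 ^ floor_log n) = real n - 2 ^ floor_log n"
    using floor_log_bounds(1)[OF assms] by (simp add: of_nat_diff)
  have "(real n - 2 ^ floor_log n) / 2 ^ floor_log n < t \<and> t \<le> (real n - 2 ^ floor_log n + 1) / 2 ^ floor_log n
      \<longleftrightarrow> t \<in> ivl n"
    unfolding ivl_def by (auto simp: field_simps)
  moreover have "2 ^ floor_log n * t - (real n - 2 ^ floor_log n) = 2 ^ floor_log n * (1 + t) - real n"
    by (simp add: algebra_simps)
  ultimately show ?thesis unfolding dil_def Let_def j by (simp only:)
qed

text \<open>The substitution maps the unit interval onto the support of \<open>dil f n\<close> and
  moves the subtree at \<open>n\<close> to the root: the node \<open>m\<close>, \<open>j\<close>
  levels below \<open>n\<close>, becomes \<open>2 ^ j + (m - n * 2 ^ j)\<close>.\<close>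

lemma dil_affine:
  fixes f :: "real \<Rightarrow> complex"
  assumes n: "n > 0" and m: "m div 2 ^ j = n"
  shows "indicator (ivl m) (real n / 2 ^ floor_log n - 1 + 1 / 2 ^ floor_log n * s) *\<^sub>R
      dil f n (real n / 2 ^ floor_log n - 1 + 1 / 2 ^ floor_log n * s)
    = indicator (ivl (2 ^ j + (m - n * 2 ^ j))) s *\<^sub>R f s"
proof -
  define i where "i = m - n * 2 ^ j"
  define t where "t = real n / 2 ^ floor_log n - 1 + 1 / 2 ^ floor_log n * s"
  have le: "n * 2 ^ j \<le> m" using m by (metis div_times_less_eq_dividend)
  then have mi: "m = n * 2 ^ j + i" by (simp add: i_def)
  have "m < (n + 1) * 2 ^ j"
    using dividend_less_times_div[of "2 ^ j" m] m by (simp add: algebra_simps)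
  then have i: "i < 2 ^ j" using mi by simp
  have fi: "floor_log (2 ^ j + i) = j" using i by (intro floor_log_eqI) auto
  have s: "2 ^ floor_log n * (1 + t) - real n = s" by (simp add: t_def field_simps)
  have fm: "floor_log m = j + floor_log n" by (rule floor_log_div_pow[OF m n])
  have "2 ^ floor_log m * (1 + t) = 2 ^ j * (2 ^ floor_log n * (1 + t))" by (simp add: fm power_add)
  also have "\<dots> = 2 ^ j * (real n + s)" using s by (simp add: algebra_simps)
  finally have eq: "2 ^ floor_log m * (1 + t) = 2 ^ j * (real n + s)" .
  have "t \<in> ivl m \<longleftrightarrow> s \<in> ivl (2 ^ j + i)"
    unfolding ivl_def fi mem_Collect_eq eq by (simp add: mi algebra_simps)
  moreover have "t \<in> ivl m \<Longrightarrow> dil f n t = f s"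
    using ivl_descendant[OF m n] s by (auto simp: dil_ivl[OF n])
  ultimately show ?thesis unfolding t_def[symmetric] i_def[symmetric] by (auto simp: indicator_def)
qed

lemma integrable_dil:
  fixes f :: "real \<Rightarrow> complex"
  assumes n: "n > 0" and f: "integrable I_meas f"
  shows "integrable I_meas (dil f n)"
proof -
  have "integrable lebesgue (\<lambda>t. indicator (ivl n) t *\<^sub>R dil f n t)"
    using lebesgue_integrable_real_affine_iff[of "1 / 2 ^ floor_log n" "\<lambda>t. indicator (ivl n) t *\<^sub>R dil f n t" "real n / 2 ^ floor_log n - 1"]
      dil_affine[OF n, where m = n and j = 0 and f = f] f unfolding integrable_I_meas_iff by simp
  moreover have "indicator (ivl n) t *\<^sub>R dil f n t = indicator {0<..1} t *\<^sub>R dil f n t" for t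
    using ivl_subset[OF n] by (auto simp: indicator_def dil_ivl[OF n])
  ultimately show ?thesis unfolding integrable_I_meas_iff by (simp only:)
qed

lemma avg_dil:
  fixes f :: "real \<Rightarrow> complex"
  assumes n: "n > 0" and m: "m div 2 ^ j = n"
  shows "avg (dil f n) m = avg f (2 ^ j + (m - n * 2 ^ j))"
proof -
  let ?l = "floor_log n"
  have "m < (n + 1) * 2 ^ j"
    using dividend_less_times_div[of "2 ^ j" m] m by (simp add: algebra_simps)
  moreover have "n * 2 ^ j \<le> m" using m by (metis div_times_less_eq_dividend)
  ultimately have "m - n * 2 ^ j < 2 ^ j" by (simp add: less_diff_conv2)
  then have fi: "floor_log (2 ^ j + (m - n * 2 ^ j)) = j" by (intro floor_log_eqI) auto
  have fm: "floor_log m = j + ?l" by (rule floor_log_div_pow[OF m n])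
  have "(\<integral>t. indicator (ivl m) t *\<^sub>R dil f n t \<partial>lebesgue)
    = \<bar>1 / 2 ^ ?l\<bar> *\<^sub>R (\<integral>s. indicator (ivl (2 ^ j + (m - n * 2 ^ j))) s *\<^sub>R f s \<partial>lebesgue)"
    by (subst lebesgue_integral_real_affine[where c = "1 / 2 ^ ?l" and t = "real n / 2 ^ ?l - 1"])
      (simp_all only: dil_affine[OF n m], simp)
  then show ?thesis unfolding avg_def fi fm by (simp add: power_add)
qed

lemma avg_dil_outside:
  assumes "n > 0" "m > 0" "m div 2 ^ j \<noteq> n" "floor_log m = j + floor_log n"
  shows "avg (dil f n) m = 0"
proof -
  have m0: "m div 2 ^ j > 0"
  proof -
    have "2 ^ j \<le> (2::nat) ^ floor_log m" using assms(4) by (intro power_increasing) auto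
    then have "2 ^ j \<le> m" using floor_log_bounds(1)[OF assms(2)] by linarith
    then show ?thesis by (simp add: div_greater_zero_iff)
  qed
  have fl: "floor_log (m div 2 ^ j) = floor_log n" using floor_log_div_pow[OF refl m0] assms(4) by simp
  have "avg (dil f n) m = avg (\<lambda>t. 0) m"
  proof (rule avg_cong)
    fix t assume "t \<in> ivl m"
    then have "t \<in> ivl (m div 2 ^ j)" using ivl_descendant[OF refl m0] by blast
    then have "node (floor_log n) t = m div 2 ^ j" using node_unique[OF _ m0, of t] fl by simp
    then have "t \<notin> ivl n" using node_unique[OF _ assms(1), of t] assms(3) by auto
    then show "dil f n t = 0" by (simp add: dil_ivl[OF assms(1)])
  qed
  then show ?thesis by (simp add: avg_const)
qed

lemma avg_dil_low:
  fixes f :: "real \<Rightarrow> complex"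
  assumes f: "integrable I_meas f" "integral\<^sup>L I_meas f = 0" and n: "n > 0"
    and "m > 0" "floor_log m + i = floor_log n"
  shows "avg (dil f n) m = 0"
  using assms(4,5)
proof (induction i arbitrary: m)
  case 0
  show ?case
  proof (cases "m = n")
    case True
    then show ?thesis using avg_dil[OF n, of n 0 f] f(2) by (simp add: avg_one)
  next
    case False
    then show ?thesis using 0 n by (intro avg_dil_outside[of _ _ 0]) auto
  qed
next
  case (Suc i)
  have "avg (dil f n) (2 * m) = 0" "avg (dil f n) (Suc (2 * m)) = 0" using Suc.prems by (auto intro!: Suc.IH)
  then show ?case using avg_split[OF integrable_dil[OF n f(1)] Suc.prems(1)] by simp
qed

definition unit :: "nat \<Rightarrow> nat \<Rightarrow> complex" where
  "unit n i = (if i = n then 1 else 0)"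

lemma conv_unit_pow:
  assumes "n > 0"
  shows "conv c (unit n) (2 ^ j * n) = c j"
proof -
  have "conv c (unit n) (2 ^ j * n) = (\<Sum>i | i < 2 ^ j * n \<and> 2 ^ i dvd 2 ^ j * n. if i = j then c j else 0)"
    unfolding conv_def
  proof (intro sum.cong refl)
    fix i assume "i \<in> {i. i < 2 ^ j * n \<and> 2 ^ i dvd 2 ^ j * n}"
    then have "2 ^ i * (2 ^ j * n div 2 ^ i) = 2 ^ j * n" by simp
    then have "2 ^ j * n div 2 ^ i = n \<longleftrightarrow> i = j" using assms by (metis mult_right_cancel nonzero_mult_div_cancel_left not_gr_zero power_inject_exp one_less_numeral_iff semiring_norm(76) zero_neq_numeral power_not_zero)
    then show "c i * unit n (2 ^ j * n div 2 ^ i) = (if i = j then c j else 0)" by (simp add: unit_def)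
  qed
  also have "\<dots> = c j"
  proof (subst sum.delta)
    have "j < 2 ^ j * n" using assms by (metis less_exp mult.right_neutral less_le_trans mult_le_mono2 One_nat_def Suc_leI)
    then show "(if j \<in> {i. i < 2 ^ j * n \<and> 2 ^ i dvd 2 ^ j * n} then c j else 0) = c j" by simp
  qed simp
  finally show ?thesis .
qed

lemma conv_unit_other:
  assumes "\<And>i. m \<noteq> 2 ^ i * n"
  shows "conv c (unit n) m = 0"
  unfolding conv_def
proof (intro sum.neutral ballI)
  fix i assume "i \<in> {i. i < m \<and> 2 ^ i dvd m}"
  then have "m = 2 ^ i * (m div 2 ^ i)" by simp
  then have "m div 2 ^ i \<noteq> n" using assms[of i] by metis
  then show "c i * unit n (m div 2 ^ i) = 0" by (simp add: unit_def)
qed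

text \<open>Dilation transplants the ray 1, 2, 4, ... to the ray through \<open>n\<close>, 2n, 4n,
  ... . So on coefficients the system consists of the images of the unit vectors under
  \<open>conv c\<close>.\<close>

lemma coef_dil:
  fixes f :: "real \<Rightarrow> complex"
  assumes f: "integrable I_meas f" "integral\<^sup>L I_meas f = 0"
    and c: "\<And>m. m > 0 \<Longrightarrow> coef f m = conv c (unit 1) m"
    and n: "n > 0" and m: "m > 0"
  shows "coef (dil f n) m = conv c (unit n) m"
proof (cases "floor_log m < floor_log n")
  case True
  then obtain i where i: "floor_log m + Suc i = floor_log n" by (metis add_Suc_right less_natE)
  have "avg (dil f n) (2 * m) = 0" "avg (dil f n) (Suc (2 * m)) = 0"
    using i m by (auto intro!: avg_dil_low[OF f n, of _ i])
  moreover have "m \<noteq> 2 ^ i * n" for i using True n by (auto simp: floor_log_pow_mult)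
  ultimately show ?thesis by (simp add: coef_def conv_unit_other)
next
  case False
  then obtain j where j: "floor_log m = j + floor_log n" by (metis add.commute le_Suc_ex not_less)
  have d: "2 * m div 2 ^ Suc j = m div 2 ^ j" "Suc (2 * m) div 2 ^ Suc j = m div 2 ^ j"
    by (simp_all add: div_mult2_eq)
  show ?thesis
  proof (cases "m div 2 ^ j = n")
    case False
    have "avg (dil f n) (2 * m) = 0" "avg (dil f n) (Suc (2 * m)) = 0"
      using m n j False d by (auto intro!: avg_dil_outside[of _ _ "Suc j"] simp del: power_Suc)
    moreover have "m \<noteq> 2 ^ i * n" for i
    proof
      assume "m = 2 ^ i * n"
      then have "i = j" using j n by (auto simp: floor_log_pow_mult)
      with \<open>m = 2 ^ i * n\<close> False show False by simp
    qed
    ultimately show ?thesis by (simp add: coef_def conv_unit_other)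
  next
    case True
    define i where "i = m - n * 2 ^ j"
    have "n * 2 ^ j \<le> m" using True by (metis div_times_less_eq_dividend)
    then have mi: "m = 2 ^ j * n + i" by (simp add: i_def mult.commute)
    have "m < (n + 1) * 2 ^ j"
      using dividend_less_times_div[of "2 ^ j" m] True by (simp add: algebra_simps)
    then have i: "i < 2 ^ j" using mi by (simp add: algebra_simps)
    have "avg (dil f n) (2 * m) = avg f (2 ^ Suc j + (2 * m - n * 2 ^ Suc j))"
      using True d by (intro avg_dil n) simp
    also have "2 ^ Suc j + (2 * m - n * 2 ^ Suc j) = 2 * (2 ^ j + i)" by (simp add: mi)
    finally have 1: "avg (dil f n) (2 * m) = avg f (2 * (2 ^ j + i))" .
    have "avg (dil f n) (Suc (2 * m)) = avg f (2 ^ Suc j + (Suc (2 * m) - n * 2 ^ Suc j))"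
      using True d by (intro avg_dil n) simp
    also have "2 ^ Suc j + (Suc (2 * m) - n * 2 ^ Suc j) = Suc (2 * (2 ^ j + i))" by (simp add: mi)
    finally have 2: "avg (dil f n) (Suc (2 * m)) = avg f (Suc (2 * (2 ^ j + i)))" .
    have "coef (dil f n) m = coef f (2 ^ j + i)" by (simp only: coef_def 1 2)
    also have "\<dots> = conv c (unit 1) (2 ^ j + i)" by (rule c) simp
    also have "\<dots> = conv c (unit n) m"
    proof (cases "i = 0")
      case True
      then show ?thesis using conv_unit_pow[of 1 c j] conv_unit_pow[OF n, of c j] mi by simp
    next
      case False
      have "floor_log (2 ^ j + i) = j" using i by (intro floor_log_eqI) auto
      then have "2 ^ j + i \<noteq> 2 ^ i'" for i' using False by (metis add_cancel_left_right floor_log_power)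
      moreover have "m \<noteq> 2 ^ i' * n" for i'
      proof
        assume *: "m = 2 ^ i' * n"
        then have "i' = j" using j n by (auto simp: floor_log_pow_mult)
        with * mi False show False by simp
      qed
      ultimately show ?thesis by (simp add: conv_unit_other)
    qed
    finally show ?thesis .
  qed
qed

text \<open>The interval is \<open>1 / 2 ^ Suc k < t \<le> 1 / 2 ^ k\<close>: the Haar functions
  with \<open>i < k\<close> are 1 there, the one with \<open>i = k\<close> is -1 and the later ones
  vanish. So a chaos is constant on it.\<close>

lemma chaos_value:
  assumes c: "(\<lambda>i. c i * dil haar (2 ^ i) t) sums f" and t: "t \<in> ivl (Suc (2 * 2 ^ k))"
  shows "f = (\<Sum>i<k. c i) - c k"
proof -
  have t': "1 / 2 ^ Suc k < t" "t \<le> 1 / 2 ^ k"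
    using t floor_log_Suc_twice[of "2 ^ k"] by (auto simp: ivl_eq field_simps)
  have v: "dil haar (2 ^ i) t = (if i < k then 1 else if i = k then - 1 else 0)" for i
  proof -
    have "t \<in> ivl (2 ^ i) \<longleftrightarrow> 0 < t \<and> t \<le> 1 / 2 ^ i" by (auto simp: ivl_eq field_simps)
    then have d: "dil haar (2 ^ i) t = (if 0 < t \<and> t \<le> 1 / 2 ^ i then haar (2 ^ i * t) else 0)"
      by (simp add: dil_ivl algebra_simps)
    have t0: "0 < t" using t'(1) by (smt (verit) divide_pos_pos zero_less_power)
    consider "i < k" | "i = k" | "i > k" by linarith
    then show ?thesis
    proof cases
      case 1
      then have "(1::real) / 2 ^ k \<le> 1 / 2 ^ Suc i" by (intro divide_left_mono power_increasing) auto
      then have le: "t \<le> 1 / 2 ^ Suc i" using t'(2) by linarith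
      also have "(1::real) / 2 ^ Suc i \<le> 1 / 2 ^ i" by (simp add: field_simps)
      finally have "t \<le> 1 / 2 ^ i" .
      moreover have "2 ^ i * t \<le> 1 / 2" using le by (simp add: field_simps)
      ultimately show ?thesis using 1 t0 by (simp add: d haar_def)
    next
      case 2
      then have "2 ^ i * t > 1 / 2" "2 ^ i * t \<le> 1" "t \<le> 1 / 2 ^ i" using t' by (auto simp: field_simps)
      then have "dil haar (2 ^ i) t = - 1" using t0 by (simp add: d haar_def)
      then show ?thesis using 2 by simp
    next
      case 3
      then have "(1::real) / 2 ^ i \<le> 1 / 2 ^ Suc k" by (intro divide_left_mono power_increasing) auto
      then have "t > 1 / 2 ^ i" using t'(1) by linarith
      then show ?thesis using 3 by (simp add: d)
    qed
  qed
  have "(\<lambda>i. c i * dil haar (2 ^ i) t) sums (\<Sum>i<Suc k. c i * dil haar (2 ^ i) t)"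
    by (rule sums_finite) (auto simp: v)
  then have "f = (\<Sum>i<Suc k. c i * dil haar (2 ^ i) t)" using c sums_unique2 by blast
  then show ?thesis by (simp add: v)
qed

lemma not_pow2_descendant:
  assumes "m > 0" "\<And>i. m \<noteq> 2 ^ i"
  shows "\<exists>j k. m div 2 ^ j = Suc (2 * 2 ^ k)"
  using assms
proof (induction m rule: tree_induct)
  case one
  then show ?case using one[of 0] by simp
next
  case (left n)
  have "n \<noteq> 2 ^ i" for i using left.prems[of "Suc i"] by auto
  then obtain j k where "n div 2 ^ j = Suc (2 * 2 ^ k)" using left.IH by blast
  then have "2 * n div 2 ^ Suc j = Suc (2 * 2 ^ k)" by (simp add: div_mult2_eq)
  then show ?case by blast
next
  case (right n)
  show ?case
  proof (cases "\<exists>i. n = 2 ^ i")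
    case True
    then obtain i where "n = 2 ^ i" by blast
    then have "Suc (2 * n) div 2 ^ 0 = Suc (2 * 2 ^ i)" by simp
    then show ?thesis by blast
  next
    case False
    then obtain j k where "n div 2 ^ j = Suc (2 * 2 ^ k)" using right.IH by blast
    then have "Suc (2 * n) div 2 ^ Suc j = Suc (2 * 2 ^ k)" by (simp add: div_mult2_eq)
    then show ?thesis by blast
  qed
qed

text \<open>Off the leftmost ray the chaos is constant on the interval of the node. On that ray
  infinitely many terms matter near 0 and termwise integration is avoided: the mean zero at the root
  and the constants on the right children determine the averages one after the other.\<close>

lemma coef_chaos:
  fixes f :: "real \<Rightarrow> complex"
  assumes f: "integrable I_meas f" "integral\<^sup>L I_meas f = 0"
    and c: "\<And>t. t \<in> {0<..1} \<Longrightarrow> (\<lambda>i. c i * dil haar (2 ^ i) t) sums f t"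
    and m: "m > 0"
  shows "coef f m = conv c (unit 1) m"
proof -
  have const: "avg f n = (\<Sum>i<k. c i) - c k" if "n div 2 ^ j = Suc (2 * 2 ^ k)" for n j k
  proof -
    have sub: "ivl n \<subseteq> ivl (Suc (2 * 2 ^ k))" using that by (intro ivl_descendant) auto
    have "avg f n = avg (\<lambda>t. (\<Sum>i<k. c i) - c k) n"
    proof (rule avg_cong)
      fix t assume "t \<in> ivl n"
      then have t: "t \<in> ivl (Suc (2 * 2 ^ k))" using sub by blast
      moreover have "t \<in> {0<..1}" using t ivl_subset[of "Suc (2 * 2 ^ k)"] by blast
      ultimately show "f t = (\<Sum>i<k. c i) - c k" using chaos_value[OF c] by blast
    qed
    then show ?thesis by (simp add: avg_const)
  qed
  show ?thesis
  proof (cases "\<exists>k. m = 2 ^ k")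
    case False
    then obtain j k where jk: "m div 2 ^ j = Suc (2 * 2 ^ k)" using not_pow2_descendant[OF m] by blast
    have "2 * m div 2 ^ Suc j = Suc (2 * 2 ^ k)" "Suc (2 * m) div 2 ^ Suc j = Suc (2 * 2 ^ k)"
      using jk by (simp_all add: div_mult2_eq)
    from const[OF this(1)] const[OF this(2)] have "coef f m = 0" by (simp add: coef_def)
    moreover have "conv c (unit 1) m = 0" using False by (intro conv_unit_other) auto
    ultimately show ?thesis by simp
  next
    case True
    then obtain k where k: "m = 2 ^ k" by blast
    have right: "avg f (Suc (2 * 2 ^ k)) = (\<Sum>i<k. c i) - c k" for k by (rule const[of _ 0]) simp
    have spine: "avg f (2 ^ k) = (\<Sum>i<k. c i)" for k
    proof (induction k)
      case 0
      then show ?case using f(2) by (simp add: avg_one)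
    next
      case (Suc k)
      have "avg f (2 * 2 ^ k) + avg f (Suc (2 * 2 ^ k)) = 2 * avg f (2 ^ k)"
        using avg_children[OF f(1), of "2 ^ k"] by simp
      then have "avg f (2 * 2 ^ k) = 2 * avg f (2 ^ k) - avg f (Suc (2 * 2 ^ k))" by (simp add: algebra_simps)
      then show ?case by (simp add: right Suc)
    qed
    have "coef f m = c k" using spine[of "Suc k"] by (simp add: coef_def k right)
    then show ?thesis using conv_unit_pow[of 1 c k] by (simp add: k)
  qed
qed

section \<open>The Haar system itself\<close>

lemma haar_measurable: "haar \<in> borel_measurable I_meas"
proof -
  have "haar \<in> borel_measurable borel" unfolding haar_def[abs_def] by measurable
  then show ?thesis unfolding I_meas_def by (intro measurable_restrict_space1 measurable_completion) simp
qed

lemma norm_haar_le: "norm (haar t) \<le> 1"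
  by (simp add: haar_def)

lemma bounded_in_Lp:
  assumes p: "0 < p" and "g \<in> borel_measurable I_meas" "\<And>t. norm (g t) \<le> B"
  shows "in_Lp p g"
proof -
  have "integrable I_meas (\<lambda>t. norm (g t) powr p)"
  proof (rule finite_measure.integrable_const_bound[OF finite_measure_I_meas])
    show "AE t in I_meas. norm (norm (g t) powr p) \<le> B powr p"
      using assms by (intro AE_I2) (auto intro!: powr_mono2)
    show "(\<lambda>t. norm (g t) powr p) \<in> borel_measurable I_meas" using assms(2) by measurable
  qed
  then show ?thesis using assms(2) by (simp add: in_Lp_def)
qed

lemma haar_integrable: "integrable I_meas haar"
  using in_Lp_integrable[OF _ bounded_in_Lp[of 2 haar 1]] haar_measurable norm_haar_le by simp

lemma haar_mean: "integral\<^sup>L I_meas haar = 0"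
proof -
  have i: "ivl 2 = {0<..1 / 2}" "ivl 3 = {1 / 2<..1}"
    using floor_log_twice[of 1] floor_log_Suc_twice[of 1] by (auto simp: ivl_eq)
  have "avg haar 2 = avg (\<lambda>t. 1) 2" by (rule avg_cong) (auto simp: i haar_def)
  moreover have "avg haar 3 = avg (\<lambda>t. - 1) 3" by (rule avg_cong) (auto simp: i haar_def)
  ultimately have "avg haar 1 = 0" using avg_split[OF haar_integrable, of 1] by (simp add: avg_const)
  then show ?thesis by (simp add: avg_one)
qed

text \<open>\<open>haar\<close> is the chaos whose power series is 1, so its convolution operator is
  the identity.\<close>

lemma coef_haar_dil:
  assumes "n > 0" "m > 0"
  shows "coef (dil haar n) m = unit n m"
proof -
  define c :: "nat \<Rightarrow> complex" where "c i = (if i = 0 then 1 else 0)" for i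
  have "(\<lambda>i. c i * dil haar (2 ^ i) t) sums haar t" if "t \<in> {0<..1}" for t
  proof -
    have "dil haar (2 ^ 0) t = haar t" using that by (simp add: dil_ivl)
    moreover have "(\<lambda>i. c i * dil haar (2 ^ i) t) sums (\<Sum>i<1. c i * dil haar (2 ^ i) t)"
      by (rule sums_finite) (auto simp: c_def)
    ultimately show ?thesis by (simp add: c_def)
  qed
  from coef_dil[OF haar_integrable haar_mean coef_chaos[OF haar_integrable haar_mean this] assms]
  have "coef (dil haar n) m = conv c (unit n) m" by blast
  also have "\<dots> = unit n m"
  proof -
    obtain k q where q: "odd q" "m = 2 ^ k * q" using nat_odd_decomp[OF assms(2)] by blast
    have "Abs_fps c = 1" by (simp add: fps_eq_iff c_def)
    then have "Abs_fps (\<lambda>k. conv c (unit n) (2 ^ k * q)) = Abs_fps (\<lambda>k. unit n (2 ^ k * q))"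
      using conv_fps[OF q(1)] by simp
    then show ?thesis using q by (simp add: fps_eq_iff)
  qed
  finally show ?thesis .
qed

lemma haar_dil_in_Lp0:
  assumes "1 < p" "n > 0"
  shows "in_Lp0 p (dil haar n)"
proof -
  have i: "integrable I_meas (dil haar n)" by (rule integrable_dil[OF assms(2) haar_integrable])
  have "norm (dil haar n t) \<le> 1" for t using norm_haar_le by (simp add: dil_ivl[OF assms(2)])
  then have "in_Lp p (dil haar n)" using i assms(1) by (intro bounded_in_Lp) auto
  moreover have "integral\<^sup>L I_meas (dil haar n) = 0"
    using avg_dil_low[OF haar_integrable haar_mean assms(2), of 1 "floor_log n"] by (simp add: avg_one)
  ultimately show ?thesis by (simp add: in_Lp0_def)
qed


section \<open>Density of Haar polynomials\<close>

definition trunc :: "nat \<Rightarrow> (nat \<Rightarrow> complex) \<Rightarrow> nat \<Rightarrow> complex" where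
  "trunc K a n = (if n < 2 ^ K then a n else 0)"

definition haar_poly :: "nat \<Rightarrow> (nat \<Rightarrow> complex) \<Rightarrow> real \<Rightarrow> complex" where
  "haar_poly K a t = (\<Sum>n\<in>{1..<2 ^ K}. a n * dil haar n t)"

lemma in_Lp0_zero: "in_Lp0 p (\<lambda>t. 0)"
  by (simp add: in_Lp0_def in_Lp_def)

lemma in_Lp0_sum:
  assumes "1 < p" "finite A" "\<And>n. n \<in> A \<Longrightarrow> in_Lp0 p (g n)"
  shows "in_Lp0 p (\<lambda>t. \<Sum>n\<in>A. a n * g n t)"
  using assms(2,3)
proof (induction A rule: finite_induct)
  case (insert n A)
  then have "in_Lp0 p (\<lambda>t. a n * g n t + 1 * (\<Sum>n\<in>A. a n * g n t))" by (intro in_Lp0_lincomb assms(1)) auto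
  then show ?case using insert by simp
qed (simp add: in_Lp0_zero)

lemma coef_zero: "coef (\<lambda>t. 0) m = 0"
  by (simp add: coef_def avg_const)

lemma coef_sum:
  assumes "finite A" "\<And>n. n \<in> A \<Longrightarrow> integrable I_meas (g n)" "m > 0"
  shows "coef (\<lambda>t. \<Sum>n\<in>A. a n * g n t) m = (\<Sum>n\<in>A. a n * coef (g n) m)"
  using assms(1,2)
proof (induction A rule: finite_induct)
  case (insert n A)
  have "coef (\<lambda>t. a n * g n t + 1 * (\<Sum>n\<in>A. a n * g n t)) m = a n * coef (g n) m + 1 * coef (\<lambda>t. \<Sum>n\<in>A. a n * g n t) m"
    using insert assms(3) by (intro coef_lincomb) auto
  then show ?case using insert by simp
qed (simp add: coef_zero)

lemma haar_poly_in_Lp0: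
  assumes "1 < p" shows "in_Lp0 p (haar_poly K a)"
  unfolding haar_poly_def[abs_def] by (intro in_Lp0_sum haar_dil_in_Lp0 assms) auto

lemma coef_haar_poly:
  assumes "m > 0"
  shows "coef (haar_poly K a) m = trunc K a m"
proof -
  have "coef (haar_poly K a) m = (\<Sum>n\<in>{1..<2 ^ K}. a n * coef (dil haar n) m)"
    unfolding haar_poly_def[abs_def] using assms by (intro coef_sum) (auto intro: integrable_dil haar_integrable)
  also have "\<dots> = (\<Sum>n\<in>{1..<2 ^ K}. if m = n then a m else 0)"
    using assms by (intro sum.cong) (auto simp: coef_haar_dil unit_def)
  also have "\<dots> = trunc K a m" using assms by (subst sum.delta') (auto simp: trunc_def)
  finally show ?thesis .
qed

lemma mart_trunc:
  assumes "n > 0" "floor_log n \<le> K"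
  shows "mart (trunc K a) n = mart a n"
  using assms
proof (induction n rule: tree_induct)
  case (left n)
  then have "n < 2 ^ K" using floor_log_less_iff[of n K] by simp
  with left show ?case by (simp add: mart_left trunc_def)
next
  case (right n)
  then have "n < 2 ^ K" using floor_log_less_iff[of n K] by simp
  with right show ?case by (simp add: mart_right trunc_def)
qed simp

lemma hnorm_trunc_same: "k \<le> K \<Longrightarrow> hnorm p k (trunc K a) = hnorm p k a"
  unfolding hnorm_def
proof (rule tav_cong)
  fix m :: nat assume "k \<le> K" "m div 2 ^ k = 1"
  then have "m > 0" "floor_log m \<le> K" using leaf_floor_log[of m k] by auto
  then show "norm (mart (trunc K a) m) powr p = norm (mart a m) powr p" by (simp add: mart_trunc)
qed

lemma hnorm_trunc: "hnorm p (K + i) (trunc K a) = hnorm p K a"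
proof -
  have "hnorm p (K + i) (trunc K a) = tav K (tav i (\<lambda>n. norm (mart (trunc K a) n) powr p)) 1"
    by (simp add: hnorm_def tav_tav)
  also have "\<dots> = tav K (\<lambda>n. norm (mart (trunc K a) n) powr p) 1"
  proof (rule tav_cong)
    fix n :: nat assume n: "n div 2 ^ K = 1"
    then have n2: "2 ^ K \<le> n" by (metis div_less not_less zero_neq_one)
    show "tav i (\<lambda>n. norm (mart (trunc K a) n) powr p) n = norm (mart (trunc K a) n) powr p"
    proof (rule tav_mart_zero_below[where G = "\<lambda>z. norm z powr p"])
      show "n > 0" using n by (rule leaf_floor_log)
      fix j m :: nat assume "m div 2 ^ j = n"
      then have "n \<le> m" by auto
      with n2 show "trunc K a m = 0" by (simp add: trunc_def)
    qed
  qed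
  also have "\<dots> = hnorm p K a" using hnorm_trunc_same[of K K p a] by (simp add: hnorm_def)
  finally show ?thesis .
qed

lemma hnorm_two: "hnorm 2 k a = (\<Sum>n\<in>{1..<2 ^ k}. (norm (a n))\<^sup>2 / 2 ^ floor_log n)"
  using tav_mart_sq[of k a] by (simp add: hnorm_def)

text \<open>By Parseval the tail is a difference of partial sums of a bounded series with
  non-negative terms. Exact additivity over nodes is special to exponent 2, so density and
  realisation start from L^2.\<close>

lemma L2_tail:
  assumes B: "\<And>k. hnorm 2 k b \<le> B" and e: "e > 0"
  shows "\<exists>K. \<forall>k. hnorm 2 k (\<lambda>n. b n - trunc K b n) \<le> e"
proof -
  have mono: "hnorm 2 j b \<le> hnorm 2 k b" if "j \<le> k" for j k
  proof -
    have "(2::nat) ^ j \<le> 2 ^ k" using that by (intro power_increasing) auto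
    then show ?thesis unfolding hnorm_two by (intro sum_mono2) auto
  qed
  define S where "S = (SUP k. hnorm 2 k b)"
  have bdd: "bdd_above (range (\<lambda>k. hnorm 2 k b))" by (intro bdd_aboveI[of _ B]) (use B in auto)
  have "S - e < S" using e by simp
  then obtain K where K: "S - e < hnorm 2 K b" unfolding S_def by (subst (asm) less_cSUP_iff[OF _ bdd]) auto
  have "hnorm 2 k (\<lambda>n. b n - trunc K b n) \<le> e" for k
  proof -
    let ?w = "\<lambda>n. (norm (b n))\<^sup>2 / 2 ^ floor_log n"
    let ?J = "max k K"
    have sub: "{1..<(2::nat) ^ K} \<subseteq> {1..<2 ^ ?J}" "{1..<(2::nat) ^ k} \<subseteq> {1..<2 ^ ?J}"
      using power_increasing[of K ?J "2::nat"] power_increasing[of k ?J "2::nat"] by auto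
    have "hnorm 2 k (\<lambda>n. b n - trunc K b n) = (\<Sum>n\<in>{1..<2 ^ k}. if n < 2 ^ K then 0 else ?w n)"
      unfolding hnorm_two by (intro sum.cong) (auto simp: trunc_def)
    also have "\<dots> \<le> (\<Sum>n\<in>{1..<2 ^ ?J}. if n < 2 ^ K then 0 else ?w n)" using sub by (intro sum_mono2) auto
    also have "\<dots> = (\<Sum>n\<in>{1..<2 ^ ?J} - {1..<2 ^ K}. ?w n)" by (intro sum.mono_neutral_cong_right) auto
    also have "\<dots> = hnorm 2 ?J b - hnorm 2 K b" using sub unfolding hnorm_two by (subst sum_diff) auto
    also have "hnorm 2 ?J b \<le> S" unfolding S_def by (intro cSUP_upper bdd) simp
    finally show ?thesis using K by simp
  qed
  then show ?thesis by blast
qed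

lemma riesz_fischer_L2:
  assumes "\<And>k. hnorm 2 k b \<le> B"
  shows "\<exists>F. in_Lp0 2 F \<and> (\<forall>n>0. coef F n = b n)"
proof (rule riesz_fischer)
  fix e :: real assume "e > 0"
  from L2_tail[OF assms this] obtain K where K: "\<And>k. hnorm 2 k (\<lambda>n. b n - trunc K b n) \<le> e" by blast
  have "hnorm 2 k (\<lambda>n. b n - coef (haar_poly K b) n) = hnorm 2 k (\<lambda>n. b n - trunc K b n)" for k
    by (intro hnorm_cong) (simp add: coef_haar_poly)
  with K show "\<exists>F. in_Lp0 2 F \<and> (\<forall>k. hnorm 2 k (\<lambda>n. b n - coef F n) \<le> e)"
    by (intro exI[of _ "haar_poly K b"]) (auto intro: haar_poly_in_Lp0)
qed simp

text \<open>Truncation destroys the mean zero. Up to sign the new mean is that of the truncation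
  error, so subtracting it costs no more in p-th power than the truncation itself.\<close>

lemma bounded_dense:
  assumes p: "1 < p" "p \<le> 2" and g: "in_Lp0 p g" and e: "e > 0"
  shows "\<exists>h. in_Lp0 2 h \<and> (\<integral>t. norm (g t - h t) powr p \<partial>I_meas) \<le> e"
proof -
  note gD = in_Lp0_D[OF p(1) g]
  note [measurable] = gD(4)
  define gt where "gt N t = (if norm (g t) \<le> real N then g t else 0)" for N :: nat and t
  have gm [measurable]: "gt N \<in> borel_measurable I_meas" for N unfolding gt_def[abs_def] by measurable
  have gb: "norm (gt N t) \<le> real N" for N t by (simp add: gt_def)
  have "(\<lambda>N. \<integral>t. norm (g t - gt N t) powr p \<partial>I_meas) \<longlonglongrightarrow> (\<integral>t. 0 \<partial>I_meas)"
  proof (rule integral_dominated_convergence[where w = "\<lambda>t. norm (g t) powr p"])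
    show "AE t in I_meas. (\<lambda>N. norm (g t - gt N t) powr p) \<longlonglongrightarrow> 0"
    proof (rule AE_I2)
      fix t
      obtain N0 :: nat where "norm (g t) \<le> real N0" using real_arch_simple by blast
      then have "\<forall>\<^sub>F N in sequentially. norm (g t - gt N t) powr p = 0"
        by (intro eventually_sequentiallyI[of N0]) (auto simp: gt_def)
      then show "(\<lambda>N. norm (g t - gt N t) powr p) \<longlonglongrightarrow> 0" by (rule tendsto_eventually)
    qed
    show "AE t in I_meas. norm (norm (g t - gt N t) powr p) \<le> norm (g t) powr p" for N
      by (rule AE_I2) (auto simp: gt_def)
    show "(\<lambda>t. norm (g t - gt N t) powr p) \<in> borel_measurable I_meas" for N by measurable
  qed (use gD in auto)
  then have lim: "(\<lambda>N. \<integral>t. norm (g t - gt N t) powr p \<partial>I_meas) \<longlonglongrightarrow> 0" by simp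
  define d where "d = e / (2 * 2 powr p)"
  have d: "d > 0" using e by (simp add: d_def)
  from LIMSEQ_D[OF lim d] obtain N where N: "\<bar>\<integral>t. norm (g t - gt N t) powr p \<partial>I_meas\<bar> < d" by auto
  define m where "m = integral\<^sup>L I_meas (gt N)"
  define h where "h t = gt N t - m" for t
  have gtL: "in_Lp q (gt N)" if "0 < q" for q using bounded_in_Lp[OF that gm gb] .
  have gti: "integrable I_meas (gt N)" using in_Lp_integrable[OF _ gtL[of 2]] by simp
  have hi: "integral\<^sup>L I_meas h = 0" unfolding h_def[abs_def] using gti by (simp add: m_def)
  have "norm (h t) \<le> real N + norm m" for t using gb[of N t] norm_triangle_ineq4[of "gt N t" m] by (simp add: h_def)
  moreover have hm [measurable]: "h \<in> borel_measurable I_meas" unfolding h_def[abs_def] by measurable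
  ultimately have hL: "in_Lp q h" if "0 < q" for q using bounded_in_Lp[OF that] by blast
  then have h2: "in_Lp0 2 h" using hi by (simp add: in_Lp0_def)
  have DL: "in_Lp p (\<lambda>t. g t - gt N t)" using in_Lp_lincomb[of p g "gt N" 1 "-1"] gD gtL[of p] p by simp
  then have Di: "integrable I_meas (\<lambda>t. norm (g t - gt N t) powr p)" by (simp add: in_Lp_def)
  have "avg (\<lambda>t. g t - gt N t) 1 = - m" using gD(2,3) gti by (simp add: avg_one m_def)
  then have mle: "norm m powr p \<le> (\<integral>t. norm (g t - gt N t) powr p \<partial>I_meas)"
    using norm_avg_powr_le[OF p(1) DL, of 1] by simp
  have "(\<integral>t. norm (g t - h t) powr p \<partial>I_meas) \<le> (\<integral>t. 2 powr p * (norm (g t - gt N t) powr p + norm m powr p) \<partial>I_meas)"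
  proof (rule integral_mono)
    show "integrable I_meas (\<lambda>t. norm (g t - h t) powr p)"
      using in_Lp_lincomb[of p g h 1 "-1"] gD hL[of p] p by (simp add: in_Lp_def)
    fix t
    show "norm (g t - h t) powr p \<le> 2 powr p * (norm (g t - gt N t) powr p + norm m powr p)"
    proof -
      have "g t - h t = (g t - gt N t) + m" by (simp add: h_def)
      then show ?thesis using norm_add_powr_le[of p "g t - gt N t" m] p by (simp only:)
    qed
  qed (use Di in auto)
  also have "\<dots> = 2 powr p * ((\<integral>t. norm (g t - gt N t) powr p \<partial>I_meas) + norm m powr p)" using Di by simp
  also have "\<dots> \<le> 2 powr p * (d + d)" using mle N by (intro mult_left_mono) auto
  also have "\<dots> = e" by (simp add: d_def)
  finally show ?thesis using h2 by blast
qed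

lemma haar_dense:
  assumes p: "1 < p" "p \<le> 2" and g: "in_Lp0 p g" and e: "e > 0"
  shows "\<exists>K b. (\<integral>t. norm (g t - haar_poly K b t) powr p \<partial>I_meas) \<le> e"
proof -
  define d where "d = e / (2 * 2 powr p)"
  have d: "d > 0" using e by (simp add: d_def)
  from bounded_dense[OF p g d] obtain h where h: "in_Lp0 2 h" "(\<integral>t. norm (g t - h t) powr p \<partial>I_meas) \<le> d" by blast
  note gD = in_Lp0_D[OF p(1) g] and hD = in_Lp0_D[OF _ h(1), simplified]
  have hp: "in_Lp p h" using in_Lp_mono[of p 2 h] p hD(1) by simp
  \<comment> \<open>\<open>s\<close> and \<open>\<epsilon>\<close> make both terms of
    \<open>powr_le_split\<close>, integrated over \<open>u\<close>, at most
    \<open>d / 2\<close>.\<close>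
  define s where "s = (d / 2) powr (1 / p)"
  have s: "s > 0" "s powr p = d / 2" using d p by (auto simp: s_def powr_powr)
  define \<epsilon> where "\<epsilon> = d / 2 / s powr (p - 2)"
  have \<epsilon>: "\<epsilon> > 0" using d s by (simp add: \<epsilon>_def)
  have "hnorm 2 k (coef h) \<le> (\<integral>t. norm (h t) powr 2 \<partial>I_meas)" for k by (rule hnorm_coef_le) (use h in auto)
  from L2_tail[OF this \<epsilon>] obtain K where K: "\<And>k. hnorm 2 k (\<lambda>n. coef h n - trunc K (coef h) n) \<le> \<epsilon>" by blast
  define q where "q = haar_poly K (coef h)"
  have q2: "in_Lp0 2 q" unfolding q_def by (rule haar_poly_in_Lp0) simp
  have qp: "in_Lp0 p q" unfolding q_def by (rule haar_poly_in_Lp0) (rule p)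
  note qD = in_Lp0_D[OF _ q2, simplified]
  define u where "u t = h t - q t" for t
  have u2: "in_Lp0 2 u" unfolding u_def[abs_def] by (rule in_Lp0_diff) (use h q2 in auto)
  note uD = in_Lp0_D[OF _ u2, simplified]
  have up: "in_Lp p u" using in_Lp_mono[of p 2 u] p uD(1) by simp
  have "(\<integral>t. norm (u t) powr 2 \<partial>I_meas) \<le> \<epsilon>"
  proof (rule in_Lp_if_hnorm_bounded(2)[where N = 0])
    fix k
    have "hnorm 2 k (coef u) = hnorm 2 k (\<lambda>n. coef h n - trunc K (coef h) n)"
    proof (rule hnorm_cong)
      fix n :: nat assume n: "n > 0"
      show "coef u n = coef h n - trunc K (coef h) n"
        using coef_lincomb[OF hD(2) qD(2) n, of 1 "-1"] coef_haar_poly[OF n] by (simp add: u_def[abs_def] q_def)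
    qed
    with K show "hnorm 2 k (coef u) \<le> \<epsilon>" by simp
  qed (use uD in auto)
  then have u2': "(\<integral>t. (norm (u t))\<^sup>2 \<partial>I_meas) \<le> \<epsilon>" by simp
  have ui: "integrable I_meas (\<lambda>t. (norm (u t))\<^sup>2)" using uD(5) by simp
  have "(\<integral>t. norm (u t) powr p \<partial>I_meas) \<le> (\<integral>t. s powr (p - 2) * (norm (u t))\<^sup>2 + s powr p \<partial>I_meas)"
    using ui up p s by (intro integral_mono powr_le_split) (auto simp: in_Lp_def)
  also have "\<dots> = s powr (p - 2) * (\<integral>t. (norm (u t))\<^sup>2 \<partial>I_meas) + s powr p" using ui by simp
  also have "\<dots> \<le> s powr (p - 2) * \<epsilon> + s powr p" using u2' by (intro add_right_mono mult_left_mono) auto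
  also have "\<dots> = d" using s by (simp add: \<epsilon>_def)
  finally have ud: "(\<integral>t. norm (u t) powr p \<partial>I_meas) \<le> d" .
  have ghi: "integrable I_meas (\<lambda>t. norm (g t - h t) powr p)"
    using in_Lp_lincomb[of p g h 1 "-1"] gD hp p by (simp add: in_Lp_def)
  have upi: "integrable I_meas (\<lambda>t. norm (u t) powr p)" using up by (simp add: in_Lp_def)
  have "(\<integral>t. norm (g t - q t) powr p \<partial>I_meas) \<le> (\<integral>t. 2 powr p * (norm (g t - h t) powr p + norm (u t) powr p) \<partial>I_meas)"
  proof (rule integral_mono)
    show "integrable I_meas (\<lambda>t. norm (g t - q t) powr p)" by (rule in_Lp0_D(5)[OF p(1) in_Lp0_diff[OF p(1) g qp]])
    fix t
    show "norm (g t - q t) powr p \<le> 2 powr p * (norm (g t - h t) powr p + norm (u t) powr p)"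
      using norm_add_powr_le[of p "g t - h t" "u t"] p by (simp add: u_def)
  qed (use ghi upi in auto)
  also have "\<dots> = 2 powr p * ((\<integral>t. norm (g t - h t) powr p \<partial>I_meas) + (\<integral>t. norm (u t) powr p \<partial>I_meas))"
    using ghi upi by simp
  also have "\<dots> \<le> 2 powr p * (d + d)" using h(2) ud by (intro mult_left_mono add_mono) auto
  also have "\<dots> = e" by (simp add: d_def)
  finally show ?thesis unfolding q_def by blast
qed

lemma conv_cong:
  assumes "\<And>n. n > 0 \<Longrightarrow> a n = b n" "n > 0"
  shows "conv c a n = conv c b n"
  unfolding conv_def
proof (intro sum.cong refl)
  fix i assume "i \<in> {i. i < n \<and> 2 ^ i dvd n}"
  then have "n = 2 ^ i * (n div 2 ^ i)" by simp
  then have "n div 2 ^ i > 0" using assms(2) by (metis gr0I mult_0_right)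
  then show "c i * a (n div 2 ^ i) = c i * b (n div 2 ^ i)" using assms(1) by simp
qed

text \<open>Even for a Haar polynomial the convolved sequence can have infinitely many terms. The
  L^2 bound realises it by a function, and the L^p bound then transfers the approximation of
  \<open>g\<close> by Haar polynomials to the images.\<close>

lemma conv_realize:
  assumes p: "1 < p" "p \<le> 2" and C: "0 \<le> C" "Lp_bd p C (conv c)" and C2: "0 \<le> C2" "Lp_bd 2 C2 (conv c)"
    and g: "in_Lp0 p g"
  shows "\<exists>F. in_Lp0 p F \<and> (\<forall>n>0. coef F n = conv c (coef g) n)"
proof (rule riesz_fischer[OF p(1)])
  fix e :: real assume e: "e > 0"
  then have "e / (C + 1) > 0" using C by simp
  from haar_dense[OF p g this] obtain K b where K: "(\<integral>t. norm (g t - haar_poly K b t) powr p \<partial>I_meas) \<le> e / (C + 1)" by blast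
  define q where "q = haar_poly K b"
  have q2: "in_Lp0 2 q" unfolding q_def by (rule haar_poly_in_Lp0) simp
  have qp: "in_Lp0 p q" unfolding q_def by (rule haar_poly_in_Lp0) (rule p)
  have "hnorm 2 k (conv c (coef q)) \<le> C2 * (\<integral>t. norm (q t) powr 2 \<partial>I_meas)" for k
  proof -
    have "hnorm 2 k (conv c (coef q)) \<le> C2 * hnorm 2 k (coef q)" using C2(2) unfolding Lp_bd_hnorm by blast
    also have "\<dots> \<le> C2 * (\<integral>t. norm (q t) powr 2 \<partial>I_meas)"
      using C2(1) q2 by (intro mult_left_mono hnorm_coef_le) auto
    finally show ?thesis .
  qed
  from riesz_fischer_L2[OF this] obtain F where F: "in_Lp0 2 F" "\<And>n. n > 0 \<Longrightarrow> coef F n = conv c (coef q) n" by blast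
  have Fp: "in_Lp0 p F" using F(1) in_Lp_mono[of p 2 F] p by (simp add: in_Lp0_def)
  have "hnorm p k (\<lambda>n. conv c (coef g) n - coef F n) \<le> e" for k
  proof -
    have "hnorm p k (\<lambda>n. conv c (coef g) n - coef F n) = hnorm p k (conv c (coef (\<lambda>t. g t - q t)))"
    proof (rule hnorm_cong)
      fix n :: nat assume n: "n > 0"
      have "conv c (coef (\<lambda>t. g t - q t)) n = conv c (\<lambda>n. coef g n - coef q n) n"
        using coef_lincomb[OF in_Lp0_D(2)[OF p(1) g] in_Lp0_D(2)[OF p(1) qp], of _ 1 "-1"]
        by (intro conv_cong n) simp
      then show "conv c (coef g) n - coef F n = conv c (coef (\<lambda>t. g t - q t)) n" using F(2)[OF n] by (simp add: conv_diff)
    qed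
    also have "\<dots> \<le> C * hnorm p k (coef (\<lambda>t. g t - q t))" using C(2) unfolding Lp_bd_hnorm by blast
    also have "\<dots> \<le> C * (\<integral>t. norm (g t - q t) powr p \<partial>I_meas)"
      using C(1) p g qp by (intro mult_left_mono hnorm_coef_le in_Lp0_diff) auto
    also have "\<dots> \<le> C * (e / (C + 1))" using C(1) K by (intro mult_left_mono) (auto simp: q_def)
    also have "\<dots> \<le> e" using C(1) e by (simp add: field_simps)
    finally show ?thesis .
  qed
  with Fp show "\<exists>F. in_Lp0 p F \<and> (\<forall>k. hnorm p k (\<lambda>n. conv c (coef g) n - coef F n) \<le> e)" by blast
qed


section \<open>Equivalence with the Haar system\<close>

lemma Lp_norm_le_if_integral_le:
  assumes "0 < p" "0 \<le> C" "(\<integral>t. norm (u t) powr p \<partial>I_meas) \<le> C * (\<integral>t. norm (v t) powr p \<partial>I_meas)"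
  shows "Lp_norm p u \<le> C powr (1 / p) * Lp_norm p v"
proof -
  have "Lp_norm p u \<le> (C * (\<integral>t. norm (v t) powr p \<partial>I_meas)) powr (1 / p)"
    unfolding Lp_norm_def using assms by (intro powr_mono2) auto
  then show ?thesis by (simp add: Lp_norm_def powr_mult)
qed

text \<open>\<open>equiv_haar\<close> puts no sign on its constants, hence
  \<open>max C 0\<close>.\<close>

lemma integral_le_if_Lp_norm_le:
  assumes p: "0 < p" and "Lp_norm p u \<le> C * Lp_norm p v"
  shows "(\<integral>t. norm (u t) powr p \<partial>I_meas) \<le> (max C 0) powr p * (\<integral>t. norm (v t) powr p \<partial>I_meas)"
proof -
  have n: "Lp_norm p w powr p = (\<integral>t. norm (w t) powr p \<partial>I_meas)" for w
    using p by (simp add: Lp_norm_def powr_powr)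
  have n0: "0 \<le> Lp_norm p w" for w by (simp add: Lp_norm_def)
  have "Lp_norm p u \<le> max C 0 * Lp_norm p v"
    using assms(2) mult_right_mono[OF _ n0[of v], of C "max C 0"] by simp
  then have "Lp_norm p u powr p \<le> (max C 0 * Lp_norm p v) powr p" using p n0 by (intro powr_mono2) auto
  then show ?thesis by (simp add: powr_mult n)
qed

lemma conv_integral_bound:
  assumes p: "1 < p" and C: "0 \<le> C" "Lp_bd p C (conv c)" and u: "in_Lp0 p u" and v: "in_Lp0 p v"
    and eq: "\<And>n. n > 0 \<Longrightarrow> coef u n = conv c (coef v) n"
  shows "(\<integral>t. norm (u t) powr p \<partial>I_meas) \<le> C * (\<integral>t. norm (v t) powr p \<partial>I_meas)"
proof (rule in_Lp_if_hnorm_bounded(2)[where N = 0])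
  fix k
  have "hnorm p k (coef u) = hnorm p k (conv c (coef v))" by (rule hnorm_cong[OF eq])
  also have "\<dots> \<le> C * hnorm p k (coef v)" using C(2) unfolding Lp_bd_hnorm by blast
  also have "\<dots> \<le> C * (\<integral>t. norm (v t) powr p \<partial>I_meas)" using C(1) p v by (intro mult_left_mono hnorm_coef_le)
  finally show "hnorm p k (coef u) \<le> C * (\<integral>t. norm (v t) powr p \<partial>I_meas)" .
qed (use p in_Lp0_D[OF p u] in auto)

lemma dil_mean_zero:
  fixes f :: "real \<Rightarrow> complex"
  assumes "integrable I_meas f" "integral\<^sup>L I_meas f = 0" "n > 0"
  shows "integral\<^sup>L I_meas (dil f n) = 0"
  using avg_dil_low[OF assms, of 1 "floor_log n"] by (simp add: avg_one)

lemma equiv_haarI: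
  assumes p: "1 < p" "p \<le> 2"
    and f: "integrable I_meas f" "integral\<^sup>L I_meas f = 0" "\<And>m. m > 0 \<Longrightarrow> coef f m = conv c (unit 1) m"
    and cd: "Abs_fps c * Abs_fps d = 1"
    and C: "0 \<le> C" "Lp_bd p C (conv c)" and C2: "0 \<le> C2" "Lp_bd 2 C2 (conv c)"
    and D: "0 \<le> D" "Lp_bd p D (conv d)" and D2: "0 \<le> D2" "Lp_bd 2 D2 (conv d)"
  shows "equiv_haar p f"
proof -
  \<comment> \<open>The coefficients determine the image only almost everywhere, so a representative
    is chosen, and linearity and the images of the Haar functions are recovered from
    \<open>coef_unique\<close>.\<close>
  define T where "T g = (SOME F. in_Lp0 p F \<and> (\<forall>n>0. coef F n = conv c (coef g) n))" for g
  have T: "in_Lp0 p (T g)" "\<And>n. n > 0 \<Longrightarrow> coef (T g) n = conv c (coef g) n" if "in_Lp0 p g" for g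
    using someI_ex[OF conv_realize[OF p C C2 that]] unfolding T_def by blast+
  have inv: "coef g n = conv d (coef (T g)) n" if "in_Lp0 p g" "n > 0" for g n
  proof -
    have "conv d (coef (T g)) n = conv d (conv c (coef g)) n" by (rule conv_cong[OF T(2)[OF that(1)] that(2)])
    also have "\<dots> = coef g n" using cd that(2) by (intro conv_inverse) (simp add: mult.commute)
    finally show ?thesis by simp
  qed
  have 2: "AE t in I_meas. T (\<lambda>s. a * g s + b * h s) t = a * T g t + b * T h t" if "in_Lp0 p g" "in_Lp0 p h" for g h a b
  proof -
    have gh: "in_Lp0 p (\<lambda>s. a * g s + b * h s)" by (rule in_Lp0_lincomb[OF p(1) that])
    have Tgh: "in_Lp0 p (\<lambda>s. a * T g s + b * T h s)" by (rule in_Lp0_lincomb[OF p(1) T(1) T(1)]) fact+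
    show ?thesis
    proof (rule coef_unique)
      fix n :: nat assume n: "n > 0"
      have "coef (T (\<lambda>s. a * g s + b * h s)) n = conv c (coef (\<lambda>s. a * g s + b * h s)) n" by (rule T(2)[OF gh n])
      also have "\<dots> = conv c (\<lambda>n. a * coef g n + b * coef h n) n"
        using in_Lp0_D(2)[OF p(1)] that by (intro conv_cong n coef_lincomb) auto
      also have "\<dots> = a * conv c (coef g) n + b * conv c (coef h) n" by (rule conv_add)
      also have "\<dots> = a * coef (T g) n + b * coef (T h) n" using T(2) that n by simp
      also have "\<dots> = coef (\<lambda>s. a * T g s + b * T h s) n"
        by (rule coef_lincomb[symmetric]) (use in_Lp0_D(2)[OF p(1)] T(1) that n in auto)
      finally show "coef (T (\<lambda>s. a * g s + b * h s)) n = coef (\<lambda>s. a * T g s + b * T h s) n" .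
    qed (use in_Lp0_D[OF p(1) T(1)[OF gh]] in_Lp0_D[OF p(1) Tgh] in auto)
  qed
  have 3: "Lp_norm p (T g) \<le> C powr (1 / p) * Lp_norm p g" if "in_Lp0 p g" for g
    using p C by (intro Lp_norm_le_if_integral_le conv_integral_bound[OF p(1) C T(1)[OF that] that T(2)[OF that]]) auto
  have 4: "Lp_norm p g \<le> D powr (1 / p) * Lp_norm p (T g)" if "in_Lp0 p g" for g
    using p D by (intro Lp_norm_le_if_integral_le conv_integral_bound[OF p(1) D that T(1)[OF that] inv[OF that]]) auto
  have 5: "\<exists>g. in_Lp0 p g \<and> (AE t in I_meas. T g t = h t)" if h: "in_Lp0 p h" for h
  proof -
    from conv_realize[OF p D D2 h] obtain g where g: "in_Lp0 p g" "\<And>n. n > 0 \<Longrightarrow> coef g n = conv d (coef h) n" by blast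
    have "AE t in I_meas. T g t = h t"
    proof (rule coef_unique)
      fix n :: nat assume n: "n > 0"
      have "coef (T g) n = conv c (coef g) n" by (rule T(2)[OF g(1) n])
      also have "\<dots> = conv c (conv d (coef h)) n" by (rule conv_cong[OF g(2) n])
      also have "\<dots> = coef h n" by (rule conv_inverse[OF cd n])
      finally show "coef (T g) n = coef h n" .
    qed (use in_Lp0_D[OF p(1) T(1)[OF g(1)]] in_Lp0_D[OF p(1) h] in auto)
    with g(1) show ?thesis by blast
  qed
  have 6: "AE t in I_meas. T (dil haar n) t = dil f n t" if n: "n > 0" for n
  proof (rule coef_unique)
    note h = haar_dil_in_Lp0[OF p(1) n]
    show "integrable I_meas (T (dil haar n))" "integral\<^sup>L I_meas (T (dil haar n)) = 0"
      using in_Lp0_D[OF p(1) T(1)[OF h]] by auto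
    show "integrable I_meas (dil f n)" by (rule integrable_dil[OF n f(1)])
    show "integral\<^sup>L I_meas (dil f n) = 0" by (rule dil_mean_zero[OF f(1,2) n])
    fix m :: nat assume m: "m > 0"
    have "coef (T (dil haar n)) m = conv c (coef (dil haar n)) m" by (rule T(2)[OF h m])
    also have "\<dots> = conv c (unit n) m" by (rule conv_cong[OF coef_haar_dil[OF n] m])
    also have "\<dots> = coef (dil f n) m" by (rule coef_dil[OF f n m, symmetric])
    finally show "coef (T (dil haar n)) m = coef (dil f n) m" .
  qed
  show ?thesis unfolding equiv_haar_def
    by (intro exI[of _ T] conjI allI impI exI[of _ "C powr (1 / p)"] exI[of _ "D powr (1 / p)"])
      (use T(1) 2 3 4 5 6 in auto)
qed

lemma conv_sum: "conv c (\<lambda>i. \<Sum>n\<in>A. a n * b n i) m = (\<Sum>n\<in>A. a n * conv c (b n) m)"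
proof (induction A rule: infinite_finite_induct)
  case (insert n A)
  then show ?case using conv_add[of c "a n" "b n" 1 "\<lambda>i. \<Sum>n\<in>A. a n * b n i" m] by simp
qed (simp_all add: conv_def)

text \<open>Level \<open>k\<close> involves only nodes below \<open>2 ^ k\<close>, and
  \<open>conv\<close> reads only ancestors. So a bound tested on Haar polynomials holds for every
  sequence.\<close>

lemma hnorm_conv_trunc: "hnorm p k (conv c (trunc k a)) = hnorm p k (conv c a)"
proof -
  have "conv c (trunc k a) n = conv c a n" if "n < 2 ^ k" for n
    unfolding conv_def
  proof (intro sum.cong refl)
    fix i
    have "n div 2 ^ i \<le> n" by simp
    with that have "n div 2 ^ i < 2 ^ k" by linarith
    then show "c i * trunc k a (n div 2 ^ i) = c i * a (n div 2 ^ i)" by (simp add: trunc_def)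
  qed
  then have "trunc k (conv c (trunc k a)) = trunc k (conv c a)" by (auto simp: trunc_def)
  then show ?thesis using hnorm_trunc_same[of k k p "conv c (trunc k a)"] hnorm_trunc_same[of k k p "conv c a"] by simp
qed

lemma haar_poly_integral_le:
  assumes "1 < p"
  shows "(\<integral>t. norm (haar_poly K a t) powr p \<partial>I_meas) \<le> hnorm p K a"
proof (rule in_Lp_if_hnorm_bounded(2)[where N = K])
  fix k assume "k \<ge> K"
  then obtain i where "k = K + i" by (auto simp: le_iff_add)
  moreover have "hnorm p k (coef (haar_poly K a)) = hnorm p k (trunc K a)" by (rule hnorm_cong[OF coef_haar_poly])
  ultimately show "hnorm p k (coef (haar_poly K a)) \<le> hnorm p K a" by (simp add: hnorm_trunc)
qed (use assms in_Lp0_D[OF assms haar_poly_in_Lp0[OF assms]] in auto)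

text \<open>The given isomorphism is identified with \<open>conv c\<close> on coefficients. Testing
  it on Haar polynomials turns its upper bound into a tree bound; preimages of Haar polynomials and
  its lower bound do the same for the reciprocal series.\<close>

lemma equiv_haarD:
  assumes p: "1 < p" "p \<le> 2" and fi: "integrable I_meas f"
    and c: "\<And>t. t \<in> {0<..1} \<Longrightarrow> (\<lambda>i. c i * dil haar (2 ^ i) t) sums f t"
    and eq: "equiv_haar p f"
  shows "integral\<^sup>L I_meas f = 0" "\<exists>C\<ge>0. Lp_bd p C (conv c)"
    "\<exists>d. Abs_fps c * Abs_fps d = 1 \<and> (\<exists>D\<ge>0. Lp_bd p D (conv d))"
proof -
  from eq obtain T C0 D0 where T0: "\<And>g. in_Lp0 p g \<Longrightarrow> in_Lp0 p (T g)"
    and lin: "\<And>g h a b. in_Lp0 p g \<Longrightarrow> in_Lp0 p h \<Longrightarrow> AE t in I_meas. T (\<lambda>s. a * g s + b * h s) t = a * T g t + b * T h t"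
    and up: "\<And>g. in_Lp0 p g \<Longrightarrow> Lp_norm p (T g) \<le> C0 * Lp_norm p g"
    and low: "\<And>g. in_Lp0 p g \<Longrightarrow> Lp_norm p g \<le> D0 * Lp_norm p (T g)"
    and onto: "\<And>h. in_Lp0 p h \<Longrightarrow> \<exists>g. in_Lp0 p g \<and> (AE t in I_meas. T g t = h t)"
    and Th: "\<And>n. n \<ge> 1 \<Longrightarrow> AE t in I_meas. T (dil haar n) t = dil f n t"
    unfolding equiv_haar_def by blast
  define C D where "C = (max C0 0) powr p" and "D = (max D0 0) powr p"
  have C: "0 \<le> C" and D: "0 \<le> D" by (simp_all add: C_def D_def)
  have up': "(\<integral>t. norm (T g t) powr p \<partial>I_meas) \<le> C * (\<integral>t. norm (g t) powr p \<partial>I_meas)" if "in_Lp0 p g" for g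
    unfolding C_def using p up[OF that] by (intro integral_le_if_Lp_norm_le) auto
  have low': "(\<integral>t. norm (g t) powr p \<partial>I_meas) \<le> D * (\<integral>t. norm (T g t) powr p \<partial>I_meas)" if "in_Lp0 p g" for g
    unfolding D_def using p low[OF that] by (intro integral_le_if_Lp_norm_le) auto
  note LD = in_Lp0_D[OF p(1)]
  have h1: "in_Lp0 p (dil haar 1)" by (rule haar_dil_in_Lp0[OF p(1)]) simp
  \<comment> \<open>A chaos in L^1 need not have mean zero: with \<open>c i = - (2 ^ i)\<close> it
    is the constant 1. Here the mean vanishes because \<open>f\<close> is almost everywhere the
    image of the first Haar function.\<close>
  show f0: "integral\<^sup>L I_meas f = 0"
  proof -
    have "integral\<^sup>L I_meas f = integral\<^sup>L I_meas (dil f 1)"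
      by (rule Bochner_Integration.integral_cong) (auto simp: dil_ivl)
    also have "\<dots> = integral\<^sup>L I_meas (T (dil haar 1))"
      using Th[of 1] LD(4)[OF T0[OF h1]] integrable_dil[of 1 f] fi by (intro integral_cong_AE) auto
    also have "\<dots> = 0" by (rule LD(3)[OF T0[OF h1]])
    finally show ?thesis .
  qed
  have Tdil: "coef (T (dil haar n)) m = conv c (unit n) m" if "n > 0" "m > 0" for n m
  proof -
    have "coef (T (dil haar n)) m = coef (dil f n) m"
      using Th[of n] that LD(4)[OF T0[OF haar_dil_in_Lp0[OF p(1) that(1)]]] integrable_dil[OF that(1) fi]
      by (intro coef_AE_cong) auto
    also have "\<dots> = conv c (unit n) m" by (rule coef_dil[OF fi f0 coef_chaos[OF fi f0 c] that])
    finally show ?thesis .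
  qed
  have Tsum: "coef (T (\<lambda>t. \<Sum>n\<in>A. a n * dil haar n t)) m = (\<Sum>n\<in>A. a n * conv c (unit n) m)"
    if "finite A" "\<And>n. n \<in> A \<Longrightarrow> n > 0" "m > 0" for A a m
    using that(1,2)
  proof (induction A rule: finite_induct)
    case empty
    have "AE t in I_meas. T (\<lambda>s. 0) t = 0" using lin[OF in_Lp0_zero in_Lp0_zero, of 0 0] by simp
    then have "coef (T (\<lambda>s. 0)) m = coef (\<lambda>t. 0) m"
      using LD(4)[OF T0[OF in_Lp0_zero]] that(3) by (intro coef_AE_cong) auto
    then show ?case by (simp add: coef_zero)
  next
    case (insert n A)
    let ?S = "\<lambda>t. \<Sum>n\<in>A. a n * dil haar n t"
    have S: "in_Lp0 p ?S" using insert by (intro in_Lp0_sum haar_dil_in_Lp0 p) auto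
    have h: "in_Lp0 p (dil haar n)" using insert by (intro haar_dil_in_Lp0 p) auto
    have l: "in_Lp0 p (\<lambda>s. a n * dil haar n s + 1 * ?S s)" by (rule in_Lp0_lincomb[OF p(1) h S])
    have r: "in_Lp0 p (\<lambda>s. a n * T (dil haar n) s + 1 * T ?S s)" by (rule in_Lp0_lincomb[OF p(1) T0[OF h] T0[OF S]])
    have "coef (T (\<lambda>s. a n * dil haar n s + 1 * ?S s)) m = coef (\<lambda>s. a n * T (dil haar n) s + 1 * T ?S s) m"
      by (rule coef_AE_cong[OF lin[OF h S] that(3) LD(4)[OF T0[OF l]] LD(4)[OF r]])
    also have "\<dots> = a n * coef (T (dil haar n)) m + 1 * coef (T ?S) m"
      by (rule coef_lincomb[OF LD(2)[OF T0[OF h]] LD(2)[OF T0[OF S]] that(3)])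
    finally show ?case using insert Tdil[of n m] that(3) by simp
  qed
  have Tpoly: "coef (T (haar_poly K a)) m = conv c (coef (haar_poly K a)) m" if m: "m > 0" for K a m
  proof -
    have "coef (T (haar_poly K a)) m = conv c (\<lambda>i. \<Sum>n\<in>{1..<2 ^ K}. a n * unit n i) m"
      unfolding haar_poly_def[abs_def] conv_sum using m by (intro Tsum) auto
    also have "\<dots> = conv c (coef (haar_poly K a)) m"
    proof (rule conv_cong[OF _ m])
      fix i :: nat assume i: "i > 0"
      have "(\<Sum>n\<in>{1..<2 ^ K}. a n * unit n i) = (\<Sum>n\<in>{1..<2 ^ K}. if i = n then a i else 0)"
        by (intro sum.cong) (auto simp: unit_def)
      then show "(\<Sum>n\<in>{1..<2 ^ K}. a n * unit n i) = coef (haar_poly K a) i"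
        using i by (simp add: coef_haar_poly trunc_def)
    qed
    finally show ?thesis .
  qed
  \<comment> \<open>Known for Haar polynomials, this extends by density: each side at
    \<open>m\<close> depends on finitely many averages, which are continuous on L^p, and
    \<open>T\<close> is bounded.\<close>
  have Tcoef: "coef (T g) m = conv c (coef g) m" if g: "in_Lp0 p g" and m: "m > 0" for g m
  proof -
    have "\<forall>i. \<exists>q. in_Lp0 p q \<and> (\<integral>t. norm (g t - q t) powr p \<partial>I_meas) \<le> (1 / 2 ^ i) powr p \<and>
      (\<forall>m>0. coef (T q) m = conv c (coef q) m)"
    proof
      fix i :: nat
      have "(1 / 2 ^ i) powr p > (0::real)" by simp
      from haar_dense[OF p g this] obtain K b where
        "(\<integral>t. norm (g t - haar_poly K b t) powr p \<partial>I_meas) \<le> (1 / 2 ^ i) powr p" by blast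
      then show "\<exists>q. in_Lp0 p q \<and> (\<integral>t. norm (g t - q t) powr p \<partial>I_meas) \<le> (1 / 2 ^ i) powr p \<and>
          (\<forall>m>0. coef (T q) m = conv c (coef q) m)"
        using haar_poly_in_Lp0[OF p(1)] Tpoly by (intro exI[of _ "haar_poly K b"]) auto
    qed
    then obtain q where q: "\<And>i. in_Lp0 p (q i)" "\<And>i. (\<integral>t. norm (g t - q i t) powr p \<partial>I_meas) \<le> (1 / 2 ^ i) powr p"
      "\<And>i m. m > 0 \<Longrightarrow> coef (T (q i)) m = conv c (coef (q i)) m" by metis
    have a1: "(\<lambda>i. avg (q i) n) \<longlonglongrightarrow> avg g n" if "n > 0" for n
      using q(2) by (intro avg_tendsto[OF p(1) LD(1)[OF q(1)] LD(1)[OF g] _ _ that, where M = 1]) (auto simp: norm_minus_commute)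
    have "(\<integral>t. norm (T (q i) t - T g t) powr p \<partial>I_meas) \<le> C * (1 / 2 ^ i) powr p" for i
    proof -
      have l: "in_Lp0 p (\<lambda>s. 1 * q i s + (- 1) * g s)" by (rule in_Lp0_lincomb[OF p(1) q(1) g])
      have [measurable]: "T (q i) \<in> borel_measurable I_meas" "T g \<in> borel_measurable I_meas"
        "T (\<lambda>s. 1 * q i s + (- 1) * g s) \<in> borel_measurable I_meas" using LD(4) T0 q(1) g l by blast+
      have "(\<integral>t. norm (T (q i) t - T g t) powr p \<partial>I_meas) = (\<integral>t. norm (T (\<lambda>s. 1 * q i s + (- 1) * g s) t) powr p \<partial>I_meas)"
      proof (rule integral_cong_AE)
        show "AE t in I_meas. norm (T (q i) t - T g t) powr p = norm (T (\<lambda>s. 1 * q i s + (- 1) * g s) t) powr p"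
          using lin[OF q(1)[of i] g, of 1 "- 1"] by eventually_elim simp
      qed measurable
      also have "\<dots> \<le> C * (\<integral>t. norm (1 * q i t + (- 1) * g t) powr p \<partial>I_meas)" by (rule up'[OF l])
      also have "(\<integral>t. norm (1 * q i t + (- 1) * g t) powr p \<partial>I_meas) = (\<integral>t. norm (g t - q i t) powr p \<partial>I_meas)"
        by (simp add: norm_minus_commute)
      also have "C * \<dots> \<le> C * (1 / 2 ^ i) powr p" using q(2) C by (intro mult_left_mono)
      finally show ?thesis .
    qed
    then have a2: "(\<lambda>i. avg (T (q i)) n) \<longlonglongrightarrow> avg (T g) n" if "n > 0" for n
      using that by (intro avg_tendsto[OF p(1) LD(1)[OF T0[OF q(1)]] LD(1)[OF T0[OF g]] _ C])
    have "(\<lambda>i. coef (T (q i)) m) \<longlonglongrightarrow> coef (T g) m"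
      unfolding coef_def using m by (intro tendsto_intros a2) auto
    moreover have "(\<lambda>i. conv c (coef (q i)) m) \<longlonglongrightarrow> conv c (coef g) m"
      unfolding conv_def
    proof (intro tendsto_sum tendsto_mult tendsto_const)
      fix j assume "j \<in> {j. j < m \<and> 2 ^ j dvd m}"
      then have "m = 2 ^ j * (m div 2 ^ j)" by simp
      then have "m div 2 ^ j > 0" using m by (metis gr0I mult_0_right)
      then show "(\<lambda>i. coef (q i) (m div 2 ^ j)) \<longlonglongrightarrow> coef g (m div 2 ^ j)"
        unfolding coef_def by (intro tendsto_intros a1) auto
    qed
    ultimately show ?thesis using q(3)[OF m] LIMSEQ_unique by simp
  qed
  have "hnorm p k (conv c a) \<le> C * hnorm p k a" for a k
  proof -
    note q = haar_poly_in_Lp0[OF p(1), of k a]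
    have "hnorm p k (conv c a) = hnorm p k (coef (T (haar_poly k a)))"
      unfolding hnorm_conv_trunc[of p k c a, symmetric]
    proof (rule hnorm_cong)
      fix n :: nat assume n: "n > 0"
      show "conv c (trunc k a) n = coef (T (haar_poly k a)) n"
        unfolding Tpoly[OF n] by (rule conv_cong[OF coef_haar_poly[symmetric] n])
    qed
    also have "\<dots> \<le> (\<integral>t. norm (T (haar_poly k a) t) powr p \<partial>I_meas)" by (rule hnorm_coef_le[OF p(1) T0[OF q]])
    also have "\<dots> \<le> C * (\<integral>t. norm (haar_poly k a t) powr p \<partial>I_meas)" by (rule up'[OF q])
    also have "\<dots> \<le> C * hnorm p k a" using C by (intro mult_left_mono haar_poly_integral_le p)
    finally show ?thesis .
  qed
  then show "\<exists>C\<ge>0. Lp_bd p C (conv c)" using C unfolding Lp_bd_hnorm by blast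
  \<comment> \<open>At the root, convolution multiplies by \<open>c 0\<close>. The first Haar
    function has root coefficient 1 and is attained by \<open>T\<close>, so the series is
    invertible.\<close>
  have "c 0 \<noteq> 0"
  proof
    assume c0: "c 0 = 0"
    from onto[OF h1] obtain g where g: "in_Lp0 p g" "AE t in I_meas. T g t = dil haar 1 t" by blast
    have "coef (T g) 1 = coef (dil haar 1) 1"
      by (rule coef_AE_cong[OF g(2) _ LD(4)[OF T0[OF g(1)]] LD(4)[OF h1]]) simp
    also have "\<dots> = 1" by (simp add: coef_haar_dil unit_def)
    finally have "conv c (coef g) 1 = 1" using Tcoef[OF g(1), of 1] by simp
    moreover have "conv c (coef g) 1 = 0" using conv_odd[of 1 c "coef g" 0] c0 by simp
    ultimately show False by simp
  qed
  define d where "d = fps_nth (inverse (Abs_fps c))"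
  have cd: "Abs_fps c * Abs_fps d = 1"
  proof -
    have "Abs_fps d = inverse (Abs_fps c)" by (simp add: fps_eq_iff d_def)
    then show ?thesis using \<open>c 0 \<noteq> 0\<close> by (simp add: inverse_mult_eq_1')
  qed
  have "hnorm p k (conv d a) \<le> D * hnorm p k a" for a k
  proof -
    note q = haar_poly_in_Lp0[OF p(1), of k a]
    from onto[OF q] obtain g where g: "in_Lp0 p g" "AE t in I_meas. T g t = haar_poly k a t" by blast
    have Tg: "coef (T g) n = trunc k a n" if "n > 0" for n
      using coef_AE_cong[OF g(2) that LD(4)[OF T0[OF g(1)]] LD(4)[OF q]] coef_haar_poly[OF that] by simp
    have "hnorm p k (conv d a) = hnorm p k (coef g)"
      unfolding hnorm_conv_trunc[of p k d a, symmetric]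
    proof (rule hnorm_cong)
      fix n :: nat assume n: "n > 0"
      have "conv d (trunc k a) n = conv d (conv c (coef g)) n"
        using Tg Tcoef[OF g(1)] by (intro conv_cong n) simp
      also have "\<dots> = coef g n" using cd n by (intro conv_inverse) (simp add: mult.commute)
      finally show "conv d (trunc k a) n = coef g n" .
    qed
    also have "\<dots> \<le> (\<integral>t. norm (g t) powr p \<partial>I_meas)" by (rule hnorm_coef_le[OF p(1) g(1)])
    also have "\<dots> \<le> D * (\<integral>t. norm (T g t) powr p \<partial>I_meas)" by (rule low'[OF g(1)])
    also have "(\<integral>t. norm (T g t) powr p \<partial>I_meas) = (\<integral>t. norm (haar_poly k a t) powr p \<partial>I_meas)"
    proof (rule integral_cong_AE)
      have [measurable]: "T g \<in> borel_measurable I_meas" "haar_poly k a \<in> borel_measurable I_meas"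
        using LD(4) T0 g(1) q by blast+
      show "(\<lambda>t. norm (T g t) powr p) \<in> borel_measurable I_meas"
        "(\<lambda>t. norm (haar_poly k a t) powr p) \<in> borel_measurable I_meas" by measurable
      show "AE t in I_meas. norm (T g t) powr p = norm (haar_poly k a t) powr p"
        using g(2) by eventually_elim simp
    qed
    also have "D * \<dots> \<le> D * hnorm p k a" using D by (intro mult_left_mono haar_poly_integral_le p)
    finally show ?thesis .
  qed
  then have "Lp_bd p D (conv d)" unfolding Lp_bd_hnorm by blast
  with cd D show "\<exists>d. Abs_fps c * Abs_fps d = 1 \<and> (\<exists>D\<ge>0. Lp_bd p D (conv d))" by blast
qed

theorem theorem2:
  fixes f :: "real \<Rightarrow> complex"
  assumes "haar_chaos1 f" and "in_Lp 1 f"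
  shows "(\<exists>p. 1 < p \<and> p \<le> 2 \<and> in_Lp p f \<and> equiv_haar p f) \<longleftrightarrow>
         (in_Lp 2 f \<and> (\<forall>p. 1 < p \<and> p \<le> 2 \<longrightarrow> equiv_haar p f))"
proof
  assume "in_Lp 2 f \<and> (\<forall>p. 1 < p \<and> p \<le> 2 \<longrightarrow> equiv_haar p f)"
  then show "\<exists>p. 1 < p \<and> p \<le> 2 \<and> in_Lp p f \<and> equiv_haar p f" by (intro exI[of _ 2]) auto
next
  assume "\<exists>p. 1 < p \<and> p \<le> 2 \<and> in_Lp p f \<and> equiv_haar p f"
  then obtain p where p: "1 < p" "p \<le> 2" and eq: "equiv_haar p f" by blast
  have fi: "integrable I_meas f" using in_Lp_integrable[OF _ assms(2)] by simp
  obtain c where c: "\<And>t. t \<in> {0<..1} \<Longrightarrow> (\<lambda>i. c i * dil haar (2 ^ i) t) sums f t"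
    using assms(1) unfolding haar_chaos1_def by blast
  note ED = equiv_haarD[OF p fi c eq]
  \<comment> \<open>\<open>conv_Lp_imp_L2\<close> is stated for \<open>p < 2\<close>; at
    \<open>p = 2\<close> there is nothing to prove.\<close>
  have L2: "\<exists>C\<ge>0. Lp_bd 2 C (conv b)" if "\<exists>C\<ge>0. Lp_bd p C (conv b)" for b
    using that conv_Lp_imp_L2[OF p(1)] p(2) by (cases "p = 2") force+
  obtain d where d: "Abs_fps c * Abs_fps d = 1" "\<exists>D\<ge>0. Lp_bd p D (conv d)" using ED(3) by blast
  obtain C where C: "0 \<le> C" "Lp_bd 2 C (conv c)" using L2[OF ED(2)] by blast
  obtain D where D: "0 \<le> D" "Lp_bd 2 D (conv d)" using L2[OF d(2)] by blast
  note coef = coef_chaos[OF fi ED(1) c]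
  have h1: "in_Lp0 2 (dil haar 1)" by (rule haar_dil_in_Lp0) auto
  \<comment> \<open>On coefficients \<open>f\<close> is the image of the unit vector at the root, so
    the L^2 bound of \<open>conv c\<close> alone puts it in L^2.\<close>
  have "in_Lp 2 f"
  proof (rule in_Lp_if_hnorm_bounded(1)[OF _ fi ED(1), where N = 0])
    fix k
    have "hnorm 2 k (coef f) = hnorm 2 k (conv c (unit 1))" by (rule hnorm_cong[OF coef])
    also have "\<dots> \<le> C * hnorm 2 k (unit 1)" using C(2) unfolding Lp_bd_hnorm by blast
    also have "hnorm 2 k (unit 1) = hnorm 2 k (coef (dil haar 1))"
      by (rule hnorm_cong) (simp add: coef_haar_dil)
    also have "C * \<dots> \<le> C * (\<integral>t. norm (dil haar 1 t) powr 2 \<partial>I_meas)"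
      using C(1) h1 by (intro mult_left_mono hnorm_coef_le) auto
    finally show "hnorm 2 k (coef f) \<le> C * (\<integral>t. norm (dil haar 1 t) powr 2 \<partial>I_meas)" .
  qed simp
  moreover have "equiv_haar q f" if q: "1 < q" "q \<le> 2" for q
  proof -
    obtain C' where C': "0 \<le> C'" "Lp_bd q C' (conv c)" using conv_L2_imp_Lp[OF q C] by blast
    obtain D' where D': "0 \<le> D'" "Lp_bd q D' (conv d)" using conv_L2_imp_Lp[OF q D] by blast
    show ?thesis by (rule equiv_haarI[OF q fi ED(1) coef d(1) C' C D' D])
  qed
  ultimately show "in_Lp 2 f \<and> (\<forall>p. 1 < p \<and> p \<le> 2 \<longrightarrow> equiv_haar p f)" by blast
qed

end
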